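(* For every integer $N\ge 2$, the maximal efficiency $\mathrm{Eff}(N)$ of a point-push protocol in the presence of $N$ obstacles satisfies $$\frac{\log(3^N-3N-1)-\log N}{N}\ \le\ \frac{\log \rho(H^{(N)})}{N}\ \le\ \mathrm{Eff}(N)\ \le\ \frac{\log\rho(\hat H^{(N)})}{N}\ \le\ \frac{\log(3^N-2)}{N},$$ where $H^{(N)}$ and $\hat H^{(N)}$ are the explicit $N\times N$ integer matrices defined in the context and $\rho$ denotes spectral radius. Consequently $\mathrm{Eff}(N)\to\log 3$ as $N\to\infty$.
   Context: **Matrices.** For $1\le k\le N$ let $E^{(k)}=I+T^{(k)}$, where $T^{(k)}$ is the $N\times N$ matrix with $T^{(k)}_{kj}=2(-1)^{k-j+1}$ for $1\le j\le k-1$, $T^{(k)}_{kk}=0$, $T^{(k)}_{kj}=2(-1)^{j-k}$ for $k+1\le j\le N$, and $T^{(k)}_{ij}=0$ for $i\ne k$. Let $A^{(k)}=I+S^{(k)}$, where $S^{(k)}$ is the $N\times N$ matrix with $S^{(k)}_{kk}=0$, $S^{(k)}_{kj}=2$ for $j\neq k$, and $S^{(k)}_{ij}=0$ for $i\neq k$. Put $H^{(N)}=E^{(1)}E^{(2)}\cdots E^{(N)}$ and $\hat H^{(N)}=A^{(1)}A^{(2)}\cdots A^{(N)}$. **Point-push protocols.** Let $D_{N+1}$ be the disk with $N+1$ punctures, arranged left to right; the left-most puncture is the stirrer $P$ and the other $N$ are the obstacles. The braid group $B_{N+1}$ with standard generators $\sigma_1,\dots,\sigma_N$ ($\sigma_i$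 switches the $i$th and $(i+1)$st punctures counterclockwise) is identified with the group of isotopy classes of homeomorphisms of $D_{N+1}$ (homeomorphisms and isotopies fix the boundary of the disk pointwise); words are read left to right, i.e. $\sigma_1\sigma_2$ means first $\sigma_1$, then $\sigma_2$. For $1\le i\le N$ put $\alpha_i=\sigma_1\sigma_2\cdots\sigma_{i-1}\sigma_i^2\sigma_{i-1}^{-1}\cdots\sigma_2^{-1}\sigma_1^{-1}$ (the stirrer goes once counterclockwise around the $i$th obstacle). The group $\mathcal P_N$ of point-push protocols is the subgroup of the pure braid group on $N+1$ strings consisting of the classes that become trivial when the stirrer puncture is filled in; it is free on $\alpha_1,\dots,\alpha_N$. **Action on $\pi_1$.** $\pi_1(D_{N+1},Q)$ is free on loops $\delta_1,\dots,\delta_{N+1}$, where for $i\le N$ the loop $\delta_i$ goes counterclockwise around the $i$th obstacle and $\delta_{N+1}$ goes clockwise around the stirrer and all obstacles, chosen so that (with representatives fixing $Q$) the action is $\alpha_j(\delta_j)=w_j^{-1}\delta_j w_j$ with $w_j=\delta_{j+1}\cdots\delta_N\delta_{N+1}\delta_1\cdots\delta_{j-1}$, and $\alpha_j(\delta_i)=\delta_i$ for $i\ne j$. **Efficiency.** For an automorphism $a$ of a group with finite generating set $x_1,\dots,x_m$ and word length $\ell$, its entropy is $h(a)=\max_i\limsup_{n\to\infty}\frac1n\log \ell(a^n(x_i))$. For $\chi\in\mathcal P_N$ let $\chi_\sharp$ be the induced automorphism of $\pi_1(D_{N+1},Q)$ and let $L(\chi)$ be the minimal word length of $\chi$ in $\alpha_1^{\pm1},\dots,\alpha_N^{\pm1}$.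 Then $\mathrm{eff}(\chi)=h(\chi_\sharp)/L(\chi)$ (for $\chi\ne 1$) and $\mathrm{Eff}(N)=\sup\{\mathrm{eff}(\chi):\chi\in\mathcal P_N,\ \chi\neq 1\}$. *)

theory Defs
  imports
    "HOL-Analysis.Analysis"
    "HOL-Algebra.Bij"
    "HOL-Algebra.Generated_Groups"
    "Jordan_Normal_Form.Spectral_Radius"
begin

section \<open>Free groups\<close>

text \<open>A letter \<open>(x, True)\<close> stands for the generator \<open>x\<close>, and \<open>(x, False)\<close> for its inverse.\<close>

type_synonym 'x gword = "('x \<times> bool) list"

definition cancelling :: "'x \<times> bool \<Rightarrow> 'x \<times> bool \<Rightarrow> bool" where
  "cancelling a b \<longleftrightarrow> fst a = fst b \<and> snd a \<noteq> snd b"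

definition reduced_word :: "'x gword \<Rightarrow> bool" where
  "reduced_word w \<longleftrightarrow> successively (\<lambda>a b. \<not> cancelling a b) w"

fun cons_reduce :: "'x \<times> bool \<Rightarrow> 'x gword \<Rightarrow> 'x gword" where
  "cons_reduce a [] = [a]"
| "cons_reduce a (b # w) = (if cancelling a b then w else a # b # w)"

definition reduce :: "'x gword \<Rightarrow> 'x gword" where
  "reduce w = foldr cons_reduce w []"

definition free_group :: "'x set \<Rightarrow> 'x gword monoid" where
  "free_group X =
     \<lparr>carrier = {w. reduced_word w \<and> set w \<subseteq> X \<times> UNIV},
      mult = (\<lambda>u v. reduce (u @ v)),
      one = []\<rparr>"

text \<open>The value in \<open>G\<close> of a word whose letters \<open>x\<close> are interpreted as \<open>f x\<close>. On reduced words
  this is the homomorphism from the free group to \<open>G\<close> that extends \<open>f\<close>.\<close>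

definition eval_word :: "('a, 'm) monoid_scheme \<Rightarrow> ('x \<Rightarrow> 'a) \<Rightarrow> 'x gword \<Rightarrow> 'a" where
  "eval_word G f w =
     foldr (\<lambda>(x, pos) a. (if pos then f x else inv\<^bsub>G\<^esub> (f x)) \<otimes>\<^bsub>G\<^esub> a) w \<one>\<^bsub>G\<^esub>"

lemma reduced_word_cons_reduce: "reduced_word w \<Longrightarrow> reduced_word (cons_reduce a w)"
  by (cases w) (auto simp: reduced_word_def successively_Cons)

lemma reduced_word_foldr: "reduced_word w \<Longrightarrow> reduced_word (foldr cons_reduce u w)"
  by (induction u) (auto intro: reduced_word_cons_reduce)

lemma reduced_word_reduce: "reduced_word (reduce w)"
  unfolding reduce_def by (rule reduced_word_foldr) (simp add: reduced_word_def)

lemma reduce_reduced_word: "reduced_word w \<Longrightarrow> reduce w = w"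
proof (induction w)
  case (Cons a w)
  then have "reduce w = w" by (auto simp: reduced_word_def successively_Cons)
  then show ?case using Cons.prems
    by (cases w) (auto simp: reduce_def reduced_word_def)
qed (simp add: reduce_def)

lemma cons_reduce_cancel:
  "reduced_word w \<Longrightarrow> cancelling a b \<Longrightarrow> cons_reduce a (cons_reduce b w) = w"
proof (cases w)
  case (Cons c v)
  assume w: "reduced_word w" and ab: "cancelling a b"
  show ?thesis
  proof (cases "cancelling b c")
    case True
    then have "a = c" using ab by (auto simp: cancelling_def prod_eq_iff)
    then show ?thesis using Cons w True by (cases v) (auto simp: reduced_word_def)
  qed (simp add: Cons ab)
qed simp

lemma foldr_cons_reduce_cons_reduce:
  "reduced_word w \<Longrightarrow>
     foldr cons_reduce (cons_reduce a r) w = cons_reduce a (foldr cons_reduce r w)"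
  by (cases r) (auto simp: cons_reduce_cancel reduced_word_foldr)

lemma foldr_reduce: "reduced_word w \<Longrightarrow> foldr cons_reduce (reduce u) w = foldr cons_reduce u w"
  by (induction u) (simp_all add: reduce_def foldr_cons_reduce_cons_reduce)

lemma reduce_append: "reduce (u @ v) = foldr cons_reduce u (reduce v)"
  by (simp add: reduce_def)

lemma set_cons_reduce: "set (cons_reduce a w) \<subseteq> insert a (set w)"
  by (cases w) auto

lemma set_reduce: "set (reduce w) \<subseteq> set w"
proof (induction w)
  case (Cons a w)
  then show ?case using set_cons_reduce[of a "reduce w"] by (auto simp: reduce_def)
qed (simp add: reduce_def)

lemma reduce_reduce_append: "reduce (reduce u @ v) = reduce (u @ v)"
  by (simp add: reduce_append foldr_reduce reduced_word_reduce)

lemma reduce_append_reduce: "reduce (u @ reduce v) = reduce (u @ v)"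
  by (simp add: reduce_append reduce_reduced_word reduced_word_reduce)

lemma reduce_inverse_append: "reduce (rev (map (apsnd Not) w) @ w) = []"
proof (induction w)
  case (Cons a w)
  have "foldr cons_reduce [apsnd Not a, a] (reduce w) = reduce w"
    by (simp add: cons_reduce_cancel reduced_word_reduce cancelling_def)
  then have "reduce (rev (map (apsnd Not) (a # w)) @ a # w) =
      reduce (rev (map (apsnd Not) w) @ w)"
    by (simp add: reduce_def)
  with Cons show ?case by simp
qed (simp add: reduce_def)

lemma group_free_group: "group (free_group X)"
proof (rule groupI)
  fix u v assume "u \<in> carrier (free_group X)" "v \<in> carrier (free_group X)"
  then show "u \<otimes>\<^bsub>free_group X\<^esub> v \<in> carrier (free_group X)"
    using set_reduce[of "u @ v"] by (auto simp: free_group_def reduced_word_reduce)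
next
  fix u assume u: "u \<in> carrier (free_group X)"
  show "\<exists>v\<in>carrier (free_group X). v \<otimes>\<^bsub>free_group X\<^esub> u = \<one>\<^bsub>free_group X\<^esub>"
  proof (rule bexI[where x = "reduce (rev (map (apsnd Not) u))"])
    show "reduce (rev (map (apsnd Not) u)) \<in> carrier (free_group X)"
      using u set_reduce[of "rev (map (apsnd Not) u)"]
      by (fastforce simp: free_group_def reduced_word_reduce)
  qed (simp add: free_group_def reduce_reduce_append reduce_inverse_append)
qed (auto simp: free_group_def reduce_reduced_word reduce_reduce_append reduce_append_reduce
    reduced_word_def[of "[]"])

section \<open>Word length and entropy of automorphisms\<close>

definition word_length :: "('a, 'm) monoid_scheme \<Rightarrow> 'a set \<Rightarrow> 'a \<Rightarrow> nat" where
  "word_length G X g =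
     (LEAST n. \<exists>u. set u \<subseteq> X \<times> UNIV \<and> length u = n \<and> eval_word G (\<lambda>x. x) u = g)"

text \<open>\<open>X\<close> is a finite nonempty generating set of \<open>G\<close>. The convention \<open>ln 0 = 0\<close> matters only if a
  generator is the neutral element, which does not happen below.\<close>

definition entropy :: "('a, 'm) monoid_scheme \<Rightarrow> 'a set \<Rightarrow> ('a \<Rightarrow> 'a) \<Rightarrow> ereal" where
  "entropy G X a =
     (MAX x\<in>X. limsup (\<lambda>n. ereal (ln (real (word_length G X ((a ^^ n) x))) / real n)))"

section \<open>Braid groups\<close>

definition normal_closure :: "('a, 'm) monoid_scheme \<Rightarrow> 'a set \<Rightarrow> 'a set" where
  "normal_closure G R =
     generate G {g \<otimes>\<^bsub>G\<^esub> r \<otimes>\<^bsub>G\<^esub> inv\<^bsub>G\<^esub> g | g r. g \<in> carrier G \<and> r \<in> R}"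

text \<open>The braid group on \<open>n\<close> strings in Artin's presentation, with generators
  \<open>\<sigma>\<^sub>1, \<dots>, \<sigma>\<^sub>n\<^sub>-\<^sub>1\<close>.\<close>

definition braid_relators :: "nat \<Rightarrow> nat gword set" where
  "braid_relators n =
     {[(i, True), (Suc i, True), (i, True), (Suc i, False), (i, False), (Suc i, False)] | i.
        1 \<le> i \<and> Suc i < n} \<union>
     {[(i, True), (j, True), (i, False), (j, False)] | i j.
        1 \<le> i \<and> i + 2 \<le> j \<and> j < n}"

definition braid_group :: "nat \<Rightarrow> nat gword set monoid" where
  "braid_group n =
     free_group {1..<n} Mod normal_closure (free_group {1..<n}) (braid_relators n)"

definition sigma :: "nat \<Rightarrow> nat \<Rightarrow> nat gword set" where
  "sigma n i =
     normal_closure (free_group {1..<n}) (braid_relators n) #>\<^bsub>free_group {1..<n}\<^esub> [(i, True)]"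

text \<open>The permutation of the strings; only its triviality is used, so the order of composition is
  immaterial.\<close>

definition braid_perm :: "nat gword \<Rightarrow> nat \<Rightarrow> nat" where
  "braid_perm w = foldr (\<lambda>(i, _) \<pi>. Transposition.transpose i (Suc i) \<circ> \<pi>) w id"

section \<open>Point-push protocols\<close>

text \<open>Filling in the stirrer puncture is the removal of one string: \<open>fill_stirrer p w\<close> is the word in
  the generators of \<open>B\<^sub>N\<close> obtained from a word \<open>w\<close> in the generators of \<open>B\<^sub>N\<^sub>+\<^sub>1\<close>, read left to right,
  by deleting the string that starts at position \<open>p\<close> (which moves with every crossing it takes part
  in) and renumbering the remaining positions.\<close>

fun fill_stirrer :: "nat \<Rightarrow> nat gword \<Rightarrow> nat gword" where
  "fill_stirrer p [] = []"
| "fill_stirrer p ((i, pos) # w) =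
     (if i = p then fill_stirrer (Suc p) w
      else if Suc i = p then fill_stirrer i w
      else if Suc i < p then (i, pos) # fill_stirrer p w
      else (i - 1, pos) # fill_stirrer p w)"

text \<open>Elements of the braid group are cosets, that is, sets of reduced words representing the same
  braid; whether the conditions hold does not depend on the representative.\<close>

definition point_push :: "nat \<Rightarrow> nat gword set set" where
  "point_push N =
     {\<beta> \<in> carrier (braid_group (Suc N)).
        \<exists>w\<in>\<beta>. braid_perm w = id \<and>
          eval_word (braid_group N) (sigma N) (fill_stirrer 1 w) = \<one>\<^bsub>braid_group N\<^esub>}"

definition alpha :: "nat \<Rightarrow> nat \<Rightarrow> nat gword set" where
  "alpha N i = eval_word (braid_group (Suc N)) (sigma (Suc N))
     (map (\<lambda>k. (k, True)) [1..<i] @ [(i, True), (i, True)] @ map (\<lambda>k. (k, False)) (rev [1..<i]))"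

section \<open>The action on the fundamental group\<close>

text \<open>The fundamental group of the disk with \<open>N + 1\<close> punctures is free on
  \<open>\<delta>\<^sub>1, \<dots>, \<delta>\<^sub>N\<^sub>+\<^sub>1\<close>, where \<open>\<delta>\<^sub>i\<close> for \<open>i \<le> N\<close> goes counterclockwise around the \<open>i\<close>th obstacle and
  \<open>\<delta>\<^sub>N\<^sub>+\<^sub>1\<close> clockwise around the stirrer and all obstacles. Pushing the stirrer around the \<open>j\<close>th
  obstacle conjugates \<open>\<delta>\<^sub>j\<close> by \<open>\<delta>\<^sub>j\<^sub>+\<^sub>1 \<dots> \<delta>\<^sub>N\<^sub>+\<^sub>1 \<delta>\<^sub>1 \<dots> \<delta>\<^sub>j\<^sub>-\<^sub>1\<close> and fixes the other generators.\<close>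

abbreviation pi1 :: "nat \<Rightarrow> nat gword monoid" where
  "pi1 N \<equiv> free_group {1..Suc N}"

definition delta :: "nat \<Rightarrow> nat gword" where
  "delta i = [(i, True)]"

definition push_word :: "nat \<Rightarrow> nat \<Rightarrow> nat gword" where
  "push_word N j = map (\<lambda>k. (k, True)) ([Suc j..<Suc (Suc N)] @ [1..<j])"

definition alpha_sharp :: "nat \<Rightarrow> nat \<Rightarrow> nat gword \<Rightarrow> nat gword" where
  "alpha_sharp N j =
     restrict
       (eval_word (pi1 N)
         (\<lambda>i. if i = j then inv\<^bsub>pi1 N\<^esub> (push_word N j) \<otimes>\<^bsub>pi1 N\<^esub> delta j \<otimes>\<^bsub>pi1 N\<^esub> push_word N j
              else delta i))
       (carrier (pi1 N))"

text \<open>The automorphism induced by a point-push protocol \<open>\<beta>\<close> is obtained by writing \<open>\<beta>\<close> as a word in the free generators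
  \<open>\<alpha>\<^sub>1, \<dots>, \<alpha>\<^sub>N\<close> of the group of point-push protocols; all such words yield the same automorphism.
  The leftmost letter acts first, whereas the product of \<open>AutoGroup\<close> is composition of functions;
  this is why the word is reversed.\<close>

definition induced_aut :: "nat \<Rightarrow> nat gword set \<Rightarrow> nat gword \<Rightarrow> nat gword" where
  "induced_aut N \<beta> =
     (THE \<phi>. \<exists>u. set u \<subseteq> {1..N} \<times> UNIV \<and>
        eval_word (braid_group (Suc N)) (alpha N) u = \<beta> \<and>
        eval_word (AutoGroup (pi1 N)) (alpha_sharp N) (rev u) = \<phi>)"

section \<open>Efficiency\<close>

definition eff :: "nat \<Rightarrow> nat gword set \<Rightarrow> ereal" where
  "eff N \<beta> =
     entropy (pi1 N) (delta ` {1..Suc N}) (induced_aut N \<beta>) /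
     ereal (real (word_length (braid_group (Suc N)) (alpha N ` {1..N}) \<beta>))"

definition Eff :: "nat \<Rightarrow> ereal" where
  "Eff N = (SUP \<beta> \<in> point_push N - {\<one>\<^bsub>braid_group (Suc N)\<^esub>}. eff N \<beta>)"

section \<open>The matrices\<close>

text \<open>Rows and columns of \<open>mat\<close> are indexed from 0, whence \<open>i = Suc i0\<close> and \<open>j = Suc j0\<close>.\<close>

definition T_mat :: "nat \<Rightarrow> nat \<Rightarrow> int mat" where
  "T_mat N k = mat N N (\<lambda>(i0, j0).
     let i = Suc i0; j = Suc j0 in
       if i \<noteq> k \<or> j = k then 0
       else if j < k then 2 * (- 1) ^ (k - j + 1)
       else 2 * (- 1) ^ (j - k))"

definition S_mat :: "nat \<Rightarrow> nat \<Rightarrow> int mat" where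
  "S_mat N k = mat N N (\<lambda>(i0, j0).
     let i = Suc i0; j = Suc j0 in if i \<noteq> k \<or> j = k then 0 else 2)"

definition E_mat :: "nat \<Rightarrow> nat \<Rightarrow> int mat" where
  "E_mat N k = 1\<^sub>m N + T_mat N k"

definition A_mat :: "nat \<Rightarrow> nat \<Rightarrow> int mat" where
  "A_mat N k = 1\<^sub>m N + S_mat N k"

definition H_mat :: "nat \<Rightarrow> int mat" where
  "H_mat N = foldr (\<lambda>k M. E_mat N k * M) [1..<Suc N] (1\<^sub>m N)"

definition H_hat_mat :: "nat \<Rightarrow> int mat" where
  "H_hat_mat N = foldr (\<lambda>k M. A_mat N k * M) [1..<Suc N] (1\<^sub>m N)"

definition rho :: "int mat \<Rightarrow> real" where
  "rho M = spectral_radius (map_mat complex_of_int M)"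

end

theory Submission
  imports Defs "HOL-Real_Asymp.Real_Asymp"
begin

text \<open>
  Both bounds on the maximal efficiency come from replacing the action of a protocol on the free
  group by a product of matrices, one factor for each letter of the protocol.

  \<^bold>\<open>Upper bound.\<close> The letter \<open>\<alpha>\<^sub>j\<close> or its inverse replaces \<open>\<delta>\<^sub>j\<close> by a word that contains \<open>\<delta>\<^sub>j\<close> once
  and every other generator twice. If the generators carry nonnegative weights \<open>v\<close>, the weight of a
  word therefore grows at most as if \<open>v\<^sub>j\<close> were replaced by \<open>2 * (\<Sum>\<^sub>i v\<^sub>i) - v\<^sub>j\<close>, which for the
  obstacles is the action of \<open>A\<^sup>(\<^sup>j\<^sup>)\<close>. The new entry is largest when the smallest entry is spent, so
  no order of the letters beats the cyclic one. In quantitative form, let \<open>\<theta> \<ge> 1\<close> solve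
  \<open>\<theta>\<^sup>N = 2 * (\<theta> + \<dots> + \<theta>\<^sup>N\<^sup>-\<^sup>1) + 1\<close>; if the entries of \<open>v\<close>, suitably ordered, are bounded by
  \<open>a, a * \<theta>, \<dots>, a * \<theta>\<^sup>N\<^sup>-\<^sup>1\<close>, then after any update they are bounded by the same progression with
  \<open>a * \<theta>\<close> in place of \<open>a\<close> (lemma \<open>dominated_push_weight\<close>). So each letter contributes at most \<open>ln \<theta>\<close>
  to the entropy. On the other hand a cyclic pass multiplies the progression exactly by \<open>\<theta>\<^sup>N\<close>, which
  makes \<open>\<theta>\<^sup>N\<close> an eigenvalue of the product of all \<open>A\<^sup>(\<^sup>j\<^sup>)\<close> (lemma \<open>cycle_geometric\<close>). The largest
  column sum of that product is \<open>3\<^sup>N - 2\<close>, and it bounds the spectral radius.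

  \<^bold>\<open>Lower bound.\<close> The witness is the cyclic protocol \<open>\<alpha>\<^sub>1 \<alpha>\<^sub>2 \<dots> \<alpha>\<^sub>N\<close>. Given complex numbers \<open>v\<^sub>i\<close>, let
  \<open>\<delta>\<^sub>i\<close> act on the complex plane by \<open>z \<mapsto> v\<^sub>i - z\<close> for \<open>i \<le> N\<close>, and let \<open>\<delta>\<^sub>N\<^sub>+\<^sub>1\<close> act by
  \<open>z \<mapsto> (-1)\<^sup>N\<^sup>+\<^sup>1 z\<close>. The action pulled back along \<open>\<alpha>\<^sub>j\<close> has the same form, with \<open>v\<close> replaced by
  \<open>E\<^sup>(\<^sup>j\<^sup>) v\<close> (lemma \<open>refl_word_alpha_sharp\<close>); this is the reduced Burau
  representation at \<open>-1\<close> in geometric form. If \<open>v\<close> is an eigenvector of \<open>H\<^sup>(\<^sup>N\<^sup>)\<close> for an eigenvalue of maximal modulus, the image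
  of \<open>\<delta>\<^sub>i\<close> under the \<open>n\<close>th power of the protocol moves the origin by \<open>\<rho>\<^sup>n \<bar>v\<^sub>i\<bar>\<close>, whereas a word of
  length \<open>l\<close> moves it by at most \<open>l * max \<bar>v\<^sub>i\<bar>\<close>. Hence the length grows at least like \<open>\<rho>\<^sup>n\<close>. The same
  geometric eigenvector as before, with alternating signs, bounds \<open>\<rho>\<close> from below by the \<open>N\<close>th power
  of a root of \<open>x\<^sup>N = 2 * (x + \<dots> + x\<^sup>N\<^sup>-\<^sup>1) - 1\<close> that is at least \<open>3 - 3 / N\<close> for \<open>N \<ge> 3\<close>.

  \<^bold>\<open>Protocols and automorphisms.\<close> The definitions presuppose two facts about the braid group. Every
  point-push protocol is a word in the \<open>\<alpha>\<^sub>i\<close> (lemma \<open>point_push_alpha_word\<close>): dragging the stirrer back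
  to the first position splits a braid into a product of the \<open>\<alpha>\<^sub>i\<close>, a braid of the obstacles, and the
  braid that carries the stirrer to its final position. All words that spell the same protocol induce
  the same automorphism (lemma \<open>induced_aut_alpha_word\<close>): the automorphisms of the definition are
  restrictions of Artin's action of the whole braid group on the free group, and that action respects
  the braid relations.
\<close>

section \<open>Evaluation of words and presentations\<close>

lemma eval_word_Nil [simp]: "eval_word G f [] = \<one>\<^bsub>G\<^esub>"
  by (simp add: eval_word_def)

lemma eval_word_Cons [simp]:
  "eval_word G f ((x, b) # w) = (if b then f x else inv\<^bsub>G\<^esub> (f x)) \<otimes>\<^bsub>G\<^esub> eval_word G f w"
  by (simp add: eval_word_def)

lemma eval_word_cong:
  assumes "\<And>x. x \<in> X \<Longrightarrow> f x = g x" and "set w \<subseteq> X \<times> UNIV"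
  shows "eval_word G f w = eval_word G g w"
  using assms(2) by (induction w) (auto simp: assms(1))

lemma eval_word_image:
  assumes "set w \<subseteq> f ` X \<times> UNIV"
  obtains u where "set u \<subseteq> X \<times> UNIV" "length u = length w"
    "eval_word G f u = eval_word G (\<lambda>x. x) w"
  using assms
proof (induction w arbitrary: thesis)
  case Nil
  show ?case by (rule Nil(1)[of "[]"]) auto
next
  case (Cons a w)
  obtain u where u: "set u \<subseteq> X \<times> UNIV" "length u = length w"
    "eval_word G f u = eval_word G (\<lambda>x. x) w"
    by (rule Cons.IH) (use Cons.prems in auto)
  obtain x b where "a = (f x, b)" "x \<in> X"
    using Cons.prems(2) by auto
  then show ?case using u by (intro Cons.prems(1)[of "(x, b) # u"]) auto
qed

context group
begin

lemma inv_mult_cancel_left: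
  "x \<in> carrier G \<Longrightarrow> y \<in> carrier G \<Longrightarrow> inv x \<otimes> (x \<otimes> y) = y"
  "x \<in> carrier G \<Longrightarrow> y \<in> carrier G \<Longrightarrow> x \<otimes> (inv x \<otimes> y) = y"
  by (simp_all flip: m_assoc)

lemma eval_word_closed:
  assumes "f \<in> X \<rightarrow> carrier G" and "set w \<subseteq> X \<times> UNIV"
  shows "eval_word G f w \<in> carrier G"
  using assms(2) by (induction w) (use assms(1) in \<open>auto dest!: funcset_mem\<close>)

lemma eval_word_append:
  assumes f: "f \<in> X \<rightarrow> carrier G" and "set u \<subseteq> X \<times> UNIV" "set v \<subseteq> X \<times> UNIV"
  shows "eval_word G f (u @ v) = eval_word G f u \<otimes> eval_word G f v"
  using assms(2)
proof (induction u)
  case (Cons a u)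
  obtain x b where a: "a = (x, b)" by fastforce
  have "eval_word G f u \<in> carrier G" "eval_word G f v \<in> carrier G" "f x \<in> carrier G"
    using assms Cons.prems a by (auto intro!: eval_word_closed[OF f])
  with Cons a show ?case by (simp add: m_assoc)
qed (use assms in \<open>simp add: eval_word_closed[OF f]\<close>)

lemma eval_word_cons_reduce:
  assumes f: "f \<in> X \<rightarrow> carrier G" and a: "a \<in> X \<times> UNIV" and w: "set w \<subseteq> X \<times> UNIV"
  shows "eval_word G f (cons_reduce a w) = eval_word G f (a # w)"
proof (cases w)
  case (Cons b v)
  obtain x p y q where xy: "a = (x, p)" "b = (y, q)" by fastforce
  have "eval_word G f v \<in> carrier G" "f x \<in> carrier G"
    using assms Cons xy by (auto intro!: eval_word_closed[OF f])
  then show ?thesis using Cons xy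
    by (auto simp: cancelling_def inv_mult_cancel_left)
qed simp

lemma eval_word_reduce:
  assumes f: "f \<in> X \<rightarrow> carrier G" and "set w \<subseteq> X \<times> UNIV"
  shows "eval_word G f (reduce w) = eval_word G f w"
  using assms(2)
proof (induction w)
  case (Cons a w)
  obtain x b where a: "a = (x, b)" by fastforce
  have "eval_word G f (reduce (a # w)) = eval_word G f (a # reduce w)"
    using eval_word_cons_reduce[OF f, of a "reduce w"] Cons.prems set_reduce[of w]
    by (auto simp: reduce_def)
  with Cons a show ?case by simp
qed (simp add: reduce_def)

lemma eval_word_hom:
  assumes "f \<in> X \<rightarrow> carrier G"
  shows "eval_word G f \<in> hom (free_group X) G"
proof (rule homI)
  fix u v assume "u \<in> carrier (free_group X)" "v \<in> carrier (free_group X)"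
  then show "eval_word G f (u \<otimes>\<^bsub>free_group X\<^esub> v) = eval_word G f u \<otimes> eval_word G f v"
    using assms by (simp add: free_group_def eval_word_reduce[OF assms] eval_word_append[OF assms])
qed (auto simp: free_group_def intro!: eval_word_closed[OF assms])

lemma eval_word_inverse_word:
  assumes f: "f \<in> X \<rightarrow> carrier G" and "set w \<subseteq> X \<times> UNIV"
  shows "eval_word G f (rev (map (apsnd Not) w)) = inv (eval_word G f w)"
  using assms(2)
proof (induction w)
  case (Cons a w)
  obtain x b where a: "a = (x, b)" by fastforce
  have "set (rev (map (apsnd Not) w)) \<subseteq> X \<times> UNIV"
    using Cons.prems by auto
  then have "eval_word G f (rev (map (apsnd Not) (a # w)))
      = eval_word G f (rev (map (apsnd Not) w)) \<otimes> eval_word G f [apsnd Not a]"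
    using Cons.prems by (simp only: list.map rev.simps, intro eval_word_append[OF f]) (auto simp: a)
  moreover have "f x \<in> carrier G" "eval_word G f w \<in> carrier G"
    using f Cons.prems a by (auto intro!: eval_word_closed[OF f])
  ultimately show ?case using Cons by (simp add: a inv_mult_group)
qed simp

text \<open>Reversing a word means multiplying in the opposite group, and inversion identifies a group with its
  opposite. This is how a product in which the leftmost letter acts first is related to composition of
  functions.\<close>

lemma eval_word_rev:
  assumes f: "f \<in> X \<rightarrow> carrier G" and "set w \<subseteq> X \<times> UNIV"
  shows "eval_word G f (rev w) = inv (eval_word G (\<lambda>x. inv (f x)) w)"
  using assms(2)
proof (induction w)
  case (Cons a w)
  obtain x b where a: "a = (x, b)" by fastforce
  have "eval_word G f (rev (a # w)) = eval_word G f (rev w) \<otimes> eval_word G f [a]"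
    using Cons.prems by (simp only: rev.simps, intro eval_word_append[OF f]) auto
  moreover have "f x \<in> carrier G" "eval_word G (\<lambda>x. inv (f x)) w \<in> carrier G"
    using f Cons.prems a by (auto intro!: eval_word_closed[where X = X])
  ultimately show ?case using Cons by (simp add: a inv_mult_group)
qed simp

end

lemma hom_eval_word:
  assumes "group G" "group H" and h: "h \<in> hom G H"
    and f: "f \<in> X \<rightarrow> carrier G" and "set w \<subseteq> X \<times> UNIV"
  shows "h (eval_word G f w) = eval_word H (\<lambda>x. h (f x)) w"
  using assms(5)
proof (induction w)
  case Nil
  then show ?case using hom_one[OF h assms(1,2)] by simp
next
  case (Cons a w)
  interpret group_hom G H h
    using assms by (simp add: group_hom_def group_hom_axioms_def)
  obtain x b where a: "a = (x, b)" by fastforce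
  have "f x \<in> carrier G" "eval_word G f w \<in> carrier G"
    using f Cons.prems a by (auto intro!: G.eval_word_closed[OF f])
  with Cons a show ?case by simp
qed

lemma letter_in_free_group: "x \<in> X \<Longrightarrow> [(x, b)] \<in> carrier (free_group X)"
  by (simp add: free_group_def reduced_word_def)

lemma inv_free_group:
  assumes "w \<in> carrier (free_group X)"
  shows "inv\<^bsub>free_group X\<^esub> w = reduce (rev (map (apsnd Not) w))"
proof (rule group.inv_equality[OF group_free_group _ assms])
  show "reduce (rev (map (apsnd Not) w)) \<otimes>\<^bsub>free_group X\<^esub> w = \<one>\<^bsub>free_group X\<^esub>"
    by (simp add: free_group_def reduce_reduce_append reduce_inverse_append)
  show "reduce (rev (map (apsnd Not) w)) \<in> carrier (free_group X)"
    using assms set_reduce[of "rev (map (apsnd Not) w)"]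
    by (fastforce simp: free_group_def reduced_word_reduce)
qed

lemma inv_letter: "x \<in> X \<Longrightarrow> inv\<^bsub>free_group X\<^esub> [(x, b)] = [(x, \<not> b)]"
  by (simp add: inv_free_group letter_in_free_group reduce_def)

lemma eval_word_letters:
  "set w \<subseteq> X \<times> UNIV \<Longrightarrow> eval_word (free_group X) (\<lambda>x. [(x, True)]) w = reduce w"
proof (induction w)
  case (Cons a w)
  obtain x b where a: "a = (x, b)" by fastforce
  have "eval_word (free_group X) (\<lambda>x. [(x, True)]) (a # w) = [a] \<otimes>\<^bsub>free_group X\<^esub> reduce w"
    using Cons a by (simp add: inv_letter)
  also have "\<dots> = reduce ([a] @ w)"
    by (simp only: free_group_def monoid.simps reduce_append_reduce)
  finally show ?case by simp
qed (simp add: reduce_def free_group_def)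

lemma hom_free_group_conv_eval_word:
  assumes "group G" and h: "h \<in> hom (free_group X) G" and w: "w \<in> carrier (free_group X)"
  shows "h w = eval_word G (\<lambda>x. h [(x, True)]) w"
proof -
  have *: "set w \<subseteq> X \<times> UNIV" "reduced_word w"
    using w by (auto simp: free_group_def)
  have "h w = h (eval_word (free_group X) (\<lambda>x. [(x, True)]) w)"
    using * by (simp add: eval_word_letters reduce_reduced_word)
  also have "\<dots> = eval_word G (\<lambda>x. h [(x, True)]) w"
    using * by (intro hom_eval_word[OF group_free_group assms(1) h, where X = X])
      (auto simp: letter_in_free_group)
  finally show ?thesis .
qed

lemma hom_free_group_eqI:
  assumes "group G" "g \<in> hom (free_group X) G" "h \<in> hom (free_group X) G"
    and "\<And>x. x \<in> X \<Longrightarrow> g [(x, True)] = h [(x, True)]" and w: "w \<in> carrier (free_group X)"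
  shows "g w = h w"
proof -
  have "set w \<subseteq> X \<times> UNIV" using w by (simp add: free_group_def)
  from eval_word_cong[OF assms(4) this] show ?thesis
    using assms by (simp add: hom_free_group_conv_eval_word[of G _ X])
qed

lemma normal_normal_closure:
  assumes "group G" "R \<subseteq> carrier G"
  shows "normal_closure G R \<lhd> G"
proof -
  interpret group G by fact
  let ?C = "{g \<otimes>\<^bsub>G\<^esub> r \<otimes>\<^bsub>G\<^esub> inv\<^bsub>G\<^esub> g | g r. g \<in> carrier G \<and> r \<in> R}"
  show ?thesis
    unfolding normal_closure_def
  proof (rule normal_generateI)
    show "?C \<subseteq> carrier G" using assms(2) by auto
    fix h g assume "h \<in> ?C" and g: "g \<in> carrier G"
    then obtain k r where h: "h = k \<otimes>\<^bsub>G\<^esub> r \<otimes>\<^bsub>G\<^esub> inv\<^bsub>G\<^esub> k" "k \<in> carrier G" "r \<in> R"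
      by auto
    then have "g \<otimes>\<^bsub>G\<^esub> h \<otimes>\<^bsub>G\<^esub> inv\<^bsub>G\<^esub> g = (g \<otimes>\<^bsub>G\<^esub> k) \<otimes>\<^bsub>G\<^esub> r \<otimes>\<^bsub>G\<^esub> inv\<^bsub>G\<^esub> (g \<otimes>\<^bsub>G\<^esub> k)"
      using assms(2) g by (auto simp: inv_mult_group m_assoc)
    then show "g \<otimes>\<^bsub>G\<^esub> h \<otimes>\<^bsub>G\<^esub> inv\<^bsub>G\<^esub> g \<in> ?C"
      using h g by blast
  qed
qed

lemma normal_closure_subset_kernel:
  assumes "group_hom G H h" and "R \<subseteq> carrier G" "\<And>r. r \<in> R \<Longrightarrow> h r = \<one>\<^bsub>H\<^esub>"
  shows "normal_closure G R \<subseteq> kernel G H h"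
proof -
  interpret group_hom G H h by fact
  show ?thesis
    unfolding normal_closure_def
    using assms(2,3) by (intro G.generate_subgroup_incl subgroup_kernel) (auto simp: kernel_def subset_iff)
qed

text \<open>Von Dyck's theorem: a map on the generators under which all relators become trivial extends to the
  presented group.\<close>

lemma hom_from_presentation:
  fixes X :: "'x set" and R :: "'x gword set"
  defines "F \<equiv> free_group X"
  defines "P \<equiv> F Mod normal_closure F R"
  assumes R: "R \<subseteq> carrier F" and H: "group H" and f: "f \<in> X \<rightarrow> carrier H"
    and rel: "\<And>r. r \<in> R \<Longrightarrow> eval_word H f r = \<one>\<^bsub>H\<^esub>"
  obtains h where "h \<in> hom P H"
    "\<And>x. x \<in> X \<Longrightarrow> h (normal_closure F R #>\<^bsub>F\<^esub> [(x, True)]) = f x"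
proof -
  interpret F: group F by (simp add: F_def group_free_group)
  interpret H: group H by fact
  interpret normal "normal_closure F R" F
    by (rule normal_normal_closure) (simp_all add: R F.is_group)
  interpret eh: group_hom F H "eval_word H f"
    using H.eval_word_hom[OF f] by (unfold_locales) (simp add: F_def)
  note ker = normal_closure_subset_kernel[OF eh.group_hom_axioms R rel]
  obtain h where h: "h \<in> hom (F Mod normal_closure F R) H"
    "\<And>w. w \<in> carrier F \<Longrightarrow> h (normal_closure F R #>\<^bsub>F\<^esub> w) = eval_word H f w"
  proof (rule FactGroup_universal[OF eh.homh normal_axioms])
    fix u v assume uv: "u \<in> carrier F" "v \<in> carrier F"
      and "normal_closure F R #>\<^bsub>F\<^esub> u = normal_closure F R #>\<^bsub>F\<^esub> v"
    then have "u \<in> normal_closure F R #>\<^bsub>F\<^esub> v"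
      using F.rcos_self subgroup_axioms by metis
    then obtain n where n: "n \<in> normal_closure F R" "u = n \<otimes>\<^bsub>F\<^esub> v"
      by (auto simp: r_coset_def)
    then have "n \<in> carrier F" "eval_word H f n = \<one>\<^bsub>H\<^esub>"
      using ker by (auto simp: kernel_def)
    with n uv show "eval_word H f u = eval_word H f v"
      by simp
  qed blast
  show thesis
  proof (rule that)
    show "h \<in> hom P H" using h(1) by (simp add: P_def)
    fix x assume "x \<in> X"
    then have "[(x, True)] \<in> carrier F" "f x \<in> carrier H"
      using f by (auto simp: F_def letter_in_free_group)
    then show "h (normal_closure F R #>\<^bsub>F\<^esub> [(x, True)]) = f x"
      using h(2) by simp
  qed
qed

section \<open>Combing the stirrer out of a braid\<close>

definition stirrer_end :: "nat \<Rightarrow> nat gword \<Rightarrow> nat" where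
  "stirrer_end p w = foldl (\<lambda>q (i, _). Transposition.transpose i (Suc i) q) p w"

lemma stirrer_end_simps [simp]:
  "stirrer_end p [] = p"
  "stirrer_end p ((i, b) # w) = stirrer_end (Transposition.transpose i (Suc i) p) w"
  by (simp_all add: stirrer_end_def)

lemma braid_perm_simps [simp]:
  "braid_perm [] = id"
  "braid_perm ((i, b) # w) = Transposition.transpose i (Suc i) \<circ> braid_perm w"
  by (simp_all add: braid_perm_def)

text \<open>Reading the word from the left, the string undergoes the transpositions of \<open>braid_perm\<close> in the
  opposite order of their composition, so that its path inverts the permutation.\<close>

lemma braid_perm_stirrer_end: "braid_perm w (stirrer_end p w) = p"
  by (induction w arbitrary: p) auto

lemma set_fill_stirrer:
  assumes "set w \<subseteq> {1..<Suc n} \<times> UNIV" "1 \<le> p" "p \<le> Suc n"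
  shows "set (fill_stirrer p w) \<subseteq> {1..<n} \<times> UNIV"
  using assms by (induction p w rule: fill_stirrer.induct) auto

lemma (in group) conj_generate:
  assumes H: "H \<subseteq> carrier G" and g: "g \<in> carrier G"
    and gen: "\<And>h. h \<in> H \<Longrightarrow> g \<otimes> h \<otimes> inv g \<in> generate G H" and u: "u \<in> generate G H"
  shows "g \<otimes> u \<otimes> inv g \<in> generate G H"
  using u
proof induction
  case one
  then show ?case using g by (simp add: generate.one)
next
  case (incl h)
  then show ?case by (rule gen)
next
  case (inv h)
  then have "h \<in> carrier G" using H by auto
  then have "g \<otimes> inv h \<otimes> inv g = inv (g \<otimes> h \<otimes> inv g)"
    using g by (simp add: inv_mult_group m_assoc)
  then show ?case using generate_m_inv_closed[OF H gen[OF inv]] by simp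
next
  case (eng x y)
  then have "x \<in> carrier G" "y \<in> carrier G"
    using generate_in_carrier[OF H] by auto
  then have "g \<otimes> (x \<otimes> y) \<otimes> inv g = (g \<otimes> x \<otimes> inv g) \<otimes> (g \<otimes> y \<otimes> inv g)"
    using g by (simp add: m_assoc inv_mult_cancel_left)
  then show ?case using generate.eng[OF eng.IH] by simp
qed

text \<open>Elements of an arbitrary group that satisfy the braid relations. Besides the generators of the braid
  group this covers Artin's automorphisms and the generators shifted by one position.\<close>

locale braid_generators = group G for G (structure) +
  fixes n :: nat and s :: "nat \<Rightarrow> 'a"
  assumes s_closed: "\<And>i. 1 \<le> i \<Longrightarrow> i < n \<Longrightarrow> s i \<in> carrier G"
    and braid_rel: "\<And>i. 1 \<le> i \<Longrightarrow> Suc i < n \<Longrightarrow>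
      s i \<otimes> s (Suc i) \<otimes> s i = s (Suc i) \<otimes> s i \<otimes> s (Suc i)"
    and commute_rel: "\<And>i j. 1 \<le> i \<Longrightarrow> i + 2 \<le> j \<Longrightarrow> j < n \<Longrightarrow> s i \<otimes> s j = s j \<otimes> s i"
begin

text \<open>The braid that carries the first string to position \<open>p\<close>, past those in between.\<close>

definition tau :: "nat \<Rightarrow> 'a" where
  "tau p = eval_word G s (map (\<lambda>k. (k, True)) [1..<p])"

text \<open>This is \<open>\<alpha>\<^sub>j\<close>: go next to the obstacle, circle it, and return.\<close>

definition push :: "nat \<Rightarrow> 'a" where
  "push j = tau j \<otimes> (s j \<otimes> s j) \<otimes> inv (tau j)"

definition push_group :: "'a set" where
  "push_group = generate G (push ` {1..<n})"

lemma s_funcset: "s \<in> {1..<n} \<rightarrow> carrier G"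
  using s_closed by auto

lemma tau_closed: "p \<le> n \<Longrightarrow> tau p \<in> carrier G"
  unfolding tau_def by (rule eval_word_closed[OF s_funcset]) auto

lemma tau_1 [simp]: "tau (Suc 0) = \<one>"
  by (simp add: tau_def)

lemma tau_Suc: "1 \<le> p \<Longrightarrow> p < n \<Longrightarrow> tau (Suc p) = tau p \<otimes> s p"
  unfolding tau_def
  by (simp, subst eval_word_append[OF s_funcset]) (auto simp: s_closed)

lemma push_closed: "1 \<le> j \<Longrightarrow> j < n \<Longrightarrow> push j \<in> carrier G"
  by (simp add: push_def tau_closed s_closed)

lemma pushes_closed: "push ` {1..<n} \<subseteq> carrier G"
  using push_closed by auto

lemma push_in_push_group: "1 \<le> j \<Longrightarrow> j < n \<Longrightarrow> push j \<in> push_group"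
  by (auto simp: push_group_def intro: generate.incl)

lemma inv_push_in_push_group: "1 \<le> j \<Longrightarrow> j < n \<Longrightarrow> inv (push j) \<in> push_group"
  by (auto simp: push_group_def intro: generate.inv)

lemma one_in_push_group: "\<one> \<in> push_group"
  by (auto simp: push_group_def intro: generate.one)

lemma mult_in_push_group: "u \<in> push_group \<Longrightarrow> v \<in> push_group \<Longrightarrow> u \<otimes> v \<in> push_group"
  by (auto simp: push_group_def intro: generate.eng)

lemma U_closed: "u \<in> push_group \<Longrightarrow> u \<in> carrier G"
  using generate_in_carrier[OF pushes_closed] by (auto simp: push_group_def)

lemma conj_in_push_group:
  assumes "g \<in> carrier G" "\<And>j. 1 \<le> j \<Longrightarrow> j < n \<Longrightarrow> g \<otimes> push j \<otimes> inv g \<in> push_group" "u \<in> push_group"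
  shows "g \<otimes> u \<otimes> inv g \<in> push_group"
proof -
  have "g \<otimes> h \<otimes> inv g \<in> generate G (push ` {1..<n})" if "h \<in> push ` {1..<n}" for h
    using that assms(2) by (auto simp: push_group_def)
  from conj_generate[OF pushes_closed assms(1) this] assms(3) show ?thesis
    by (simp only: push_group_def)
qed

lemma tau_commute:
  assumes "1 \<le> p" "p < i" "i < n"
  shows "s i \<otimes> tau p = tau p \<otimes> s i"
  using assms
proof (induction p rule: dec_induct)
  case base
  then show ?case using s_closed by simp
next
  case (step p)
  have c: "s i \<in> carrier G" "s p \<in> carrier G" "tau p \<in> carrier G"
    using step by (auto intro: s_closed tau_closed)
  have e: "tau (Suc p) = tau p \<otimes> s p"
    using step by (simp add: tau_Suc)
  have "s i \<otimes> tau (Suc p) = (s i \<otimes> tau p) \<otimes> s p"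
    using c by (simp only: e m_assoc m_closed)
  also have "\<dots> = tau p \<otimes> (s i \<otimes> s p)"
    using step c by (simp add: m_assoc)
  also have "s i \<otimes> s p = s p \<otimes> s i"
    using step commute_rel[of p i] by simp
  also have "tau p \<otimes> (s p \<otimes> s i) = tau (Suc p) \<otimes> s i"
    using c by (simp only: e m_assoc m_closed)
  finally show ?case .
qed

text \<open>A crossing of two strings to the left of the stirrer is, before the stirrer has passed them, a
  crossing one position further to the right.\<close>

lemma tau_shift:
  assumes "1 \<le> i" "i + 2 \<le> p" "p \<le> n"
  shows "s (Suc i) \<otimes> tau p = tau p \<otimes> s i"
  using assms(2,3)
proof (induction p rule: dec_induct)
  case base
  have c: "s i \<in> carrier G" "s (Suc i) \<in> carrier G" "tau i \<in> carrier G"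
    using assms base by (auto intro: s_closed tau_closed)
  have t: "tau (i + 2) = tau i \<otimes> (s i \<otimes> s (Suc i))"
    using assms base c by (simp add: tau_Suc m_assoc)
  have "s (Suc i) \<otimes> tau (i + 2) = (s (Suc i) \<otimes> tau i) \<otimes> (s i \<otimes> s (Suc i))"
    using c by (simp only: t m_assoc m_closed)
  also have "s (Suc i) \<otimes> tau i = tau i \<otimes> s (Suc i)"
    using assms base by (simp add: tau_commute)
  also have "tau i \<otimes> s (Suc i) \<otimes> (s i \<otimes> s (Suc i)) = tau i \<otimes> (s (Suc i) \<otimes> s i \<otimes> s (Suc i))"
    using c by (simp add: m_assoc)
  also have "\<dots> = tau i \<otimes> (s i \<otimes> s (Suc i) \<otimes> s i)"
    using assms base by (simp add: braid_rel)
  also have "\<dots> = tau (i + 2) \<otimes> s i"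
    using c by (simp only: t m_assoc m_closed)
  finally show ?case .
next
  case (step p)
  have c: "s i \<in> carrier G" "s (Suc i) \<in> carrier G" "s p \<in> carrier G" "tau p \<in> carrier G"
    using step assms(1) by (auto intro: s_closed tau_closed)
  have e: "tau (Suc p) = tau p \<otimes> s p"
    using step assms(1) by (simp add: tau_Suc)
  have "s (Suc i) \<otimes> tau (Suc p) = (s (Suc i) \<otimes> tau p) \<otimes> s p"
    using c by (simp only: e m_assoc m_closed)
  also have "\<dots> = tau p \<otimes> (s i \<otimes> s p)"
    using step c by (simp add: m_assoc)
  also have "s i \<otimes> s p = s p \<otimes> s i"
    using step assms(1) commute_rel[of i p] by simp
  also have "tau p \<otimes> (s p \<otimes> s i) = tau (Suc p) \<otimes> s i"
    using c by (simp only: e m_assoc m_closed)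
  finally show ?case .
qed

lemma s_push_commute:
  assumes "2 \<le> i" "i < n" "1 \<le> j" "j < n" "i < j \<or> j + 1 < i"
  shows "s i \<otimes> push j = push j \<otimes> s i"
proof -
  define i' where "i' = (if i < j then i - 1 else i)"
  have c: "s i \<in> carrier G" "s i' \<in> carrier G" "s j \<in> carrier G" "tau j \<in> carrier G"
    using assms by (auto intro: s_closed tau_closed simp: i'_def)
  have t: "s i \<otimes> tau j = tau j \<otimes> s i'"
    using assms tau_shift[of "i - 1" j] tau_commute[of j i] by (auto simp: i'_def)
  have com: "s i' \<otimes> s j = s j \<otimes> s i'"
    using assms commute_rel[of "i - 1" j] commute_rel[of j i] by (auto simp: i'_def)
  have t': "inv (tau j) \<otimes> s i = s i' \<otimes> inv (tau j)"
    using t c by (metis inv_closed inv_solve_left' inv_solve_right m_assoc m_closed)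
  have "s i \<otimes> push j = (s i \<otimes> tau j) \<otimes> (s j \<otimes> s j) \<otimes> inv (tau j)"
    using c by (simp add: push_def m_assoc)
  also have "\<dots> = tau j \<otimes> (s i' \<otimes> s j \<otimes> s j) \<otimes> inv (tau j)"
    using c by (simp add: t m_assoc)
  also have "s i' \<otimes> s j \<otimes> s j = s j \<otimes> (s i' \<otimes> s j)"
    using c by (simp add: com m_assoc)
  also have "\<dots> = s j \<otimes> s j \<otimes> s i'"
    using c by (simp add: com m_assoc)
  also have "tau j \<otimes> (s j \<otimes> s j \<otimes> s i') \<otimes> inv (tau j) = tau j \<otimes> (s j \<otimes> s j) \<otimes> (s i' \<otimes> inv (tau j))"
    using c by (simp add: m_assoc)
  also have "\<dots> = push j \<otimes> s i"
    using c by (simp add: t'[symmetric] push_def m_assoc)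
  finally show ?thesis .
qed

text \<open>The next two lemmas hold because exchanging two neighbouring obstacles turns a push around one of them
  into a push around the other, possibly on the other side of its neighbour.\<close>

lemma s_push_same:
  assumes "1 \<le> j" "Suc j < n"
  shows "s (Suc j) \<otimes> push (Suc j) \<otimes> inv (s (Suc j)) = push j"
proof -
  let ?t = "tau j" and ?a = "s j" and ?b = "s (Suc j)"
  have c: "?t \<in> carrier G" "?a \<in> carrier G" "?b \<in> carrier G"
    using assms by (auto intro: s_closed tau_closed)
  have tb: "?b \<otimes> ?t = ?t \<otimes> ?b"
    using assms by (simp add: tau_commute)
  have r: "?b \<otimes> ?a \<otimes> ?b = ?a \<otimes> ?b \<otimes> ?a"
    using assms by (simp add: braid_rel)
  have "?b \<otimes> ?a \<otimes> ?b \<otimes> ?b = ?a \<otimes> ?b \<otimes> ?a \<otimes> ?b"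
    by (simp only: r)
  also have "\<dots> = ?a \<otimes> (?b \<otimes> ?a \<otimes> ?b)"
    using c by (simp add: m_assoc)
  also have "\<dots> = ?a \<otimes> ?a \<otimes> ?b \<otimes> ?a"
    unfolding r using c by (simp add: m_assoc)
  finally have sq: "?b \<otimes> ?a \<otimes> ?b \<otimes> ?b = ?a \<otimes> ?a \<otimes> ?b \<otimes> ?a" .
  have "?b \<otimes> push (Suc j) = (?b \<otimes> ?t) \<otimes> (?a \<otimes> (?b \<otimes> (?b \<otimes> (inv ?a \<otimes> inv ?t))))"
    using c assms by (simp add: push_def tau_Suc inv_mult_group m_assoc)
  also have "\<dots> = ?t \<otimes> (?b \<otimes> ?a \<otimes> ?b \<otimes> ?b) \<otimes> (inv ?a \<otimes> inv ?t)"
    using c by (simp add: tb m_assoc)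
  also have "\<dots> = ?t \<otimes> ?a \<otimes> ?a \<otimes> ?b \<otimes> inv ?t"
    unfolding sq using c by (simp add: m_assoc inv_mult_cancel_left)
  also have "\<dots> = ?t \<otimes> ?a \<otimes> ?a \<otimes> inv ?t \<otimes> (?t \<otimes> ?b) \<otimes> inv ?t"
    using c by (simp add: m_assoc inv_mult_cancel_left)
  also have "\<dots> = push j \<otimes> ?b"
    using c by (simp add: tb[symmetric] push_def m_assoc)
  finally show ?thesis
    using c assms by (simp add: inv_solve_right' push_closed)
qed

lemma s_push_next:
  assumes "1 \<le> j" "Suc j < n"
  shows "s (Suc j) \<otimes> push j \<otimes> inv (s (Suc j)) = inv (push j) \<otimes> push (Suc j) \<otimes> push j"
proof -
  let ?t = "tau j" and ?a = "s j" and ?b = "s (Suc j)"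
  have c: "?t \<in> carrier G" "?a \<in> carrier G" "?b \<in> carrier G"
    and cp: "push j \<in> carrier G" "push (Suc j) \<in> carrier G"
    using assms by (auto intro: s_closed tau_closed push_closed)
  have tb: "?b \<otimes> ?t = ?t \<otimes> ?b"
    using assms by (simp add: tau_commute)
  then have tb': "inv ?t \<otimes> ?b = ?b \<otimes> inv ?t"
    using c by (metis inv_closed inv_solve_left' inv_solve_right m_assoc m_closed)
  have r: "?b \<otimes> ?a \<otimes> ?b = ?a \<otimes> ?b \<otimes> ?a"
    using assms by (simp add: braid_rel)
  have "?b \<otimes> ?b \<otimes> ?a \<otimes> ?b = ?b \<otimes> (?b \<otimes> ?a \<otimes> ?b)"
    using c by (simp add: m_assoc)
  also have "\<dots> = ?b \<otimes> (?a \<otimes> ?b \<otimes> ?a)"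
    by (simp only: r)
  also have "\<dots> = (?b \<otimes> ?a \<otimes> ?b) \<otimes> ?a"
    using c by (simp add: m_assoc)
  also have "\<dots> = ?a \<otimes> ?b \<otimes> ?a \<otimes> ?a"
    by (simp only: r)
  finally have sq: "?b \<otimes> ?b \<otimes> ?a \<otimes> ?b = ?a \<otimes> ?b \<otimes> ?a \<otimes> ?a" .
  have "push (Suc j) \<otimes> push j \<otimes> ?b
      = ?t \<otimes> ?a \<otimes> ?b \<otimes> ?b \<otimes> ?a \<otimes> (inv ?t \<otimes> ?b)"
    using c assms by (simp add: push_def tau_Suc inv_mult_group m_assoc inv_mult_cancel_left)
  also have "\<dots> = ?t \<otimes> ?a \<otimes> (?b \<otimes> ?b \<otimes> ?a \<otimes> ?b) \<otimes> inv ?t"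
    using c by (simp add: tb' m_assoc)
  also have "\<dots> = ?t \<otimes> ?a \<otimes> ?a \<otimes> ?b \<otimes> ?a \<otimes> ?a \<otimes> inv ?t"
    unfolding sq using c by (simp add: m_assoc)
  also have "\<dots> = ?t \<otimes> ?a \<otimes> ?a \<otimes> inv ?t \<otimes> (?t \<otimes> ?b) \<otimes> ?a \<otimes> ?a \<otimes> inv ?t"
    using c by (simp add: m_assoc inv_mult_cancel_left)
  also have "\<dots> = push j \<otimes> (?b \<otimes> push j)"
    using c by (simp add: tb[symmetric] push_def m_assoc)
  finally have "?b \<otimes> push j = inv (push j) \<otimes> (push (Suc j) \<otimes> push j \<otimes> ?b)"
    using c cp by (simp add: inv_mult_cancel_left)
  then show ?thesis
    using c cp by (simp add: inv_solve_right' m_assoc)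
qed

text \<open>The pushes generate a subgroup that is normalised by the crossings of obstacles: on a push these act
  by the two preceding relations or trivially. The inverse of a crossing needs its own argument, as a
  conjugate of a subgroup could be strictly smaller.\<close>

lemma s_conj_push_group:
  assumes i: "2 \<le> i" "i < n" and u: "u \<in> push_group"
  shows "s i \<otimes> u \<otimes> inv (s i) \<in> push_group" "inv (s i) \<otimes> u \<otimes> s i \<in> push_group"
proof -
  have c: "s i \<in> carrier G" using i by (auto intro: s_closed)
  obtain k where k: "i = Suc k" "1 \<le> k" using i by (cases i) auto
  have ck: "push k \<in> carrier G" "push i \<in> carrier G"
    using i k by (auto intro: push_closed)
  have same: "s i \<otimes> push i \<otimes> inv (s i) = push k"
    and nxt: "s i \<otimes> push k \<otimes> inv (s i) = inv (push k) \<otimes> push i \<otimes> push k"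
    using s_push_same[of k] s_push_next[of k] i k by auto
  have com: "s i \<otimes> push j = push j \<otimes> s i" if "1 \<le> j" "j < n" "j \<noteq> i" "j \<noteq> k" for j
    using that i k by (intro s_push_commute) auto
  show "s i \<otimes> u \<otimes> inv (s i) \<in> push_group"
  proof (rule conj_in_push_group[OF c _ u])
    fix j assume j: "1 \<le> j" "j < n"
    consider "j = i" | "j = k" | "j \<noteq> i" "j \<noteq> k" by blast
    then show "s i \<otimes> push j \<otimes> inv (s i) \<in> push_group"
    proof cases
      case 1
      then show ?thesis using same j i k by (auto simp: push_in_push_group)
    next
      case 2
      then show ?thesis using nxt j i k
        by (auto simp: mult_in_push_group push_in_push_group inv_push_in_push_group)
    next
      case 3
      then have "s i \<otimes> push j \<otimes> inv (s i) = push j"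
        using com[of j] j c push_closed[of j] by (simp add: m_assoc)
      then show ?thesis using j by (auto simp: push_in_push_group)
    qed
  qed
  have same': "inv (s i) \<otimes> push k \<otimes> s i = push i"
    using c ck by (simp add: same[symmetric] m_assoc inv_mult_cancel_left)
  have e: "push k \<otimes> s i = s i \<otimes> push i"
    using c ck by (simp add: same[symmetric] m_assoc)
  have "push i = push k \<otimes> (s i \<otimes> push k \<otimes> inv (s i)) \<otimes> inv (push k)"
    using c ck by (simp add: nxt m_assoc inv_mult_cancel_left)
  also have "\<dots> = (push k \<otimes> s i) \<otimes> push k \<otimes> (inv (s i) \<otimes> inv (push k))"
    using c ck by (simp add: m_assoc)
  also have "\<dots> = (s i \<otimes> push i) \<otimes> push k \<otimes> (inv (s i) \<otimes> inv (push k))"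
    by (simp only: e)
  finally have "inv (s i) \<otimes> push i \<otimes> s i
      = inv (s i) \<otimes> ((s i \<otimes> push i) \<otimes> push k \<otimes> (inv (s i) \<otimes> inv (push k))) \<otimes> s i"
    by (rule arg_cong)
  also have "\<dots> = push i \<otimes> push k \<otimes> inv (inv (s i) \<otimes> push k \<otimes> s i)"
    using c ck by (simp add: m_assoc inv_mult_group inv_mult_cancel_left)
  finally have nxt': "inv (s i) \<otimes> push i \<otimes> s i = push i \<otimes> push k \<otimes> inv (push i)"
    by (simp add: same')
  show "inv (s i) \<otimes> u \<otimes> s i \<in> push_group"
  proof -
    have "inv (s i) \<otimes> u \<otimes> inv (inv (s i)) \<in> push_group"
    proof (rule conj_in_push_group[OF inv_closed[OF c] _ u])
      fix j assume j: "1 \<le> j" "j < n"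
      consider "j = i" | "j = k" | "j \<noteq> i" "j \<noteq> k" by blast
      then show "inv (s i) \<otimes> push j \<otimes> inv (inv (s i)) \<in> push_group"
      proof cases
        case 1
        then show ?thesis using nxt' j i k c
          by (auto simp: mult_in_push_group push_in_push_group inv_push_in_push_group)
      next
        case 2
        then show ?thesis using same' j i k c by (auto simp: push_in_push_group)
      next
        case 3
        then have "inv (s i) \<otimes> push j \<otimes> inv (inv (s i)) = push j"
          using com[of j, symmetric] j c push_closed[of j] by (simp add: m_assoc inv_mult_cancel_left)
        then show ?thesis using j by (auto simp: push_in_push_group)
      qed
    qed
    then show ?thesis using c by simp
  qed
qed

text \<open>A crossing of the stirrer extends or shortens the path \<open>tau\<close> that it has taken by one step. If the
  crossing has the wrong sign for that, the two differ by a full twist, hence by a push. The other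
  crossings commute with \<open>tau\<close> up to the renumbering that \<open>fill_stirrer\<close> performs.\<close>

lemma comb_letter:
  assumes p: "1 \<le> p" "p \<le> n" and i: "1 \<le> i" "i < n"
  shows "\<exists>u\<in>push_group. tau p \<otimes> eval_word G s [(i, b)] =
    u \<otimes> eval_word G (\<lambda>i. s (Suc i)) (fill_stirrer p [(i, b)]) \<otimes> tau (Transposition.transpose i (Suc i) p)"
proof -
  have c: "s i \<in> carrier G" "tau p \<in> carrier G"
    using assms by (auto intro: s_closed tau_closed)
  consider "i = p" | "Suc i = p" | "Suc i < p" | "p < i" by linarith
  then show ?thesis
  proof cases
    case 1
    show ?thesis
    proof (cases b)
      case True
      with 1 show ?thesis using c i
        by (intro bexI[where x = \<one>]) (auto simp: tau_Suc one_in_push_group)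
    next
      case False
      have "inv (push p) \<otimes> tau (Suc p) = tau p \<otimes> inv (s p)"
        using 1 c i by (simp add: push_def tau_Suc inv_mult_group m_assoc inv_mult_cancel_left)
      with False 1 show ?thesis using c i push_closed[of p]
        by (intro bexI[where x = "inv (push p)"]) (auto simp: inv_push_in_push_group)
    qed
  next
    case 2
    have ci: "tau i \<in> carrier G" using i by (auto intro: tau_closed)
    have t: "tau p = tau i \<otimes> s i" using 2 i by (auto simp: tau_Suc)
    show ?thesis
    proof (cases b)
      case True
      have "push i \<otimes> tau i = tau p \<otimes> s i"
        using c ci by (simp add: push_def t m_assoc)
      with True 2 show ?thesis using c i push_closed[of i]
        by (intro bexI[where x = "push i"]) (auto simp: push_in_push_group)
    next
      case False
      with 2 show ?thesis using c i ci
        by (intro bexI[where x = \<one>]) (auto simp: t m_assoc one_in_push_group)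
    qed
  next
    case 3
    have ci: "s (Suc i) \<in> carrier G" using 3 i p by (auto intro: s_closed)
    have t: "s (Suc i) \<otimes> tau p = tau p \<otimes> s i"
      using 3 i p by (intro tau_shift) auto
    then have "inv (s (Suc i)) \<otimes> tau p = tau p \<otimes> inv (s i)"
      using c ci by (metis inv_closed inv_solve_left' inv_solve_right m_assoc m_closed)
    with t 3 show ?thesis using c ci
      by (intro bexI[where x = \<one>]) (auto simp: one_in_push_group Transposition.transpose_def)
  next
    case 4
    have t: "s i \<otimes> tau p = tau p \<otimes> s i"
      using 4 i p by (intro tau_commute) auto
    then have "inv (s i) \<otimes> tau p = tau p \<otimes> inv (s i)"
      using c by (metis inv_closed inv_solve_left' inv_solve_right m_assoc m_closed)
    with t 4 show ?thesis using c i
      by (intro bexI[where x = \<one>]) (auto simp: one_in_push_group Transposition.transpose_def)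
  qed
qed

lemma shift_funcset: "(\<lambda>i. s (Suc i)) \<in> {1..<n - 1} \<rightarrow> carrier G"
  using s_closed by auto

lemma shift_conj_push_group:
  assumes "set v \<subseteq> {1..<n - 1} \<times> UNIV" and u: "u \<in> push_group"
  shows "eval_word G (\<lambda>i. s (Suc i)) v \<otimes> u \<otimes> inv (eval_word G (\<lambda>i. s (Suc i)) v) \<in> push_group"
  using assms(1)
proof (induction v)
  case Nil
  then show ?case using u U_closed by simp
next
  case (Cons a v)
  obtain i b where a: "a = (i, b)" by fastforce
  let ?w = "eval_word G (\<lambda>i. s (Suc i)) v" and ?x = "if b then s (Suc i) else inv (s (Suc i))"
  have i: "1 \<le> i" "Suc i < n" and v: "set v \<subseteq> {1..<n - 1} \<times> UNIV"
    using Cons.prems a by auto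
  have c: "s (Suc i) \<in> carrier G" "?x \<in> carrier G" "?w \<in> carrier G" "u \<in> carrier G"
    using i s_closed[of "Suc i"] eval_word_closed[OF shift_funcset v] U_closed[OF u] by auto
  have "?x \<otimes> (?w \<otimes> u \<otimes> inv ?w) \<otimes> inv ?x \<in> push_group"
    using s_conj_push_group[of "Suc i", OF _ _ Cons.IH[OF v]] i c by auto
  moreover have "eval_word G (\<lambda>i. s (Suc i)) (a # v) = ?x \<otimes> ?w"
    by (simp add: a)
  ultimately show ?case
    using c(2-) by (simp only: m_assoc inv_mult_group m_closed inv_closed)
qed

lemma fill_stirrer_Cons:
  "fill_stirrer p (a # w)
    = fill_stirrer p [a] @ fill_stirrer (Transposition.transpose (fst a) (Suc (fst a)) p) w"
  by (cases a) (auto simp: Transposition.transpose_def)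

text \<open>Letters are treated one by one. The push that a later letter produces has to travel to the front across
  the obstacle crossings already collected, which the normalisation lemma permits.\<close>

lemma comb_word:
  assumes "set w \<subseteq> {1..<n} \<times> UNIV" "1 \<le> p" "p \<le> n"
  shows "\<exists>u\<in>push_group. tau p \<otimes> eval_word G s w =
    u \<otimes> eval_word G (\<lambda>i. s (Suc i)) (fill_stirrer p w) \<otimes> tau (stirrer_end p w)
    \<and> 1 \<le> stirrer_end p w \<and> stirrer_end p w \<le> n"
  using assms
proof (induction w arbitrary: p)
  case Nil
  then show ?case by (intro bexI[where x = \<one>]) (auto simp: tau_closed one_in_push_group)
next
  case (Cons a w)
  obtain i b where a: "a = (i, b)" by fastforce
  have i: "1 \<le> i" "i < n" and w: "set w \<subseteq> {1..<n} \<times> UNIV" and p: "1 \<le> p" "p \<le> n"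
    using Cons.prems a by auto
  let ?q = "Transposition.transpose i (Suc i) p"
  have q: "1 \<le> ?q" "?q \<le> n" using i p by (auto simp: Transposition.transpose_def)
  let ?S = "eval_word G (\<lambda>i. s (Suc i))"
  obtain u where u: "u \<in> push_group" "tau p \<otimes> eval_word G s [(i, b)] = u \<otimes> ?S (fill_stirrer p [(i, b)]) \<otimes> tau ?q"
    using comb_letter[OF p i] by blast
  obtain u' where u': "u' \<in> push_group" "tau ?q \<otimes> eval_word G s w
      = u' \<otimes> ?S (fill_stirrer ?q w) \<otimes> tau (stirrer_end ?q w)"
    "1 \<le> stirrer_end ?q w" "stirrer_end ?q w \<le> n"
    using Cons.IH[OF w q] by blast
  let ?x = "?S (fill_stirrer p [(i, b)])" and ?y = "?S (fill_stirrer ?q w)"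
  let ?t = "tau (stirrer_end ?q w)"
  have n: "Suc (n - 1) = n" using i by simp
  have set: "set (fill_stirrer p [(i, b)]) \<subseteq> {1..<n - 1} \<times> UNIV"
    "set (fill_stirrer ?q w) \<subseteq> {1..<n - 1} \<times> UNIV"
    using set_fill_stirrer[of _ "n - 1"] i p q w n by auto
  have "?x \<in> carrier G" "?y \<in> carrier G" "u \<in> carrier G" "u' \<in> carrier G" "?t \<in> carrier G"
    "eval_word G s [(i, b)] \<in> carrier G" "eval_word G s w \<in> carrier G" "tau p \<in> carrier G"
    "tau ?q \<in> carrier G"
    using i eval_word_closed[OF shift_funcset set(1)] eval_word_closed[OF shift_funcset set(2)]
      U_closed[OF u(1)] U_closed[OF u'(1)] tau_closed[OF u'(4)] tau_closed[OF q(2)]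
      tau_closed[OF p(2)] eval_word_closed[OF s_funcset w] s_closed[OF i] by auto
  note c = this
  have fs: "fill_stirrer p (a # w) = fill_stirrer p [(i, b)] @ fill_stirrer ?q w"
    by (subst fill_stirrer_Cons) (simp only: a fst_conv)
  have "eval_word G s (a # w) = eval_word G s [(i, b)] \<otimes> eval_word G s w"
    using c a i s_closed[of i] by auto
  then have "tau p \<otimes> eval_word G s (a # w) = (tau p \<otimes> eval_word G s [(i, b)]) \<otimes> eval_word G s w"
    using c by (simp only: m_assoc)
  also have "\<dots> = u \<otimes> ?x \<otimes> (tau ?q \<otimes> eval_word G s w)"
    using c by (simp only: u m_assoc m_closed)
  also have "\<dots> = u \<otimes> (?x \<otimes> u' \<otimes> inv ?x) \<otimes> (?x \<otimes> ?y) \<otimes> ?t"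
    using c by (simp only: u' m_assoc m_closed inv_closed inv_mult_cancel_left)
  also have "?x \<otimes> ?y = ?S (fill_stirrer p (a # w))"
    unfolding fs by (rule eval_word_append[OF shift_funcset set, symmetric])
  finally show ?case
    using u' mult_in_push_group[OF u(1) shift_conj_push_group[OF set(1) u'(1)]] by (auto simp: a)
qed

end

section \<open>The braid group and its point pushes\<close>

lemma braid_relators_closed: "braid_relators n \<subseteq> carrier (free_group {1..<n})"
  by (auto simp: braid_relators_def free_group_def reduced_word_def cancelling_def)

lemma normal_braid_relators:
  "normal_closure (free_group {1..<n}) (braid_relators n) \<lhd> free_group {1..<n}"
  by (rule normal_normal_closure[OF group_free_group braid_relators_closed])

lemma group_braid_group: "group (braid_group n)"
  unfolding braid_group_def by (rule normal.factorgroup_is_group[OF normal_braid_relators])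

lemma eval_word_sigma:
  assumes "w \<in> carrier (free_group {1..<n})"
  shows "eval_word (braid_group n) (sigma n) w
    = normal_closure (free_group {1..<n}) (braid_relators n) #>\<^bsub>free_group {1..<n}\<^esub> w"
proof -
  let ?F = "free_group {1..<n}" and ?N = "normal_closure (free_group {1..<n}) (braid_relators n)"
  have "(\<lambda>a. ?N #>\<^bsub>?F\<^esub> a) \<in> hom ?F (braid_group n)"
    unfolding braid_group_def by (rule normal.r_coset_hom_Mod[OF normal_braid_relators])
  from hom_free_group_conv_eval_word[OF group_braid_group this assms]
  show ?thesis by (simp add: sigma_def[abs_def])
qed

lemma sigma_closed: "1 \<le> i \<Longrightarrow> i < n \<Longrightarrow> sigma n i \<in> carrier (braid_group n)"
  using letter_in_free_group[of i "{1..<n}" True]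
  by (auto simp: braid_group_def carrier_FactGroup sigma_def)

lemma eval_word_braid_relator:
  assumes "r \<in> braid_relators n"
  shows "eval_word (braid_group n) (sigma n) r = \<one>\<^bsub>braid_group n\<^esub>"
proof -
  let ?F = "free_group {1..<n}" and ?N = "normal_closure (free_group {1..<n}) (braid_relators n)"
  interpret F: group ?F by (rule group_free_group)
  interpret normal ?N ?F by (rule normal_braid_relators)
  have r: "r \<in> carrier ?F" using assms braid_relators_closed by auto
  then have "\<one>\<^bsub>?F\<^esub> \<otimes>\<^bsub>?F\<^esub> r \<otimes>\<^bsub>?F\<^esub> inv\<^bsub>?F\<^esub> \<one>\<^bsub>?F\<^esub> \<in> ?N"
    unfolding normal_closure_def using assms by (blast intro: generate.incl F.one_closed)
  then have "r \<in> ?N" using r by (simp only: F.l_one F.r_one F.inv_one)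
  then show ?thesis unfolding eval_word_sigma[OF r]
    using F.coset_join2[OF r subgroup_axioms] by (simp add: braid_group_def)
qed

lemma braid_generators_sigma: "braid_generators (braid_group n) n (sigma n)"
proof -
  let ?B = "braid_group n"
  interpret group "braid_group n" by (rule group_braid_group)
  show ?thesis
  proof
    fix i :: nat assume i: "1 \<le> i" "i < n"
    then show "sigma n i \<in> carrier ?B" by (rule sigma_closed)
  next
    fix i :: nat assume i: "1 \<le> i" "Suc i < n"
    let ?a = "sigma n i" and ?b = "sigma n (Suc i)"
    have c: "?a \<in> carrier ?B" "?b \<in> carrier ?B"
      using i by (auto intro: sigma_closed)
    have "[(i, True), (Suc i, True), (i, True), (Suc i, False), (i, False), (Suc i, False)]
        \<in> braid_relators n"
      using i by (auto simp: braid_relators_def)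
    from eval_word_braid_relator[OF this]
    have "(?a \<otimes>\<^bsub>?B\<^esub> ?b \<otimes>\<^bsub>?B\<^esub> ?a) \<otimes>\<^bsub>?B\<^esub>
      inv\<^bsub>?B\<^esub> (?b \<otimes>\<^bsub>?B\<^esub> ?a \<otimes>\<^bsub>?B\<^esub> ?b) = \<one>\<^bsub>?B\<^esub>"
      using c by (simp add: inv_mult_group m_assoc)
    then show "?a \<otimes>\<^bsub>?B\<^esub> ?b \<otimes>\<^bsub>?B\<^esub> ?a = ?b \<otimes>\<^bsub>?B\<^esub> ?a \<otimes>\<^bsub>?B\<^esub> ?b"
      using c by (simp only: inv_solve_right' m_closed one_closed l_one)
  next
    fix i j :: nat assume ij: "1 \<le> i" "i + 2 \<le> j" "j < n"
    let ?a = "sigma n i" and ?b = "sigma n j"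
    have c: "?a \<in> carrier ?B" "?b \<in> carrier ?B"
      using ij by (auto intro: sigma_closed)
    have "[(i, True), (j, True), (i, False), (j, False)] \<in> braid_relators n"
      using ij by (auto simp: braid_relators_def)
    from eval_word_braid_relator[OF this]
    have "(?a \<otimes>\<^bsub>?B\<^esub> ?b) \<otimes>\<^bsub>?B\<^esub>
      inv\<^bsub>?B\<^esub> (?b \<otimes>\<^bsub>?B\<^esub> ?a) = \<one>\<^bsub>?B\<^esub>"
      using c by (simp add: inv_mult_group m_assoc)
    then show "?a \<otimes>\<^bsub>?B\<^esub> ?b = ?b \<otimes>\<^bsub>?B\<^esub> ?a"
      using c by (simp only: inv_solve_right' m_closed one_closed l_one)
  qed
qed

lemma braid_group_hom:
  assumes "braid_generators H n s"
  obtains h where "h \<in> hom (braid_group n) H" "\<And>i. 1 \<le> i \<Longrightarrow> i < n \<Longrightarrow> h (sigma n i) = s i"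
proof -
  interpret braid_generators H n s by fact
  have rel: "eval_word H s r = \<one>\<^bsub>H\<^esub>" if "r \<in> braid_relators n" for r
  proof -
    have "(\<exists>i. r = [(i, True), (Suc i, True), (i, True), (Suc i, False), (i, False), (Suc i, False)]
        \<and> 1 \<le> i \<and> Suc i < n) \<or>
      (\<exists>i j. r = [(i, True), (j, True), (i, False), (j, False)] \<and> 1 \<le> i \<and> i + 2 \<le> j \<and> j < n)"
      using that by (simp add: braid_relators_def)
    then show ?thesis
    proof (elim disjE exE conjE)
      fix i assume r: "r = [(i, True), (Suc i, True), (i, True), (Suc i, False), (i, False), (Suc i, False)]"
        and i: "1 \<le> i" "Suc i < n"
      have c: "s i \<in> carrier H" "s (Suc i) \<in> carrier H" using i by (auto intro: s_closed)
      have "eval_word H s r = (s i \<otimes>\<^bsub>H\<^esub> s (Suc i) \<otimes>\<^bsub>H\<^esub> s i) \<otimes>\<^bsub>H\<^esub> inv\<^bsub>H\<^esub> (s (Suc i) \<otimes>\<^bsub>H\<^esub> s i \<otimes>\<^bsub>H\<^esub> s (Suc i))"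
        using c by (simp add: r m_assoc inv_mult_group)
      then show ?thesis using c by (simp only: braid_rel[OF i] r_inv m_closed)
    next
      fix i j assume r: "r = [(i, True), (j, True), (i, False), (j, False)]"
        and ij: "1 \<le> i" "i + 2 \<le> j" "j < n"
      have c: "s i \<in> carrier H" "s j \<in> carrier H" using ij by (auto intro: s_closed)
      have "eval_word H s r = (s i \<otimes>\<^bsub>H\<^esub> s j) \<otimes>\<^bsub>H\<^esub> inv\<^bsub>H\<^esub> (s j \<otimes>\<^bsub>H\<^esub> s i)"
        using c by (simp add: r m_assoc inv_mult_group)
      then show ?thesis using c by (simp only: commute_rel[OF ij] r_inv m_closed)
    qed
  qed
  show thesis
    by (rule hom_from_presentation[OF braid_relators_closed is_group s_funcset rel])
      (auto simp: braid_group_def sigma_def intro!: that)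
qed

lemma braid_coset_memD:
  assumes "\<beta> \<in> carrier (braid_group n)" "w \<in> \<beta>"
  shows "set w \<subseteq> {1..<n} \<times> UNIV" "eval_word (braid_group n) (sigma n) w = \<beta>"
proof -
  let ?F = "free_group {1..<n}" and ?N = "normal_closure (free_group {1..<n}) (braid_relators n)"
  interpret F: group ?F by (rule group_free_group)
  interpret normal ?N ?F by (rule normal_braid_relators)
  obtain v where v: "v \<in> carrier ?F" "\<beta> = ?N #>\<^bsub>?F\<^esub> v"
    using assms(1) by (auto simp: braid_group_def carrier_FactGroup)
  then have w: "w \<in> carrier ?F"
    using assms(2) F.r_coset_subset_G[OF subset] by auto
  then show "set w \<subseteq> {1..<n} \<times> UNIV" by (simp add: free_group_def)
  have "\<beta> = ?N #>\<^bsub>?F\<^esub> w"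
    using F.repr_independence[of w ?N v] assms(2) v subgroup_axioms by simp
  then show "eval_word (braid_group n) (sigma n) w = \<beta>"
    using w by (simp add: eval_word_sigma)
qed

lemma braid_coset_memI:
  assumes "w \<in> carrier (free_group {1..<n})"
  shows "w \<in> eval_word (braid_group n) (sigma n) w"
    "eval_word (braid_group n) (sigma n) w \<in> carrier (braid_group n)"
proof -
  show "w \<in> eval_word (braid_group n) (sigma n) w"
    unfolding eval_word_sigma[OF assms]
    by (rule group.rcos_self[OF group_free_group assms normal_imp_subgroup[OF normal_braid_relators]])
  show "eval_word (braid_group n) (sigma n) w \<in> carrier (braid_group n)"
    using assms unfolding eval_word_sigma[OF assms] by (auto simp: braid_group_def carrier_FactGroup)
qed

lemma (in group) generate_image_eval_word:
  assumes f: "f \<in> X \<rightarrow> carrier G" and "g \<in> generate G (f ` X)"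
  shows "\<exists>u. set u \<subseteq> X \<times> UNIV \<and> eval_word G f u = g"
  using assms(2)
proof induction
  case one
  show ?case by (intro exI[where x = "[]"]) simp
next
  case (incl h)
  then obtain x where "x \<in> X" "h = f x" by auto
  then show ?case using funcset_mem[OF f] by (intro exI[where x = "[(x, True)]"]) auto
next
  case (inv h)
  then obtain x where "x \<in> X" "h = f x" by auto
  then show ?case using funcset_mem[OF f] by (intro exI[where x = "[(x, False)]"]) auto
next
  case (eng g h)
  then obtain u v where "set u \<subseteq> X \<times> UNIV" "eval_word G f u = g"
    "set v \<subseteq> X \<times> UNIV" "eval_word G f v = h" by blast
  then show ?case
    by (intro exI[where x = "u @ v"]) (auto simp: eval_word_append[OF f])
qed

lemma (in braid_generators) eval_word_push:
  assumes "1 \<le> i" "i < n"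
  shows "eval_word G s (map (\<lambda>k. (k, True)) [1..<i] @ [(i, True), (i, True)] @
    map (\<lambda>k. (k, False)) (rev [1..<i])) = push i"
proof -
  let ?t = "map (\<lambda>k. (k, True)) [1..<i]"
  have t: "set ?t \<subseteq> {1..<n} \<times> UNIV" "set (rev (map (apsnd Not) ?t)) \<subseteq> {1..<n} \<times> UNIV"
    using assms by auto
  have r: "map (\<lambda>k. (k, False)) (rev [1..<i]) = rev (map (apsnd Not) ?t)"
    by (simp add: rev_map o_def)
  have "eval_word G s (?t @ [(i, True), (i, True)] @ rev (map (apsnd Not) ?t))
      = eval_word G s ?t \<otimes> (eval_word G s [(i, True), (i, True)] \<otimes> eval_word G s (rev (map (apsnd Not) ?t)))"
    using t assms by (subst eval_word_append[OF s_funcset] | simp)+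
  also have "eval_word G s (rev (map (apsnd Not) ?t)) = inv (tau i)"
    unfolding tau_def by (rule eval_word_inverse_word[OF s_funcset t(1)])
  also have "eval_word G s ?t = tau i"
    by (simp add: tau_def)
  finally show ?thesis
    using assms s_closed[of i] tau_closed[of i] unfolding r
    by (simp add: push_def m_assoc)
qed

lemma alpha_eq_push:
  assumes "1 \<le> i" "i \<le> N"
  shows "alpha N i = braid_generators.push (braid_group (Suc N)) (sigma (Suc N)) i"
  unfolding alpha_def
  using braid_generators.eval_word_push[OF braid_generators_sigma, of i "Suc N"] assms by simp

lemma alpha_closed: "1 \<le> i \<Longrightarrow> i \<le> N \<Longrightarrow> alpha N i \<in> carrier (braid_group (Suc N))"
  using braid_generators.push_closed[OF braid_generators_sigma, of i "Suc N"]
  by (simp add: alpha_eq_push)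

text \<open>In the combed form of a point push the obstacle part is trivial, because it is the image of the trivial
  braid under the homomorphism that inserts a string on the left, and the stirrer returns to where it
  started.\<close>

lemma point_push_alpha_word:
  assumes "\<beta> \<in> point_push N"
  obtains u where "set u \<subseteq> {1..N} \<times> UNIV" "eval_word (braid_group (Suc N)) (alpha N) u = \<beta>"
proof -
  interpret B: braid_generators "braid_group (Suc N)" "Suc N" "sigma (Suc N)"
    by (rule braid_generators_sigma)
  obtain w where w: "\<beta> \<in> carrier (braid_group (Suc N))" "w \<in> \<beta>" "braid_perm w = id"
    "eval_word (braid_group N) (sigma N) (fill_stirrer 1 w) = \<one>\<^bsub>braid_group N\<^esub>"
    using assms by (auto simp: point_push_def)
  note w' = braid_coset_memD[OF w(1,2)]
  have e: "stirrer_end 1 w = 1"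
    using braid_perm_stirrer_end[of w 1] w(3) by simp
  \<comment> \<open>The homomorphism that inserts the stirrer to the left of a braid of the obstacles.\<close>
  have shift: "braid_generators (braid_group (Suc N)) N (\<lambda>i. sigma (Suc N) (Suc i))"
    using B.s_closed B.braid_rel[of "Suc _"] B.commute_rel[of "Suc _" "Suc _"] by unfold_locales simp_all
  then obtain h where h: "h \<in> hom (braid_group N) (braid_group (Suc N))"
    "\<And>i. 1 \<le> i \<Longrightarrow> i < N \<Longrightarrow> h (sigma N i) = sigma (Suc N) (Suc i)"
    by (rule braid_group_hom) blast
  have set: "set (fill_stirrer 1 w) \<subseteq> {1..<N} \<times> UNIV"
    using set_fill_stirrer[OF w'(1)] by simp
  have "eval_word (braid_group (Suc N)) (\<lambda>i. sigma (Suc N) (Suc i)) (fill_stirrer 1 w)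
      = eval_word (braid_group (Suc N)) (\<lambda>i. h (sigma N i)) (fill_stirrer 1 w)"
    using h(2) by (intro eval_word_cong[OF _ set]) simp
  also have "\<dots> = h (eval_word (braid_group N) (sigma N) (fill_stirrer 1 w))"
    using sigma_closed set
    by (intro hom_eval_word[OF group_braid_group group_braid_group h(1), symmetric]) auto
  also have "\<dots> = \<one>\<^bsub>braid_group (Suc N)\<^esub>"
    using hom_one[OF h(1) group_braid_group group_braid_group] w(4) by simp
  finally have fill: "eval_word (braid_group (Suc N)) (\<lambda>i. sigma (Suc N) (Suc i)) (fill_stirrer 1 w)
      = \<one>\<^bsub>braid_group (Suc N)\<^esub>" .
  obtain u where u: "u \<in> B.push_group" "B.tau 1 \<otimes>\<^bsub>braid_group (Suc N)\<^esub> eval_word (braid_group (Suc N)) (sigma (Suc N)) w =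
    u \<otimes>\<^bsub>braid_group (Suc N)\<^esub> eval_word (braid_group (Suc N)) (\<lambda>i. sigma (Suc N) (Suc i)) (fill_stirrer 1 w)
    \<otimes>\<^bsub>braid_group (Suc N)\<^esub> B.tau (stirrer_end 1 w)"
    using B.comb_word[OF w'(1), of 1] by auto
  then have "\<beta> = u"
    unfolding e fill using w(1) w'(2) B.U_closed by simp
  with u have "\<beta> \<in> generate (braid_group (Suc N)) (B.push ` {1..N})"
    by (simp add: B.push_group_def atLeastLessThanSuc_atLeastAtMost)
  also have "B.push ` {1..N} = alpha N ` {1..N}"
    using alpha_eq_push by (intro image_cong) auto
  finally show thesis
    using B.generate_image_eval_word[of "alpha N" "{1..N}" \<beta>] alpha_closed that by auto
qed

section \<open>Automorphisms of free groups\<close>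

lemma (in group) auto_hom: "f \<in> auto G \<Longrightarrow> group_hom G G f"
  by (unfold_locales) (simp add: auto_def)

lemma (in group) AutoGroup_mult_apply:
  "f \<in> auto G \<Longrightarrow> g \<in> auto G \<Longrightarrow> x \<in> carrier G \<Longrightarrow> (f \<otimes>\<^bsub>AutoGroup G\<^esub> g) x = f (g x)"
  by (simp add: AutoGroup_def BijGroup_def auto_def compose_def)

lemma carrier_AutoGroup: "carrier (AutoGroup G) = auto G"
  by (simp add: AutoGroup_def)

lemma one_AutoGroup: "\<one>\<^bsub>AutoGroup G\<^esub> = (\<lambda>x\<in>carrier G. x)"
  by (simp add: AutoGroup_def BijGroup_def)

lemma auto_eqI:
  assumes "f \<in> auto G" "g \<in> auto G" "\<And>x. x \<in> carrier G \<Longrightarrow> f x = g x"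
  shows "f = g"
  using assms by (intro extensionalityI[of f "carrier G" g]) (auto simp: auto_def Bij_def)

lemma (in group) autoI:
  assumes "f \<in> hom G G" "f \<in> extensional (carrier G)" "g \<in> carrier G \<rightarrow> carrier G"
    and "\<And>x. x \<in> carrier G \<Longrightarrow> f (g x) = x" "\<And>x. x \<in> carrier G \<Longrightarrow> g (f x) = x"
  shows "f \<in> auto G"
proof -
  have "f \<in> carrier G \<rightarrow> carrier G" using assms(1) by (auto simp: hom_def)
  then have "bij_betw f (carrier G) (carrier G)"
    using assms by (intro bij_betwI[where g = g]) auto
  then show ?thesis using assms by (simp add: auto_def Bij_def)
qed

definition free_endo :: "'x set \<Rightarrow> ('x \<Rightarrow> 'x gword) \<Rightarrow> 'x gword \<Rightarrow> 'x gword" where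
  "free_endo X f = restrict (eval_word (free_group X) f) (carrier (free_group X))"

lemma free_endo_hom:
  assumes "f \<in> X \<rightarrow> carrier (free_group X)"
  shows "free_endo X f \<in> hom (free_group X) (free_group X)"
proof -
  interpret group "free_group X" by (rule group_free_group)
  show ?thesis
    unfolding free_endo_def using eval_word_hom[OF assms] by (auto simp: hom_def)
qed

lemma free_endo_extensional: "free_endo X f \<in> extensional (carrier (free_group X))"
  by (simp add: free_endo_def)

lemma free_endo_letter:
  assumes "f \<in> X \<rightarrow> carrier (free_group X)" "x \<in> X"
  shows "free_endo X f [(x, True)] = f x"
  using assms group.is_monoid[OF group_free_group, of X]
  by (auto simp: free_endo_def letter_in_free_group monoid.r_one dest!: funcset_mem)

lemma hom_id: "(\<lambda>x. x) \<in> hom G G"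
  by (simp add: hom_def)

section \<open>Artin's action on the free group\<close>

(* Bounds of intervals keep the form 1 instead of Suc 0. *)
declare One_nat_def [simp del]

lemma reduced_positive: "reduced_word (map (\<lambda>k. (k, True)) xs)"
  by (induction xs rule: induct_list012) (auto simp: reduced_word_def cancelling_def)

definition delta_prod :: "nat \<Rightarrow> nat \<Rightarrow> nat \<Rightarrow> nat gword" where
  "delta_prod N a b = map (\<lambda>k. (k, True)) [a..<b]"

text \<open>Simple loops around the punctures from left to right: \<open>k = 1\<close> is the stirrer, \<open>k > 1\<close> the obstacle
  number \<open>k - 1\<close>. They are Artin's generators, whose product is the inverse of \<open>\<delta>\<^sub>N\<^sub>+\<^sub>1\<close>.\<close>

definition loop :: "nat \<Rightarrow> nat \<Rightarrow> nat gword" where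
  "loop N k = (if k = 1 then inv\<^bsub>pi1 N\<^esub> (delta_prod N 1 (N + 2)) else delta (k - 1))"

context
  fixes N :: nat
begin

interpretation F: group "pi1 N"
  by (rule group_free_group)

abbreviation pi1_mult (infixl \<open>\<cdot>\<close> 70) where "u \<cdot> v \<equiv> u \<otimes>\<^bsub>pi1 N\<^esub> v"
abbreviation pi1_inv where "pi1_inv u \<equiv> inv\<^bsub>pi1 N\<^esub> u"

lemma delta_closed: "1 \<le> i \<Longrightarrow> i \<le> Suc N \<Longrightarrow> delta i \<in> carrier (pi1 N)"
  by (simp add: delta_def letter_in_free_group)

lemma delta_prod_closed: "1 \<le> a \<Longrightarrow> b \<le> N + 2 \<Longrightarrow> delta_prod N a b \<in> carrier (pi1 N)"
  by (auto simp: delta_prod_def free_group_def reduced_positive)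

lemma delta_prod_append:
  assumes "1 \<le> a" "a \<le> b" "b \<le> c" "c \<le> N + 2"
  shows "delta_prod N a c = delta_prod N a b \<cdot> delta_prod N b c"
proof -
  have "[a..<c] = [a..<b] @ [b..<c]"
    using assms by (metis le_Suc_ex upt_add_eq_append)
  then show ?thesis
    by (simp add: delta_prod_def free_group_def reduce_reduced_word reduced_positive flip: map_append)
qed

lemma delta_prod_single: "delta_prod N a (Suc a) = delta a"
  by (simp add: delta_prod_def delta_def)

lemma delta_prod_empty: "delta_prod N a a = \<one>\<^bsub>pi1 N\<^esub>"
  by (simp add: delta_prod_def free_group_def)

lemma push_word_eq:
  assumes "1 \<le> j" "j \<le> N"
  shows "push_word N j = delta_prod N (Suc j) (N + 2) \<cdot> delta_prod N 1 j"
  by (simp add: push_word_def delta_prod_def free_group_def reduce_reduced_word reduced_positive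
      flip: map_append)

lemma push_word_closed:
  assumes "1 \<le> j" "j \<le> N"
  shows "push_word N j \<in> carrier (pi1 N)"
  using assms by (simp add: push_word_eq delta_prod_closed)

lemma loop_closed: "1 \<le> k \<Longrightarrow> k \<le> Suc N \<Longrightarrow> loop N k \<in> carrier (pi1 N)"
  by (auto simp: loop_def delta_closed delta_prod_closed)

lemma hom_delta_prod_fixed:
  assumes h: "h \<in> hom (pi1 N) (pi1 N)" and ab: "1 \<le> a" "b \<le> N + 2"
    and fix_gen: "\<And>i. a \<le> i \<Longrightarrow> i < b \<Longrightarrow> h (delta i) = delta i"
  shows "h (delta_prod N a b) = delta_prod N a b"
proof -
  have c: "delta_prod N a b \<in> carrier (pi1 N)" using ab by (rule delta_prod_closed)
  have w: "set (delta_prod N a b) \<subseteq> {a..<b} \<times> UNIV" by (auto simp: delta_prod_def)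
  have "h (delta_prod N a b) = eval_word (pi1 N) (\<lambda>x. h [(x, True)]) (delta_prod N a b)"
    by (rule hom_free_group_conv_eval_word[OF F.is_group h c])
  also have "\<dots> = eval_word (pi1 N) (\<lambda>x. [(x, True)]) (delta_prod N a b)"
    using fix_gen by (intro eval_word_cong[OF _ w]) (simp add: delta_def)
  also have "\<dots> = delta_prod N a b"
    using w ab by (subst eval_word_letters) (auto simp: reduce_reduced_word delta_prod_def reduced_positive)
  finally show ?thesis .
qed

text \<open>The loops generate: \<open>\<delta>\<^sub>N\<^sub>+\<^sub>1\<close> is the inverse of their product.\<close>

lemma loop_hom_eqI:
  assumes g: "g \<in> hom (pi1 N) (pi1 N)" and h: "h \<in> hom (pi1 N) (pi1 N)"
    and eq: "\<And>k. 1 \<le> k \<Longrightarrow> k \<le> Suc N \<Longrightarrow> g (loop N k) = h (loop N k)"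
    and w: "w \<in> carrier (pi1 N)"
  shows "g w = h w"
proof (rule hom_free_group_eqI[OF F.is_group g h _ w])
  interpret g: group_hom "pi1 N" "pi1 N" g by unfold_locales (rule g)
  interpret h: group_hom "pi1 N" "pi1 N" h by unfold_locales (rule h)
  have d: "g (delta i) = h (delta i)" if "1 \<le> i" "i \<le> N" for i
    using eq[of "Suc i"] that by (simp add: loop_def)
  have c: "delta_prod N 1 (Suc N) \<in> carrier (pi1 N)" "delta_prod N 1 (N + 2) \<in> carrier (pi1 N)"
    "delta (Suc N) \<in> carrier (pi1 N)"
    by (simp_all add: delta_prod_closed delta_closed)
  have "g (delta_prod N 1 (Suc N)) = h (delta_prod N 1 (Suc N))"
    using d c(1) unfolding hom_free_group_conv_eval_word[OF F.is_group g c(1)]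
      hom_free_group_conv_eval_word[OF F.is_group h c(1)]
    by (intro eval_word_cong[where X = "{1..N}"]) (auto simp: delta_prod_def delta_def)
  moreover have "g (delta_prod N 1 (N + 2)) = h (delta_prod N 1 (N + 2))"
  proof -
    have "g (pi1_inv (loop N 1)) = h (pi1_inv (loop N 1))"
      using eq[of 1] loop_closed[of 1] by simp
    moreover have "pi1_inv (loop N 1) = delta_prod N 1 (N + 2)"
      using c(2) by (simp add: loop_def)
    ultimately show ?thesis by simp
  qed
  moreover have "delta (Suc N) = pi1_inv (delta_prod N 1 (Suc N)) \<cdot> delta_prod N 1 (N + 2)"
    using c delta_prod_append[of 1 "Suc N" "N + 2"] delta_prod_single[of "Suc N"]
    by (simp add: F.inv_mult_cancel_left)
  ultimately have last: "g (delta (Suc N)) = h (delta (Suc N))"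
    using c by simp
  fix x assume "x \<in> {1..Suc N}"
  then show "g [(x, True)] = h [(x, True)]"
    using d[of x] last by (cases "x = Suc N") (auto simp: delta_def)
qed

text \<open>The loops are a free basis: any images may be prescribed for them. The value at \<open>\<delta>\<^sub>N\<^sub>+\<^sub>1\<close> is then
  forced to be the inverse of the product of all images.\<close>

lemma loop_basis:
  assumes y: "y \<in> {1..Suc N} \<rightarrow> carrier (pi1 N)"
  obtains h where "h \<in> hom (pi1 N) (pi1 N)" "h \<in> extensional (carrier (pi1 N))"
    "\<And>k. 1 \<le> k \<Longrightarrow> k \<le> Suc N \<Longrightarrow> h (loop N k) = y k"
proof -
  let ?Y = "eval_word (pi1 N) (\<lambda>k. y (Suc k)) (delta_prod N 1 (Suc N))"
  define f where "f i = (if i \<le> N then y (Suc i) else pi1_inv (y 1 \<cdot> ?Y))" for i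
  have set: "set (delta_prod N 1 (Suc N)) \<subseteq> {1..N} \<times> UNIV" by (auto simp: delta_prod_def)
  have Y: "?Y \<in> carrier (pi1 N)"
    using y by (intro F.eval_word_closed[OF _ set]) auto
  have y1: "y 1 \<in> carrier (pi1 N)" using y by auto
  have f: "f \<in> {1..Suc N} \<rightarrow> carrier (pi1 N)"
    using y Y y1 by (auto simp: f_def)
  define h where "h = free_endo {1..Suc N} f"
  have h: "h \<in> hom (pi1 N) (pi1 N)" unfolding h_def by (rule free_endo_hom[OF f])
  interpret h: group_hom "pi1 N" "pi1 N" h by unfold_locales (rule h)
  have hd: "h (delta i) = f i" if "1 \<le> i" "i \<le> Suc N" for i
    unfolding h_def delta_def using free_endo_letter[OF f] that by simp
  have c: "delta_prod N 1 (Suc N) \<in> carrier (pi1 N)" "delta_prod N 1 (N + 2) \<in> carrier (pi1 N)"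
    "delta (Suc N) \<in> carrier (pi1 N)"
    by (simp_all add: delta_prod_closed delta_closed)
  have "h (delta_prod N 1 (Suc N)) = ?Y"
    unfolding hom_free_group_conv_eval_word[OF F.is_group h c(1)]
    using hd by (intro eval_word_cong[OF _ set]) (auto simp: f_def delta_def)
  moreover have "delta_prod N 1 (N + 2) = delta_prod N 1 (Suc N) \<cdot> delta (Suc N)"
    using delta_prod_append[of 1 "Suc N" "N + 2"] delta_prod_single[of "Suc N"] by simp
  ultimately have "h (delta_prod N 1 (N + 2)) = ?Y \<cdot> pi1_inv (y 1 \<cdot> ?Y)"
    using c hd[of "Suc N"] by (simp add: f_def)
  then have "h (delta_prod N 1 (N + 2)) = pi1_inv (y 1)"
    using Y y1 by (simp add: F.inv_mult_group F.inv_mult_cancel_left)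
  then have 1: "h (loop N 1) = y 1"
    using c y1 by (simp add: loop_def)
  have "h (loop N k) = y k" if "1 \<le> k" "k \<le> Suc N" for k
    using 1 hd[of "k - 1"] that by (cases "k = 1") (auto simp: loop_def f_def)
  then show thesis
    using h by (intro that[of h]) (auto simp: h_def free_endo_extensional)
qed

lemma artin_exists:
  assumes "1 \<le> i" "i \<le> N"
  shows "\<exists>t\<in>auto (pi1 N). t (loop N i) = loop N (Suc i) \<and>
    t (loop N (Suc i)) = pi1_inv (loop N (Suc i)) \<cdot> loop N i \<cdot> loop N (Suc i) \<and>
    (\<forall>k. 1 \<le> k \<longrightarrow> k \<le> Suc N \<longrightarrow> k \<noteq> i \<longrightarrow> k \<noteq> Suc i \<longrightarrow> t (loop N k) = loop N k)"
proof -
  let ?a = "loop N i" and ?b = "loop N (Suc i)"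
  have c: "?a \<in> carrier (pi1 N)" "?b \<in> carrier (pi1 N)"
    using assms by (auto intro: loop_closed)
  have "(\<lambda>k. if k = i then ?b else if k = Suc i then pi1_inv ?b \<cdot> ?a \<cdot> ?b else loop N k)
      \<in> {1..Suc N} \<rightarrow> carrier (pi1 N)"
    using c by (auto simp: loop_closed)
  from loop_basis[OF this] obtain t where t: "t \<in> hom (pi1 N) (pi1 N)"
    "t \<in> extensional (carrier (pi1 N))"
    "\<And>k. 1 \<le> k \<Longrightarrow> k \<le> Suc N \<Longrightarrow> t (loop N k)
      = (if k = i then ?b else if k = Suc i then pi1_inv ?b \<cdot> ?a \<cdot> ?b else loop N k)" by blast
  have "(\<lambda>k. if k = Suc i then ?a else if k = i then ?a \<cdot> ?b \<cdot> pi1_inv ?a else loop N k)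
      \<in> {1..Suc N} \<rightarrow> carrier (pi1 N)"
    using c by (auto simp: loop_closed)
  from loop_basis[OF this] obtain r where r: "r \<in> hom (pi1 N) (pi1 N)"
    "r \<in> extensional (carrier (pi1 N))"
    "\<And>k. 1 \<le> k \<Longrightarrow> k \<le> Suc N \<Longrightarrow> r (loop N k)
      = (if k = Suc i then ?a else if k = i then ?a \<cdot> ?b \<cdot> pi1_inv ?a else loop N k)" by blast
  interpret t: group_hom "pi1 N" "pi1 N" t by unfold_locales (rule t)
  interpret r: group_hom "pi1 N" "pi1 N" r by unfold_locales (rule r)
  have ti: "t ?a = ?b" "t ?b = pi1_inv ?b \<cdot> ?a \<cdot> ?b" and ri: "r ?a = ?a \<cdot> ?b \<cdot> pi1_inv ?a" "r ?b = ?a"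
    using t(3)[of i] t(3)[of "Suc i"] r(3)[of i] r(3)[of "Suc i"] assms by auto
  have "t \<in> auto (pi1 N)"
  proof (rule F.autoI[OF t(1,2), of r])
    show "r \<in> carrier (pi1 N) \<rightarrow> carrier (pi1 N)" by auto
    fix w assume w: "w \<in> carrier (pi1 N)"
    show "t (r w) = w"
    proof (rule loop_hom_eqI[where g = "\<lambda>w. t (r w)" and h = "\<lambda>w. w", OF _ hom_id _ w])
      show "(\<lambda>w. t (r w)) \<in> hom (pi1 N) (pi1 N)"
        by (auto simp: hom_def)
      fix k assume k: "1 \<le> k" "k \<le> Suc N"
      then show "t (r (loop N k)) = loop N k"
        using c ti t(3)[OF k] r(3)[OF k] by (auto simp: F.m_assoc F.inv_mult_cancel_left)
    qed
    show "r (t w) = w"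
    proof (rule loop_hom_eqI[where g = "\<lambda>w. r (t w)" and h = "\<lambda>w. w", OF _ hom_id _ w])
      show "(\<lambda>w. r (t w)) \<in> hom (pi1 N) (pi1 N)"
        by (auto simp: hom_def)
      fix k assume k: "1 \<le> k" "k \<le> Suc N"
      then show "r (t (loop N k)) = loop N k"
        using c ri t(3)[OF k] r(3)[OF k] by (auto simp: F.m_assoc F.inv_mult_group F.inv_mult_cancel_left)
    qed
  qed
  then show ?thesis using ti t(3) by (intro bexI[of _ t]) auto
qed

end

text \<open>For Artin's generators a letter on the left acts first, whereas the automorphism group multiplies by
  composition. Their inverses are used here, so that the assignment is a homomorphism.\<close>

definition artin :: "nat \<Rightarrow> nat \<Rightarrow> nat gword \<Rightarrow> nat gword" where
  "artin N i = (SOME t. t \<in> auto (pi1 N) \<and> t (loop N i) = loop N (Suc i) \<and>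
    t (loop N (Suc i)) = inv\<^bsub>pi1 N\<^esub> (loop N (Suc i)) \<otimes>\<^bsub>pi1 N\<^esub> loop N i \<otimes>\<^bsub>pi1 N\<^esub> loop N (Suc i) \<and>
    (\<forall>k. 1 \<le> k \<longrightarrow> k \<le> Suc N \<longrightarrow> k \<noteq> i \<longrightarrow> k \<noteq> Suc i \<longrightarrow> t (loop N k) = loop N k))"

lemma artin:
  assumes "1 \<le> i" "i \<le> N"
  shows "artin N i \<in> auto (pi1 N)" "artin N i (loop N i) = loop N (Suc i)"
    "artin N i (loop N (Suc i)) = inv\<^bsub>pi1 N\<^esub> (loop N (Suc i)) \<otimes>\<^bsub>pi1 N\<^esub> loop N i \<otimes>\<^bsub>pi1 N\<^esub> loop N (Suc i)"
    "\<And>k. 1 \<le> k \<Longrightarrow> k \<le> Suc N \<Longrightarrow> k \<noteq> i \<Longrightarrow> k \<noteq> Suc i \<Longrightarrow> artin N i (loop N k) = loop N k"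
proof -
  note * = someI_ex[OF artin_exists[OF assms, unfolded Bex_def], folded artin_def]
  from * show "artin N i \<in> auto (pi1 N)" by (elim conjE)
  from * show "artin N i (loop N i) = loop N (Suc i)" by (elim conjE)
  from * show "artin N i (loop N (Suc i)) = inv\<^bsub>pi1 N\<^esub> (loop N (Suc i)) \<otimes>\<^bsub>pi1 N\<^esub> loop N i \<otimes>\<^bsub>pi1 N\<^esub> loop N (Suc i)"
    by (elim conjE)
  from * show "artin N i (loop N k) = loop N k"
    if "1 \<le> k" "k \<le> Suc N" "k \<noteq> i" "k \<noteq> Suc i" for k
    using that by (elim conjE) blast
qed

lemma auto_loop_eqI:
  assumes "f \<in> auto (pi1 N)" "g \<in> auto (pi1 N)"
    and "\<And>k. 1 \<le> k \<Longrightarrow> k \<le> Suc N \<Longrightarrow> f (loop N k) = g (loop N k)"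
  shows "f = g"
proof (rule auto_eqI[OF assms(1,2)])
  fix w assume w: "w \<in> carrier (pi1 N)"
  have "f \<in> hom (pi1 N) (pi1 N)" "g \<in> hom (pi1 N) (pi1 N)"
    using assms(1,2) by (simp_all add: auto_def)
  from loop_hom_eqI[OF this assms(3) w] show "f w = g w" .
qed

text \<open>All relations are checked on the loops, where both sides are explicit words.\<close>

lemma braid_generators_artin: "braid_generators (AutoGroup (pi1 N)) (Suc N) (artin N)"
proof -
  interpret F: group "pi1 N" by (rule group_free_group)
  interpret A: group "AutoGroup (pi1 N)" by (rule F.AutoGroup)
  let ?A = "AutoGroup (pi1 N)"
  have m: "f \<otimes>\<^bsub>?A\<^esub> g \<in> auto (pi1 N)" if "f \<in> auto (pi1 N)" "g \<in> auto (pi1 N)" for f g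
    using that A.m_closed[of f g] by (simp add: carrier_AutoGroup)
  note loop_c = loop_closed[of _ N]
  show ?thesis
  proof
    fix i assume "1 \<le> i" "i < Suc N"
    then show "artin N i \<in> carrier ?A" by (simp add: carrier_AutoGroup artin)
  next
    fix i assume i: "1 \<le> i" "Suc i < Suc N"
    let ?s = "artin N i" and ?t = "artin N (Suc i)"
    have st: "?s \<in> auto (pi1 N)" "?t \<in> auto (pi1 N)" using i by (auto intro: artin)
    interpret s: group_hom "pi1 N" "pi1 N" ?s by (rule F.auto_hom[OF st(1)])
    interpret t: group_hom "pi1 N" "pi1 N" ?t by (rule F.auto_hom[OF st(2)])
    let ?a = "loop N i" and ?b = "loop N (Suc i)" and ?c = "loop N (Suc (Suc i))"
    have c: "?a \<in> carrier (pi1 N)" "?b \<in> carrier (pi1 N)" "?c \<in> carrier (pi1 N)"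
      using i by (auto intro: loop_c)
    have e: "?s ?a = ?b" "?s ?b = inv\<^bsub>pi1 N\<^esub> ?b \<otimes>\<^bsub>pi1 N\<^esub> ?a \<otimes>\<^bsub>pi1 N\<^esub> ?b" "?s ?c = ?c"
      "?t ?a = ?a" "?t ?b = ?c" "?t ?c = inv\<^bsub>pi1 N\<^esub> ?c \<otimes>\<^bsub>pi1 N\<^esub> ?b \<otimes>\<^bsub>pi1 N\<^esub> ?c"
      using i artin[of i N] artin[of "Suc i" N] by auto
    show "?s \<otimes>\<^bsub>?A\<^esub> ?t \<otimes>\<^bsub>?A\<^esub> ?s = ?t \<otimes>\<^bsub>?A\<^esub> ?s \<otimes>\<^bsub>?A\<^esub> ?t"
    proof (rule auto_loop_eqI)
      fix k assume k: "1 \<le> k" "k \<le> Suc N"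
      consider "k = i" | "k = Suc i" | "k = Suc (Suc i)" | "k \<noteq> i" "k \<noteq> Suc i" "k \<noteq> Suc (Suc i)"
        by blast
      then show "(?s \<otimes>\<^bsub>?A\<^esub> ?t \<otimes>\<^bsub>?A\<^esub> ?s) (loop N k) = (?t \<otimes>\<^bsub>?A\<^esub> ?s \<otimes>\<^bsub>?A\<^esub> ?t) (loop N k)"
      proof cases
        case 4
        then have "?s (loop N k) = loop N k" "?t (loop N k) = loop N k"
          using i k by (auto intro: artin)
        then show ?thesis using k by (simp add: st m F.AutoGroup_mult_apply loop_c)
      qed (use c e in \<open>simp_all add: st m F.AutoGroup_mult_apply F.m_assoc F.inv_mult_group
            F.inv_mult_cancel_left\<close>)
    qed (simp_all add: m st)
  next
    fix i j assume ij: "1 \<le> i" "i + 2 \<le> j" "j < Suc N"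
    let ?s = "artin N i" and ?t = "artin N j"
    have st: "?s \<in> auto (pi1 N)" "?t \<in> auto (pi1 N)" using ij by (auto intro: artin)
    interpret s: group_hom "pi1 N" "pi1 N" ?s by (rule F.auto_hom[OF st(1)])
    interpret t: group_hom "pi1 N" "pi1 N" ?t by (rule F.auto_hom[OF st(2)])
    have c: "loop N i \<in> carrier (pi1 N)" "loop N (Suc i) \<in> carrier (pi1 N)"
      "loop N j \<in> carrier (pi1 N)" "loop N (Suc j) \<in> carrier (pi1 N)"
      using ij by (auto intro: loop_c)
    have e: "?s (loop N j) = loop N j" "?s (loop N (Suc j)) = loop N (Suc j)"
      "?t (loop N i) = loop N i" "?t (loop N (Suc i)) = loop N (Suc i)"
      using ij by (auto intro!: artin)
    have e': "?s (loop N i) = loop N (Suc i)" "?t (loop N j) = loop N (Suc j)"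
      "?s (loop N (Suc i)) = inv\<^bsub>pi1 N\<^esub> (loop N (Suc i)) \<otimes>\<^bsub>pi1 N\<^esub> loop N i \<otimes>\<^bsub>pi1 N\<^esub> loop N (Suc i)"
      "?t (loop N (Suc j)) = inv\<^bsub>pi1 N\<^esub> (loop N (Suc j)) \<otimes>\<^bsub>pi1 N\<^esub> loop N j \<otimes>\<^bsub>pi1 N\<^esub> loop N (Suc j)"
      using ij by (auto intro!: artin)
    show "?s \<otimes>\<^bsub>?A\<^esub> ?t = ?t \<otimes>\<^bsub>?A\<^esub> ?s"
    proof (rule auto_loop_eqI)
      fix k assume k: "1 \<le> k" "k \<le> Suc N"
      consider "k = i" | "k = Suc i" | "k = j" | "k = Suc j" | "k \<notin> {i, Suc i, j, Suc j}"
        by blast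
      then show "(?s \<otimes>\<^bsub>?A\<^esub> ?t) (loop N k) = (?t \<otimes>\<^bsub>?A\<^esub> ?s) (loop N k)"
      proof cases
        case 5
        then have "?s (loop N k) = loop N k" "?t (loop N k) = loop N k"
          using ij k by (auto intro: artin)
        then show ?thesis using k by (simp add: st F.AutoGroup_mult_apply loop_c)
      qed (use c e e' in \<open>simp_all add: st F.AutoGroup_mult_apply\<close>)
    qed (simp_all add: m st)
  qed
qed

section \<open>The automorphism induced by a protocol\<close>

text \<open>The images of \<open>\<delta>\<^sub>i\<close> under \<open>\<alpha>\<^sub>j\<close> and, below, under its inverse.\<close>

definition push_image :: "nat \<Rightarrow> nat \<Rightarrow> nat \<Rightarrow> nat gword" where
  "push_image N j i =
    (if i = j then inv\<^bsub>pi1 N\<^esub> (push_word N j) \<otimes>\<^bsub>pi1 N\<^esub> delta j \<otimes>\<^bsub>pi1 N\<^esub> push_word N j else delta i)"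

definition inv_push_image :: "nat \<Rightarrow> nat \<Rightarrow> nat \<Rightarrow> nat gword" where
  "inv_push_image N j i =
    (if i = j then push_word N j \<otimes>\<^bsub>pi1 N\<^esub> delta j \<otimes>\<^bsub>pi1 N\<^esub> inv\<^bsub>pi1 N\<^esub> (push_word N j) else delta i)"

lemma alpha_sharp_free_endo: "alpha_sharp N j = free_endo {1..Suc N} (push_image N j)"
  by (simp add: alpha_sharp_def free_endo_def push_image_def[abs_def])

context
  fixes N j :: nat
  assumes j: "1 \<le> j" "j \<le> N"
begin

interpretation F: group "pi1 N"
  by (rule group_free_group)

interpretation A: group "AutoGroup (pi1 N)"
  by (rule F.AutoGroup)

interpretation artin: braid_generators "AutoGroup (pi1 N)" "Suc N" "artin N"
  by (rule braid_generators_artin)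

lemma push_image_closed:
  "push_image N j \<in> {1..Suc N} \<rightarrow> carrier (pi1 N)"
  "inv_push_image N j \<in> {1..Suc N} \<rightarrow> carrier (pi1 N)"
  using j push_word_closed[of j N] delta_closed[of _ N]
  by (auto simp: push_image_def inv_push_image_def)

lemma alpha_sharp_hom: "alpha_sharp N j \<in> hom (pi1 N) (pi1 N)"
  unfolding alpha_sharp_free_endo by (rule free_endo_hom[OF push_image_closed(1)])

lemma alpha_sharp_delta: "1 \<le> i \<Longrightarrow> i \<le> Suc N \<Longrightarrow> alpha_sharp N j (delta i) = push_image N j i"
  unfolding alpha_sharp_free_endo delta_def
  by (rule free_endo_letter[OF push_image_closed(1)]) simp

lemma alpha_sharp_push_word: "alpha_sharp N j (push_word N j) = push_word N j"
proof -
  interpret group_hom "pi1 N" "pi1 N" "alpha_sharp N j"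
    by unfold_locales (rule alpha_sharp_hom)
  have "alpha_sharp N j (delta_prod N (Suc j) (N + 2)) = delta_prod N (Suc j) (N + 2)"
    "alpha_sharp N j (delta_prod N 1 j) = delta_prod N 1 j"
    using j by (auto intro!: hom_delta_prod_fixed alpha_sharp_hom simp: alpha_sharp_delta push_image_def)
  then show ?thesis
    using j by (simp add: push_word_eq delta_prod_closed)
qed

text \<open>On its way to position \<open>p\<close> the stirrer shifts the obstacles that it passes by one position, while its
  own loop is conjugated by the product of their loops.\<close>

lemma tau_artin_loop:
  assumes "1 \<le> p" "p \<le> Suc N"
  shows "(\<forall>k. 1 \<le> k \<longrightarrow> k < p \<longrightarrow> artin.tau p (loop N k) = loop N (Suc k)) \<and>
    (\<forall>k. p < k \<longrightarrow> k \<le> Suc N \<longrightarrow> artin.tau p (loop N k) = loop N k) \<and>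
    artin.tau p (loop N p) =
      inv\<^bsub>pi1 N\<^esub> (delta_prod N 1 p) \<otimes>\<^bsub>pi1 N\<^esub> loop N 1 \<otimes>\<^bsub>pi1 N\<^esub> delta_prod N 1 p"
  using assms
proof (induction p rule: dec_induct)
  case base
  have "artin.tau 1 = \<one>\<^bsub>AutoGroup (pi1 N)\<^esub>" using artin.tau_1 by (simp only: One_nat_def)
  then show ?case
    by (auto simp: one_AutoGroup loop_closed delta_prod_empty)
next
  case (step p)
  have p: "1 \<le> p" "p \<le> N" using step by auto
  have a: "artin.tau p \<in> auto (pi1 N)" "artin N p \<in> auto (pi1 N)"
    using p artin.tau_closed[of p] artin(1)[of p N] by (auto simp: carrier_AutoGroup)
  interpret t: group_hom "pi1 N" "pi1 N" "artin.tau p" by (rule F.auto_hom[OF a(1)])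
  have tau: "artin.tau (Suc p) (loop N k) = artin.tau p (artin N p (loop N k))"
    if "1 \<le> k" "k \<le> Suc N" for k
    using p that a loop_closed[of k N] by (simp add: artin.tau_Suc F.AutoGroup_mult_apply)
  have IH: "\<And>k. 1 \<le> k \<Longrightarrow> k < p \<Longrightarrow> artin.tau p (loop N k) = loop N (Suc k)"
    "\<And>k. p < k \<Longrightarrow> k \<le> Suc N \<Longrightarrow> artin.tau p (loop N k) = loop N k"
    "artin.tau p (loop N p) =
      inv\<^bsub>pi1 N\<^esub> (delta_prod N 1 p) \<otimes>\<^bsub>pi1 N\<^esub> loop N 1 \<otimes>\<^bsub>pi1 N\<^esub> delta_prod N 1 p"
    using step p by auto
  have d: "loop N (Suc p) = delta p" using p by (simp add: loop_def)
  have c: "delta p \<in> carrier (pi1 N)" "loop N p \<in> carrier (pi1 N)" "loop N 1 \<in> carrier (pi1 N)"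
    "delta_prod N 1 p \<in> carrier (pi1 N)"
    using p by (auto intro: delta_closed loop_closed delta_prod_closed)
  have V: "delta_prod N 1 (Suc p) = delta_prod N 1 p \<otimes>\<^bsub>pi1 N\<^esub> delta p"
    using p delta_prod_append[of 1 p "Suc p" N] by (simp add: delta_prod_single)
  show ?case
  proof (intro conjI allI impI)
    fix k assume k: "1 \<le> k" "k < Suc p"
    show "artin.tau (Suc p) (loop N k) = loop N (Suc k)"
    proof (cases "k = p")
      case True
      then show ?thesis using tau[of p] p IH(2)[of "Suc p"] by (simp add: artin(2))
    next
      case False
      then show ?thesis using tau[of k] p k IH(1)[of k] by (simp add: artin(4))
    qed
  next
    fix k assume "Suc p < k" "k \<le> Suc N"
    then show "artin.tau (Suc p) (loop N k) = loop N k"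
      using tau[of k] p IH(2)[of k] by (simp add: artin(4))
  next
    have "artin.tau (Suc p) (loop N (Suc p)) = inv\<^bsub>pi1 N\<^esub> (delta p) \<otimes>\<^bsub>pi1 N\<^esub>
      (inv\<^bsub>pi1 N\<^esub> (delta_prod N 1 p) \<otimes>\<^bsub>pi1 N\<^esub> loop N 1 \<otimes>\<^bsub>pi1 N\<^esub> delta_prod N 1 p) \<otimes>\<^bsub>pi1 N\<^esub> delta p"
      using tau[of "Suc p"] p c IH(2)[of "Suc p"] IH(3) artin(3)[OF p] by (simp add: d)
    also have "\<dots> = inv\<^bsub>pi1 N\<^esub> (delta_prod N 1 (Suc p)) \<otimes>\<^bsub>pi1 N\<^esub> loop N 1 \<otimes>\<^bsub>pi1 N\<^esub> delta_prod N 1 (Suc p)"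
      using c by (simp add: V F.inv_mult_group F.m_assoc)
    finally show "artin.tau (Suc p) (loop N (Suc p)) =
      inv\<^bsub>pi1 N\<^esub> (delta_prod N 1 (Suc p)) \<otimes>\<^bsub>pi1 N\<^esub> loop N 1 \<otimes>\<^bsub>pi1 N\<^esub> delta_prod N 1 (Suc p)" .
  qed
qed

lemma tau_artin_loop_push_word:
  "artin.tau j (loop N j) = inv\<^bsub>pi1 N\<^esub> (push_word N j) \<otimes>\<^bsub>pi1 N\<^esub> inv\<^bsub>pi1 N\<^esub> (delta j)"
proof -
  let ?V = "delta_prod N 1 j" and ?W = "delta_prod N (Suc j) (N + 2)"
  have c: "?V \<in> carrier (pi1 N)" "?W \<in> carrier (pi1 N)" "delta j \<in> carrier (pi1 N)"
    using j by (auto intro!: delta_prod_closed delta_closed)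
  have "delta_prod N 1 (N + 2) = ?V \<otimes>\<^bsub>pi1 N\<^esub> (delta j \<otimes>\<^bsub>pi1 N\<^esub> ?W)"
    using j delta_prod_append[of 1 j "N + 2" N] delta_prod_append[of j "Suc j" "N + 2" N]
    by (simp add: delta_prod_single)
  then have "loop N 1 = inv\<^bsub>pi1 N\<^esub> (?V \<otimes>\<^bsub>pi1 N\<^esub> (delta j \<otimes>\<^bsub>pi1 N\<^esub> ?W))"
    by (simp add: loop_def)
  then show ?thesis
    using tau_artin_loop[of j] j c by (simp add: push_word_eq F.inv_mult_group F.m_assoc)
qed

text \<open>The equation is equivalent to \<open>\<alpha>\<^sub>j t s s = t\<close>, where \<open>s\<close> is Artin's automorphism for \<open>\<sigma>\<^sub>j\<close> and \<open>t\<close> that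
  for the path to position \<open>j\<close>. It suffices to compare both sides on the loops, and only the two loops
  that \<open>s\<close> exchanges require a computation. There \<open>w\<^sub>j\<close> becomes the inverse of \<open>S d\<close>, where \<open>S\<close> is the
  transported loop of the stirrer and \<open>d = \<delta>\<^sub>j\<close>.\<close>

lemma alpha_sharp_inverts_push:
  assumes w: "w \<in> carrier (pi1 N)"
  shows "alpha_sharp N j (artin.push j w) = w"
proof -
  let ?G = "AutoGroup (pi1 N)"
  let ?A = "alpha_sharp N j" and ?t = "artin.tau j" and ?s = "artin N j"
  let ?d = "delta j" and ?S = "?t (loop N j)"
  have a: "?t \<in> auto (pi1 N)" "?s \<in> auto (pi1 N)" "inv\<^bsub>?G\<^esub> ?t \<in> auto (pi1 N)"
    using j artin.tau_closed[of j] artin(1)[of j N] A.inv_closed[of ?t] by (auto simp: carrier_AutoGroup)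
  have m: "f \<otimes>\<^bsub>?G\<^esub> g \<in> auto (pi1 N)" if "f \<in> auto (pi1 N)" "g \<in> auto (pi1 N)" for f g
    using that A.m_closed[of f g] by (simp add: carrier_AutoGroup)
  interpret A: group_hom "pi1 N" "pi1 N" ?A by unfold_locales (rule alpha_sharp_hom)
  interpret t: group_hom "pi1 N" "pi1 N" ?t by (rule F.auto_hom[OF a(1)])
  interpret s: group_hom "pi1 N" "pi1 N" ?s by (rule F.auto_hom[OF a(2)])
  interpret ti: group_hom "pi1 N" "pi1 N" "inv\<^bsub>?G\<^esub> ?t" by (rule F.auto_hom[OF a(3)])
  have c: "?d \<in> carrier (pi1 N)" "?S \<in> carrier (pi1 N)" "push_word N j \<in> carrier (pi1 N)"
    "loop N j \<in> carrier (pi1 N)"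
    using j loop_closed[of j N] by (auto intro!: delta_closed push_word_closed)
  have d: "loop N (Suc j) = ?d" using j by (simp add: loop_def)
  have td: "?t ?d = ?d"
    using tau_artin_loop[of j] j by (auto simp flip: d)
  have W: "push_word N j = inv\<^bsub>pi1 N\<^esub> (?S \<otimes>\<^bsub>pi1 N\<^esub> ?d)"
    using c by (simp add: tau_artin_loop_push_word F.m_assoc F.inv_mult_group)
  have Ad: "?A ?d = ?S \<otimes>\<^bsub>pi1 N\<^esub> ?d \<otimes>\<^bsub>pi1 N\<^esub> inv\<^bsub>pi1 N\<^esub> ?S"
    using j c(1,2) by (simp add: alpha_sharp_delta push_image_def W F.m_assoc F.inv_mult_group F.inv_mult_cancel_left)
  have "?A ?S = ?A (inv\<^bsub>pi1 N\<^esub> (push_word N j) \<otimes>\<^bsub>pi1 N\<^esub> inv\<^bsub>pi1 N\<^esub> ?d)"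
    by (simp add: tau_artin_loop_push_word)
  also have "\<dots> = inv\<^bsub>pi1 N\<^esub> (push_word N j) \<otimes>\<^bsub>pi1 N\<^esub> inv\<^bsub>pi1 N\<^esub> (?A ?d)"
    using c by (simp add: alpha_sharp_push_word)
  also have "\<dots> = ?S \<otimes>\<^bsub>pi1 N\<^esub> ?d \<otimes>\<^bsub>pi1 N\<^esub> ?S \<otimes>\<^bsub>pi1 N\<^esub> inv\<^bsub>pi1 N\<^esub> ?d \<otimes>\<^bsub>pi1 N\<^esub> inv\<^bsub>pi1 N\<^esub> ?S"
    using c(1,2) by (simp add: Ad W F.m_assoc F.inv_mult_group)
  finally have AS: "?A ?S = \<dots>" .
  have sj: "?s (loop N j) = ?d" "?s ?d = inv\<^bsub>pi1 N\<^esub> ?d \<otimes>\<^bsub>pi1 N\<^esub> loop N j \<otimes>\<^bsub>pi1 N\<^esub> ?d"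
    using artin(2,3)[OF j] by (simp_all add: d)
  \<comment> \<open>The cases are the loop of the stirrer, the loop around obstacle \<open>j\<close>, the obstacles that \<open>t\<close> has
    passed, and the other ones.\<close>
  have key: "?A (?t (?s (?s v))) = ?t v" if v: "v \<in> carrier (pi1 N)" for v
  proof (rule loop_hom_eqI[where g = "\<lambda>v. ?A (?t (?s (?s v)))" and h = ?t, OF _ _ _ v])
    show "(\<lambda>v. ?A (?t (?s (?s v)))) \<in> hom (pi1 N) (pi1 N)" by (auto simp: hom_def)
    fix k assume k: "1 \<le> k" "k \<le> Suc N"
    consider "k = j" | "k = Suc j" | "k < j" | "Suc j < k" by linarith
    then show "?A (?t (?s (?s (loop N k)))) = ?t (loop N k)"
    proof cases
      case 1
      have "?A (?t (?s (?s (loop N j)))) = inv\<^bsub>pi1 N\<^esub> (?A ?d) \<otimes>\<^bsub>pi1 N\<^esub> ?A ?S \<otimes>\<^bsub>pi1 N\<^esub> ?A ?d"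
        using c by (simp add: sj td)
      also have "\<dots> = ?S"
        using c(1,2) unfolding Ad AS
        by (simp add: F.m_assoc F.inv_mult_group F.inv_mult_cancel_left)
      finally show ?thesis by (simp add: 1)
    next
      case 2
      have "?A (?t (?s (?s ?d))) = inv\<^bsub>pi1 N\<^esub> (?A ?d) \<otimes>\<^bsub>pi1 N\<^esub>
          (inv\<^bsub>pi1 N\<^esub> (?A ?S) \<otimes>\<^bsub>pi1 N\<^esub> (?A ?d \<otimes>\<^bsub>pi1 N\<^esub> (?A ?S \<otimes>\<^bsub>pi1 N\<^esub> ?A ?d)))"
        using c by (simp add: sj td F.m_assoc F.inv_mult_group F.inv_mult_cancel_left)
      also have "\<dots> = ?d"
        using c(1,2) unfolding Ad AS
        by (simp add: F.m_assoc F.inv_mult_group F.inv_mult_cancel_left)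
      finally show ?thesis by (simp add: 2 d td)
    next
      case 3
      then have "?s (loop N k) = loop N k" "?t (loop N k) = delta k"
        using j k tau_artin_loop[of j] artin(4)[of j N k] by (auto simp: loop_def)
      then show ?thesis using 3 k j by (simp add: alpha_sharp_delta push_image_def)
    next
      case 4
      then have "?s (loop N k) = loop N k" "?t (loop N k) = delta (k - 1)"
        using j k tau_artin_loop[of j] artin(4)[of j N k] by (auto simp: loop_def)
      then show ?thesis using 4 k j by (auto simp: alpha_sharp_delta push_image_def)
    qed
  qed (rule t.homh)
  let ?v = "(inv\<^bsub>?G\<^esub> ?t) w"
  have v: "?v \<in> carrier (pi1 N)" using w by simp
  have tv: "?t ?v = w"
    using w a(1) A.r_inv[of ?t] by (simp add: carrier_AutoGroup one_AutoGroup flip: F.AutoGroup_mult_apply[OF a(1,3)])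
  have "artin.push j w = ?t (?s (?s ?v))"
    unfolding artin.push_def using w v a by (simp add: F.AutoGroup_mult_apply m)
  then show ?thesis using key[OF v] tv by simp
qed

lemma alpha_sharp_eq_inv_push:
  "alpha_sharp N j = inv\<^bsub>AutoGroup (pi1 N)\<^esub> (artin.push j)" (is "_ = inv\<^bsub>?G\<^esub> ?p")
proof -
  have p: "?p \<in> carrier ?G" "inv\<^bsub>?G\<^esub> ?p \<in> carrier ?G"
    using artin.push_closed[of j] j by auto
  interpret i: group_hom "pi1 N" "pi1 N" "inv\<^bsub>?G\<^esub> ?p"
    using p(2) by (intro F.auto_hom) (simp add: carrier_AutoGroup)
  show ?thesis
  proof (rule extensionalityI)
    show "alpha_sharp N j \<in> extensional (carrier (pi1 N))"
      by (simp add: alpha_sharp_free_endo free_endo_extensional)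
    show "inv\<^bsub>?G\<^esub> ?p \<in> extensional (carrier (pi1 N))"
      using p(2) by (simp add: carrier_AutoGroup auto_def Bij_def)
    fix w assume w: "w \<in> carrier (pi1 N)"
    have "w = ?p ((inv\<^bsub>?G\<^esub> ?p) w)"
      using w p A.r_inv[OF p(1)] F.AutoGroup_mult_apply[of ?p "inv\<^bsub>?G\<^esub> ?p" w]
      by (simp add: carrier_AutoGroup one_AutoGroup)
    then show "alpha_sharp N j w = (inv\<^bsub>?G\<^esub> ?p) w"
      using alpha_sharp_inverts_push[of "(inv\<^bsub>?G\<^esub> ?p) w"] w by simp
  qed
qed

lemma alpha_sharp_auto: "alpha_sharp N j \<in> auto (pi1 N)"
  using artin.push_closed[of j] j by (simp add: alpha_sharp_eq_inv_push flip: carrier_AutoGroup)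

text \<open>The conjugating word \<open>w\<^sub>j\<close> does not contain \<open>\<delta>\<^sub>j\<close>, so it is fixed by \<open>\<alpha>\<^sub>j\<close>, and the conjugation is undone
  by the opposite one.\<close>

lemma inv_alpha_sharp:
  assumes w: "w \<in> carrier (pi1 N)"
  shows "(inv\<^bsub>AutoGroup (pi1 N)\<^esub> (alpha_sharp N j)) w = free_endo {1..Suc N} (inv_push_image N j) w"
proof -
  let ?A = "alpha_sharp N j" and ?B = "free_endo {1..Suc N} (inv_push_image N j)"
  let ?I = "inv\<^bsub>AutoGroup (pi1 N)\<^esub> ?A"
  have a: "?A \<in> auto (pi1 N)" "?I \<in> auto (pi1 N)"
    using alpha_sharp_auto A.inv_closed[of ?A] by (simp_all add: carrier_AutoGroup)
  interpret A: group_hom "pi1 N" "pi1 N" ?A by (rule F.auto_hom[OF a(1)])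
  interpret B: group_hom "pi1 N" "pi1 N" ?B
    by unfold_locales (rule free_endo_hom[OF push_image_closed(2)])
  have AB: "?A (?B w) = w"
  proof (rule hom_free_group_eqI[where g = "\<lambda>w. ?A (?B w)" and h = "\<lambda>w. w", OF F.is_group _ hom_id _ w])
    show "(\<lambda>w. ?A (?B w)) \<in> hom (pi1 N) (pi1 N)" by (auto simp: hom_def)
    fix i assume i: "i \<in> {1..Suc N}"
    have c: "push_word N j \<in> carrier (pi1 N)" "delta j \<in> carrier (pi1 N)"
      using j by (auto intro: push_word_closed delta_closed)
    have "?A (inv_push_image N j i) = delta i"
      using c i j by (auto simp: inv_push_image_def alpha_sharp_delta push_image_def
          alpha_sharp_push_word F.m_assoc F.inv_mult_cancel_left)
    then show "?A (?B [(i, True)]) = [(i, True)]"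
      using free_endo_letter[OF push_image_closed(2) i] by (simp add: delta_def)
  qed
  have "?I w = ?I (?A (?B w))" by (simp add: AB)
  also have "\<dots> = ?B w"
    using a w A.l_inv[of ?A] F.AutoGroup_mult_apply[OF a(2,1), of "?B w"]
    by (simp add: carrier_AutoGroup one_AutoGroup)
  finally show ?thesis .
qed

end

text \<open>By Artin's action the automorphism attached to a word is the inverse of a homomorphic image of the
  braid that the word spells, hence depends on that braid only.\<close>

lemma induced_aut_alpha_word:
  assumes u: "set u \<subseteq> {1..N} \<times> UNIV"
  shows "induced_aut N (eval_word (braid_group (Suc N)) (alpha N) u)
    = eval_word (AutoGroup (pi1 N)) (alpha_sharp N) (rev u)"
proof -
  let ?G = "AutoGroup (pi1 N)" and ?B = "braid_group (Suc N)"
  interpret F: group "pi1 N" by (rule group_free_group)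
  interpret A: group ?G by (rule F.AutoGroup)
  interpret B: braid_generators ?B "Suc N" "sigma (Suc N)" by (rule braid_generators_sigma)
  interpret artin: braid_generators ?G "Suc N" "artin N" by (rule braid_generators_artin)
  obtain h where h: "h \<in> hom ?B ?G" "\<And>i. 1 \<le> i \<Longrightarrow> i < Suc N \<Longrightarrow> h (sigma (Suc N) i) = artin N i"
    using braid_group_hom[OF braid_generators_artin] by blast
  interpret h: group_hom ?B ?G h by unfold_locales (rule h)
  have push: "h (alpha N j) = artin.push j" if "1 \<le> j" "j \<le> N" for j
  proof -
    let ?w = "map (\<lambda>k. (k, True)) [1..<j] @ [(j, True), (j, True)] @ map (\<lambda>k. (k, False)) (rev [1..<j])"
    have w: "set ?w \<subseteq> {1..<Suc N} \<times> UNIV" using that by auto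
    have "h (alpha N j) = eval_word ?G (\<lambda>i. h (sigma (Suc N) i)) ?w"
      unfolding alpha_def by (rule hom_eval_word[OF B.is_group A.is_group h(1) B.s_funcset w])
    also have "\<dots> = eval_word ?G (artin N) ?w"
      using h(2) by (intro eval_word_cong[OF _ w]) simp
    also have "\<dots> = artin.push j"
      using that artin.eval_word_push[of j] by simp
    finally show ?thesis .
  qed
  have alpha: "alpha N \<in> {1..N} \<rightarrow> carrier ?B" using alpha_closed by auto
  have sharp: "alpha_sharp N \<in> {1..N} \<rightarrow> carrier ?G"
    using alpha_sharp_auto by (auto simp: carrier_AutoGroup)
  have eq: "eval_word ?G (alpha_sharp N) (rev v) = inv\<^bsub>?G\<^esub> (h (eval_word ?B (alpha N) v))"
    if v: "set v \<subseteq> {1..N} \<times> UNIV" for v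
  proof -
    have "h (eval_word ?B (alpha N) v) = eval_word ?G (\<lambda>j. h (alpha N j)) v"
      by (rule hom_eval_word[OF B.is_group A.is_group h(1) alpha v])
    also have "\<dots> = eval_word ?G (\<lambda>j. inv\<^bsub>?G\<^esub> (alpha_sharp N j)) v"
      using artin.push_closed by (intro eval_word_cong[OF _ v]) (simp add: push alpha_sharp_eq_inv_push)
    finally show ?thesis using A.eval_word_rev[OF sharp v] by simp
  qed
  show ?thesis
    unfolding induced_aut_def
  proof (rule the_equality)
    show "\<exists>v. set v \<subseteq> {1..N} \<times> UNIV \<and> eval_word ?B (alpha N) v = eval_word ?B (alpha N) u \<and>
      eval_word ?G (alpha_sharp N) (rev v) = eval_word ?G (alpha_sharp N) (rev u)"
      using u by blast
  qed (use u eq in metis)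
qed

section \<open>Protocols spelled by braid words\<close>

definition push_sigma_word :: "nat \<Rightarrow> nat gword" where
  "push_sigma_word i =
    map (\<lambda>k. (k, True)) [1..<i] @ [(i, True), (i, True)] @ map (\<lambda>k. (k, False)) (rev [1..<i])"

lemma fill_stirrer_up:
  "p \<le> q \<Longrightarrow> fill_stirrer p (map (\<lambda>k. (k, b)) [p..<q] @ v) = fill_stirrer q v"
  by (induction p rule: inc_induct) (auto simp: upt_conv_Cons)

lemma fill_stirrer_down:
  "p \<le> q \<Longrightarrow> fill_stirrer q (map (\<lambda>k. (k, b)) (rev [p..<q]) @ v) = fill_stirrer p v"
  by (induction q rule: dec_induct) auto

lemma fill_stirrer_push_sigma_word:
  "1 \<le> i \<Longrightarrow> fill_stirrer 1 (push_sigma_word i @ v) = fill_stirrer 1 v"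
  unfolding push_sigma_word_def append_assoc
  by (subst fill_stirrer_up) (simp_all add: fill_stirrer_down)

lemma braid_perm_append: "braid_perm (u @ v) = braid_perm u \<circ> braid_perm v"
  by (induction u) (auto simp: o_assoc)

lemma braid_perm_rev: "braid_perm (map (\<lambda>k. (k, b)) xs) \<circ> braid_perm (map (\<lambda>k. (k, c)) (rev xs)) = id"
proof (induction xs)
  case (Cons x xs)
  have "braid_perm (map (\<lambda>k. (k, b)) (x # xs)) \<circ> braid_perm (map (\<lambda>k. (k, c)) (rev (x # xs)))
    = Transposition.transpose x (Suc x) \<circ> (braid_perm (map (\<lambda>k. (k, b)) xs)
      \<circ> braid_perm (map (\<lambda>k. (k, c)) (rev xs))) \<circ> Transposition.transpose x (Suc x)"
    by (simp add: braid_perm_append o_assoc)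
  also have "\<dots> = id" unfolding Cons by (simp add: fun_eq_iff)
  finally show ?case .
qed simp

lemma braid_perm_push_sigma_word: "braid_perm (push_sigma_word i) = id"
proof -
  have "braid_perm (push_sigma_word i) = braid_perm (map (\<lambda>k. (k, True)) [1..<i])
     \<circ> (Transposition.transpose i (Suc i) \<circ> Transposition.transpose i (Suc i))
     \<circ> braid_perm (map (\<lambda>k. (k, False)) (rev [1..<i]))"
    by (simp add: push_sigma_word_def braid_perm_append o_assoc)
  then show ?thesis by (simp add: braid_perm_rev)
qed

lemma cancelling_iff: "cancelling a b \<longleftrightarrow> (\<exists>i p. a = (i, p) \<and> b = (i, \<not> p))"
  by (cases a; cases b) (auto simp: cancelling_def)

lemma braid_perm_reduce: "braid_perm (reduce w) = braid_perm w"
proof (induction w)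
  case (Cons a w)
  have "braid_perm (cons_reduce a v) = braid_perm (a # v)" for v
    by (cases v; cases a) (auto simp: cancelling_iff o_assoc)
  then have "braid_perm (reduce (a # w)) = braid_perm (a # reduce w)"
    by (simp add: reduce_def)
  then show ?case using Cons by (cases a) simp
qed (simp add: reduce_def)

text \<open>A braid is a set of reduced words, but the words that spell protocols arise by concatenation. Here a
  cancelling pair of crossings either disappears together with the stirrer or survives as a
  cancelling pair.\<close>

lemma eval_word_fill_stirrer_reduce:
  assumes "group G" and f: "f \<in> {1..<n} \<rightarrow> carrier G"
    and "set w \<subseteq> {1..<Suc n} \<times> UNIV" "1 \<le> p" "p \<le> Suc n"
  shows "eval_word G f (fill_stirrer p (reduce w)) = eval_word G f (fill_stirrer p w)"
  using assms(3-5)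
proof (induction w arbitrary: p)
  case (Cons a w)
  interpret group G by fact
  obtain i b where a: "a = (i, b)" by fastforce
  have i: "1 \<le> i" "i < Suc n" and w: "set w \<subseteq> {1..<Suc n} \<times> UNIV" using Cons.prems a by auto
  have step: "eval_word G f (fill_stirrer p (cons_reduce a v)) = eval_word G f (fill_stirrer p (a # v))"
    if v: "set v \<subseteq> {1..<Suc n} \<times> UNIV" for v
  proof (cases v)
    case (Cons c v')
    show ?thesis
    proof (cases "cancelling a c")
      case True
      then have c: "c = (i, \<not> b)" using a by (auto simp: cancelling_iff)
      have "set v' \<subseteq> {1..<Suc n} \<times> UNIV" using v Cons by auto
      note e = eval_word_closed[OF f set_fill_stirrer[OF this Cons.prems(2,3)]]
      consider "i = p" | "Suc i = p" | "Suc i < p" | "p < i" by linarith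
      then show ?thesis
      proof cases
        case 3
        then have "f i \<in> carrier G" using i Cons.prems(3) by (intro funcset_mem[OF f]) auto
        with 3 e show ?thesis using Cons True a c by (simp add: inv_mult_cancel_left)
      next
        case 4
        then have "f (i - 1) \<in> carrier G" using i Cons.prems(2) by (intro funcset_mem[OF f]) auto
        with 4 e show ?thesis using Cons True a c by (simp add: inv_mult_cancel_left)
      qed (use Cons True a c in auto)
    qed (simp add: Cons)
  qed simp
  have r: "set (reduce w) \<subseteq> {1..<Suc n} \<times> UNIV" using w set_reduce[of w] by auto
  have "eval_word G f (fill_stirrer p (reduce (a # w))) = eval_word G f (fill_stirrer p (a # reduce w))"
    using step[OF r] by (simp add: reduce_def)
  also have "\<dots> = eval_word G f (fill_stirrer p (a # w))"
    using a i Cons.prems(2,3) Cons.IH[OF w] by auto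
  finally show ?case .
qed (simp add: reduce_def)

lemma positive_alpha_word_point_push:
  assumes "set is \<subseteq> {1..N}"
  shows "eval_word (braid_group (Suc N)) (alpha N) (map (\<lambda>i. (i, True)) is) \<in> point_push N"
proof -
  let ?B = "braid_group (Suc N)" and ?w = "concat (map push_sigma_word is)"
  interpret B: braid_generators ?B "Suc N" "sigma (Suc N)" by (rule braid_generators_sigma)
  have s: "set (push_sigma_word i) \<subseteq> {1..<Suc N} \<times> UNIV" if "i \<in> set is" for i
    using that assms by (auto simp: push_sigma_word_def)
  have set: "set ?w \<subseteq> {1..<Suc N} \<times> UNIV" using s by fastforce
  have "eval_word ?B (alpha N) (map (\<lambda>i. (i, True)) is) = eval_word ?B (sigma (Suc N)) ?w"
    using s
  proof (induction "is")
    case (Cons i "is")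
    then have "set (push_sigma_word i) \<subseteq> {1..<Suc N} \<times> UNIV"
      "set (concat (map push_sigma_word is)) \<subseteq> {1..<Suc N} \<times> UNIV" by fastforce+
    moreover have "alpha N i = eval_word ?B (sigma (Suc N)) (push_sigma_word i)"
      by (simp add: alpha_def push_sigma_word_def)
    ultimately show ?case
      using Cons by (simp add: B.eval_word_append[OF B.s_funcset])
  qed simp
  also have "\<dots> = eval_word ?B (sigma (Suc N)) (reduce ?w)"
    by (rule B.eval_word_reduce[OF B.s_funcset set, symmetric])
  finally have eq: "eval_word ?B (alpha N) (map (\<lambda>i. (i, True)) is) = \<dots>" .
  have r: "reduce ?w \<in> carrier (free_group {1..<Suc N})"
    using set set_reduce[of ?w] by (auto simp: free_group_def reduced_word_reduce)
  have "braid_perm ?w = id"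
    by (induction "is") (auto simp: braid_perm_append braid_perm_push_sigma_word)
  moreover have "fill_stirrer 1 ?w = []"
    using assms by (induction "is") (auto simp: fill_stirrer_push_sigma_word)
  moreover have "eval_word (braid_group N) (sigma N) (fill_stirrer 1 (reduce ?w))
      = eval_word (braid_group N) (sigma N) (fill_stirrer 1 ?w)"
    using set sigma_closed by (intro eval_word_fill_stirrer_reduce[OF group_braid_group, where n = N]) auto
  ultimately show ?thesis
    unfolding point_push_def eq using braid_coset_memI[OF r]
    by (auto simp: braid_perm_reduce intro!: bexI[where x = "reduce ?w"])
qed

section \<open>Spectral radii of the cyclic products\<close>

(* The dollar sign denotes the entries of vectors of variable dimension. *)
no_notation vec_nth (infixl \<open>$\<close> 90)

text \<open>For \<open>s = -1\<close> this is row \<open>k\<close> of \<open>T\<^sup>(\<^sup>k\<^sup>)\<close>, for \<open>s = 1\<close> that of \<open>S\<^sup>(\<^sup>k\<^sup>)\<close>; so one computation serves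
  both families of matrices.\<close>

definition row_coeff :: "int \<Rightarrow> nat \<Rightarrow> nat \<Rightarrow> int" where
  "row_coeff s k j = (if j = k then 0 else if j < k then 2 * s ^ (k - j + 1) else 2 * s ^ (j - k))"

lemma row_coeff_1: "row_coeff 1 k j = (if j = k then 0 else 2)"
  by (simp add: row_coeff_def)

definition row_mat :: "int \<Rightarrow> nat \<Rightarrow> nat \<Rightarrow> int mat" where
  "row_mat s N k = 1\<^sub>m N + mat N N (\<lambda>(i, j). if Suc i = k then row_coeff s k (Suc j) else 0)"

definition cycle_mat :: "int \<Rightarrow> nat \<Rightarrow> int mat" where
  "cycle_mat s N = foldr (\<lambda>k M. row_mat s N k * M) [1..<Suc N] (1\<^sub>m N)"

lemma H_mat_eq_cycle_mat: "H_mat N = cycle_mat (- 1) N"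
proof -
  have "E_mat N k = row_mat (- 1) N k" for k
    by (auto simp: E_mat_def T_mat_def row_mat_def row_coeff_def Let_def intro!: eq_matI)
  then show ?thesis by (simp add: H_mat_def cycle_mat_def)
qed

lemma H_hat_mat_eq_cycle_mat: "H_hat_mat N = cycle_mat 1 N"
proof -
  have "A_mat N k = row_mat 1 N k" for k
    by (auto simp: A_mat_def S_mat_def row_mat_def row_coeff_def Let_def intro!: eq_matI)
  then show ?thesis by (simp add: H_hat_mat_def cycle_mat_def)
qed

definition row_update :: "int \<Rightarrow> nat \<Rightarrow> nat \<Rightarrow> (nat \<Rightarrow> complex) \<Rightarrow> nat \<Rightarrow> complex" where
  "row_update s N k v = v(k := v k + (\<Sum>j=1..N. of_int (row_coeff s k j) * v j))"

text \<open>The linear map of the product \<open>E\<^sup>(\<^sup>1\<^sup>) \<dots> E\<^sup>(\<^sup>N\<^sup>)\<close> or \<open>A\<^sup>(\<^sup>1\<^sup>) \<dots> A\<^sup>(\<^sup>N\<^sup>)\<close>: row \<open>N\<close> is updated first, row 1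
  last. Vectors are functions whose entries \<open>1, \<dots>, N\<close> matter.\<close>

definition cycle :: "int \<Rightarrow> nat \<Rightarrow> (nat \<Rightarrow> complex) \<Rightarrow> nat \<Rightarrow> complex" where
  "cycle s N v = foldr (row_update s N) [1..<Suc N] v"

definition vec1 :: "nat \<Rightarrow> (nat \<Rightarrow> complex) \<Rightarrow> complex vec" where
  "vec1 N v = vec N (\<lambda>i. v (Suc i))"

lemma row_mat_carrier: "row_mat s N k \<in> carrier_mat N N"
  by (simp add: row_mat_def)

lemma row_mat_mult_vec:
  assumes "1 \<le> k" "k \<le> N"
  shows "map_mat complex_of_int (row_mat s N k) *\<^sub>v vec1 N v = vec1 N (row_update s N k v)"
proof (rule eq_vecI)
  fix i assume "i < dim_vec (vec1 N (row_update s N k v))"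
  then have i: "i < N" by (simp add: vec1_def)
  have "(map_mat complex_of_int (row_mat s N k) *\<^sub>v vec1 N v) $ i
    = (\<Sum>j<N. ((if i = j then 1 else 0) + of_int (if Suc i = k then row_coeff s k (Suc j) else 0)) * v (Suc j))"
    using i by (simp add: row_mat_def vec1_def scalar_prod_def lessThan_atLeast0) (auto intro!: sum.cong)
  also have "\<dots> = (\<Sum>j<N. (if i = j then 1 else 0) * v (Suc j))
      + (\<Sum>j<N. of_int (if Suc i = k then row_coeff s k (Suc j) else 0) * v (Suc j))"
    by (simp only: distrib_right sum.distrib)
  also have "(\<Sum>j<N. (if i = j then 1 else 0) * v (Suc j)) = (\<Sum>j<N. if i = j then v (Suc j) else 0)"
    by (intro sum.cong) auto
  also have "\<dots> = v (Suc i)" using i by simp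
  also have "(\<Sum>j<N. of_int (if Suc i = k then row_coeff s k (Suc j) else 0) * v (Suc j))
      = (if Suc i = k then \<Sum>j<N. of_int (row_coeff s k (Suc j)) * v (Suc j) else 0)"
    by simp
  also have "(\<Sum>j<N. of_int (row_coeff s k (Suc j)) * v (Suc j)) = (\<Sum>j=1..N. of_int (row_coeff s k j) * v j)"
    by (rule sum.reindex_bij_witness[of _ "\<lambda>j. j - 1" Suc]) auto
  finally show "(map_mat complex_of_int (row_mat s N k) *\<^sub>v vec1 N v) $ i = vec1 N (row_update s N k v) $ i"
    using i by (auto simp: vec1_def row_update_def)
qed (simp add: row_mat_def vec1_def)

lemma cycle_mat_carrier: "cycle_mat s N \<in> carrier_mat N N"
proof -
  have "foldr (\<lambda>k M. row_mat s N k * M) ks (1\<^sub>m N) \<in> carrier_mat N N" for ks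
    by (induction ks) (auto simp: row_mat_carrier intro!: mult_carrier_mat[of _ N N])
  then show ?thesis by (simp add: cycle_mat_def)
qed

lemma cycle_mat_mult_vec:
  "map_mat complex_of_int (cycle_mat s N) *\<^sub>v vec1 N v = vec1 N (cycle s N v)"
proof -
  have c: "foldr (\<lambda>k M. row_mat s N k * M) ks (1\<^sub>m N) \<in> carrier_mat N N" for ks
    by (induction ks) (auto simp: row_mat_carrier intro!: mult_carrier_mat[of _ N N])
  have "map_mat complex_of_int (foldr (\<lambda>k M. row_mat s N k * M) ks (1\<^sub>m N)) *\<^sub>v vec1 N v
      = vec1 N (foldr (row_update s N) ks v)" if "set ks \<subseteq> {1..N}" for ks
    using that
  proof (induction ks)
    case Nil
    show ?case by (simp add: of_int_hom.mat_hom_one vec1_def)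
  next
    case (Cons k ks)
    let ?M = "foldr (\<lambda>k M. row_mat s N k * M) ks (1\<^sub>m N)"
    have "map_mat complex_of_int (row_mat s N k * ?M) *\<^sub>v vec1 N v
        = map_mat complex_of_int (row_mat s N k) *\<^sub>v (map_mat complex_of_int ?M *\<^sub>v vec1 N v)"
      using c[of ks] row_mat_carrier[of s N k]
      by (subst of_int_hom.mat_hom_mult[of _ N N _ N])
        (auto intro!: assoc_mult_mat_vec[of _ N N _ N] simp: vec1_def)
    then show ?case using Cons by (simp add: row_mat_mult_vec)
  qed
  moreover have "set [1..<Suc N] \<subseteq> {1..N}" by auto
  ultimately show ?thesis unfolding cycle_mat_def cycle_def by blast
qed

lemma rho_cycle_mat_attained:
  assumes "N \<ge> 1"
  obtains \<kappa> v i where "cmod \<kappa> = rho (cycle_mat s N)" "1 \<le> i" "i \<le> N" "v i \<noteq> 0"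
    "\<And>j. 1 \<le> j \<Longrightarrow> j \<le> N \<Longrightarrow> cycle s N v j = \<kappa> * v j"
proof -
  let ?M = "map_mat complex_of_int (cycle_mat s N)"
  have M: "?M \<in> carrier_mat N N" using cycle_mat_carrier by simp
  have "rho (cycle_mat s N) \<in> norm ` spectrum ?M"
    unfolding rho_def using spectral_radius_mem_max(1)[OF M] assms by simp
  then obtain \<kappa> where \<kappa>: "cmod \<kappa> = rho (cycle_mat s N)" "eigenvalue ?M \<kappa>"
    by (auto simp: spectrum_def)
  then obtain w where w: "w \<in> carrier_vec N" "w \<noteq> 0\<^sub>v N" "?M *\<^sub>v w = \<kappa> \<cdot>\<^sub>v w"
    using M by (auto simp: eigenvalue_def eigenvector_def)
  define v where "v j = w $ (j - 1)" for j
  have wv: "w = vec1 N v"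
    using w(1) by (auto simp: vec1_def v_def intro!: eq_vecI)
  obtain i where i: "i < N" "w $ i \<noteq> 0"
    using w(1,2) by (metis carrier_vecD eq_vecI index_zero_vec)
  have "cycle s N v j = \<kappa> * v j" if "1 \<le> j" "j \<le> N" for j
  proof -
    have "vec1 N (cycle s N v) = \<kappa> \<cdot>\<^sub>v vec1 N v"
      using w(3) unfolding wv cycle_mat_mult_vec .
    then have "vec1 N (cycle s N v) $ (j - 1) = (\<kappa> \<cdot>\<^sub>v vec1 N v) $ (j - 1)" by simp
    moreover have "j - 1 < N" "Suc (j - 1) = j" using that by auto
    ultimately show ?thesis by (simp add: vec1_def)
  qed
  then show thesis
    using that[of \<kappa> "Suc i" v] \<kappa>(1) i by (simp add: v_def)
qed

lemma rho_cycle_mat_ge: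
  assumes "1 \<le> i" "i \<le> N" "v i \<noteq> 0"
    and "\<And>j. 1 \<le> j \<Longrightarrow> j \<le> N \<Longrightarrow> cycle s N v j = \<kappa> * v j"
  shows "cmod \<kappa> \<le> rho (cycle_mat s N)"
proof -
  let ?M = "map_mat complex_of_int (cycle_mat s N)"
  have M: "?M \<in> carrier_mat N N" using cycle_mat_carrier by simp
  have "vec1 N v \<noteq> 0\<^sub>v N"
  proof
    assume "vec1 N v = 0\<^sub>v N"
    then have "vec1 N v $ (i - 1) = 0\<^sub>v N $ (i - 1)" by simp
    moreover have "i - 1 < N" "Suc (i - 1) = i" using assms by auto
    ultimately show False using assms(3) by (simp add: vec1_def)
  qed
  moreover have "?M *\<^sub>v vec1 N v = \<kappa> \<cdot>\<^sub>v vec1 N v"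
    unfolding cycle_mat_mult_vec using assms(4) by (auto simp: vec1_def intro!: eq_vecI)
  ultimately have "eigenvalue ?M \<kappa>"
    using M unfolding eigenvalue_def eigenvector_def by (intro exI[of _ "vec1 N v"]) (auto simp: vec1_def)
  then show ?thesis
    unfolding rho_def using assms by (intro spectral_radius_mem_max(2)[OF M]) (auto simp: spectrum_def)
qed

text \<open>Read in the order in which they are updated, the entries of a geometric vector form a geometric
  sequence, and the equation for \<open>\<theta>\<close> says that each update continues it by one term. For \<open>s = -1\<close> the
  sign of an entry alternates with its position, and flips with every pass.\<close>

lemma cycle_geometric:
  fixes \<theta> :: real and s :: int
  assumes s: "s = 1 \<or> s = - 1" and N: "1 \<le> N"
    and root: "\<theta> ^ N = 2 * (\<Sum>i=1..<N. \<theta> ^ i) + s"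
  defines "v \<equiv> \<lambda>k. complex_of_real (s ^ k * \<theta> ^ (N - k))"
  assumes j: "1 \<le> j" "j \<le> N"
  shows "cycle s N v j = complex_of_real (s * \<theta> ^ N) * v j"
proof -
  \<comment> \<open>The vector after rows \<open>N, \<dots>, k\<close> have been updated.\<close>
  define r where "r k j = s ^ j * \<theta> ^ (N - j) * (if k \<le> j then s * \<theta> ^ N else 1)" for k j :: nat
  have s2: "s * s = 1" "(real_of_int s) * s = 1" using s by auto
  have ss: "(real_of_int s) ^ (a + a) = 1" for a
    using s2 by (simp add: power_add flip: power_mult_distrib)
  have upd: "row_update s N k (\<lambda>j. complex_of_real (r (Suc k) j)) i = complex_of_real (r k i)"
    if k: "1 \<le> k" "k \<le> N" and i: "1 \<le> i" "i \<le> N" for i k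
  proof (cases "i = k")
    case False
    then show ?thesis by (auto simp: row_update_def r_def)
  next
    case True
    define c where "c = s ^ k * \<theta> ^ (N - k)"
    have low: "(\<Sum>j=1..<k. row_coeff s k j * r (Suc k) j) = 2 * c * s * (\<Sum>i=1..<k. \<theta> ^ i)"
    proof -
      have "(\<Sum>j=1..<k. row_coeff s k j * r (Suc k) j) = (\<Sum>j=1..<k. 2 * c * s * \<theta> ^ (k - j))"
      proof (intro sum.cong refl)
        fix j assume j: "j \<in> {1..<k}"
        define d where "d = k - j"
        have "row_coeff s k j = 2 * s ^ (d + 1)" "N - j = (N - k) + d" "s ^ k = s ^ d * s ^ j"
          using j k by (auto simp: row_coeff_def d_def simp flip: power_add)
        then show "row_coeff s k j * r (Suc k) j = 2 * c * s * \<theta> ^ (k - j)"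
          using j by (simp add: r_def power_add c_def flip: d_def)
      qed
      also have "\<dots> = 2 * c * s * (\<Sum>j=1..<k. \<theta> ^ (k - j))" by (simp add: sum_distrib_left)
      also have "(\<Sum>j=1..<k. \<theta> ^ (k - j)) = (\<Sum>i=1..<k. \<theta> ^ i)"
        by (rule sum.reindex_bij_witness[of _ "\<lambda>i. k - i" "\<lambda>i. k - i"]) auto
      finally show ?thesis .
    qed
    have high: "(\<Sum>j=Suc k..N. row_coeff s k j * r (Suc k) j) = 2 * c * s * (\<Sum>i=k..<N. \<theta> ^ i)"
    proof -
      have "(\<Sum>j=Suc k..N. row_coeff s k j * r (Suc k) j) = (\<Sum>j=Suc k..N. 2 * c * s * \<theta> ^ (N + k - j))"
      proof (intro sum.cong refl)
        fix j assume j: "j \<in> {Suc k..N}"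
        then have e: "\<theta> ^ (N - j) * \<theta> ^ N = \<theta> ^ (N - k) * \<theta> ^ (N + k - j)"
          by (simp flip: power_add)
        have "real_of_int s ^ (j - k) * real_of_int s ^ j = real_of_int s ^ (j - k + (j - k)) * real_of_int s ^ k"
          using j by (simp flip: power_add)
        then have e': "real_of_int s ^ (j - k) * real_of_int s ^ j = real_of_int s ^ k" by (simp add: ss)
        have "row_coeff s k j * r (Suc k) j 
            = 2 * real_of_int s * (real_of_int s ^ (j - k) * real_of_int s ^ j) * (\<theta> ^ (N - j) * \<theta> ^ N)"
          using j by (simp add: row_coeff_def r_def)
        also have "\<dots> = 2 * real_of_int s * real_of_int s ^ k * (\<theta> ^ (N - k) * \<theta> ^ (N + k - j))"
          by (simp only: e e')
        finally show "row_coeff s k j * r (Suc k) j = 2 * c * s * \<theta> ^ (N + k - j)"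
          by (simp add: c_def)
      qed
      also have "\<dots> = 2 * c * s * (\<Sum>j=Suc k..N. \<theta> ^ (N + k - j))" by (simp add: sum_distrib_left)
      also have "(\<Sum>j=Suc k..N. \<theta> ^ (N + k - j)) = (\<Sum>i=k..<N. \<theta> ^ i)"
        by (rule sum.reindex_bij_witness[of _ "\<lambda>i. N + k - i" "\<lambda>i. N + k - i"]) auto
      finally show ?thesis .
    qed
    have "{1..N} = insert k ({1..<k} \<union> {Suc k..N})" and "{1..<k} \<inter> {Suc k..N} = {}"
      using k by auto
    then have "(\<Sum>j=1..N. row_coeff s k j * r (Suc k) j)
        = (\<Sum>j=1..<k. row_coeff s k j * r (Suc k) j) + (\<Sum>j=Suc k..N. row_coeff s k j * r (Suc k) j)"
      by (simp add: sum.union_disjoint) (simp add: row_coeff_def[of s k k])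
    also have "\<dots> = 2 * c * s * (\<Sum>i=1..<N. \<theta> ^ i)"
      unfolding low high using k by (simp add: sum.atLeastLessThan_concat flip: distrib_left)
    also have "\<dots> = c * s * (\<theta> ^ N - s)" using root by simp
    finally have "(\<Sum>j=1..N. row_coeff s k j * r (Suc k) j) = c * s * (\<theta> ^ N - s)" .
    moreover have "c * s * (\<theta> ^ N - s) = c * s * \<theta> ^ N - c * (real_of_int s * s)"
      by (simp add: algebra_simps)
    moreover have "r (Suc k) k = c" "r k k = c * s * \<theta> ^ N"
      by (simp_all add: r_def c_def)
    ultimately have "r (Suc k) k + (\<Sum>j=1..N. row_coeff s k j * r (Suc k) j) = r k k"
      using s2 by simp
    then have "complex_of_real (r (Suc k) k + (\<Sum>j=1..N. row_coeff s k j * r (Suc k) j)) = complex_of_real (r k k)"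
      by simp
    then show ?thesis using True by (simp add: row_update_def)
  qed
  have cong: "row_update s N k u i = row_update s N k w i"
    if "\<And>j. 1 \<le> j \<Longrightarrow> j \<le> N \<Longrightarrow> u j = w j" "1 \<le> k" "k \<le> N" "1 \<le> i" "i \<le> N" for k u w i
    using that by (auto simp: row_update_def intro!: sum.cong)
  have "\<forall>j. 1 \<le> j \<longrightarrow> j \<le> N \<longrightarrow> foldr (row_update s N) [k..<Suc N] v j = complex_of_real (r k j)"
    if "k \<le> Suc N" "1 \<le> k" for k
    using that
  proof (induction k rule: inc_induct)
    case base
    show ?case by (auto simp: v_def r_def)
  next
    case (step k)
    have "foldr (row_update s N) [k..<Suc N] v = row_update s N k (foldr (row_update s N) [Suc k..<Suc N] v)"
      using step by (simp add: upt_conv_Cons del: upt_Suc)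
    then show ?case
      using step upd[of k] cong[of "foldr (row_update s N) [Suc k..<Suc N] v" "\<lambda>j. complex_of_real (r (Suc k) j)" k]
      by simp
  qed
  from this[of 1] show ?thesis
    using j by (simp add: cycle_def r_def v_def del: upt_Suc)
qed

lemma rho_cycle_mat_ge_root:
  fixes \<theta> :: real
  assumes s: "s = 1 \<or> s = - 1" and N: "1 \<le> N" and "\<theta> \<ge> 0"
    and root: "\<theta> ^ N = 2 * (\<Sum>i=1..<N. \<theta> ^ i) + s"
  shows "\<theta> ^ N \<le> rho (cycle_mat s N)"
proof -
  have "cmod (complex_of_real (s * \<theta> ^ N)) \<le> rho (cycle_mat s N)"
    by (rule rho_cycle_mat_ge[OF N order_refl _ cycle_geometric[OF s N root]]) (use s in auto)
  moreover have "\<bar>real_of_int s * \<theta> ^ N\<bar> = \<theta> ^ N"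
    using s \<open>\<theta> \<ge> 0\<close> by auto
  ultimately show ?thesis by (simp only: norm_of_real)
qed

lemma times_geometric_sum:
  fixes x :: real
  assumes "1 \<le> N"
  shows "(x - 1) * (\<Sum>i=1..<N. x ^ i) = x ^ N - x"
  using assms by (induction N rule: dec_induct) (simp_all add: algebra_simps)

text \<open>At 3 the left side exceeds the right side by \<open>3 - s\<close>, so the intermediate value theorem applies.\<close>

lemma cycle_root_exists:
  fixes \<mu> :: real and s :: int
  assumes s: "s = 1 \<or> s = - 1" and N: "1 \<le> N" and \<mu>: "1 \<le> \<mu>" "\<mu> \<le> 3"
    and le: "\<mu> ^ N \<le> 2 * (\<Sum>i=1..<N. \<mu> ^ i) + s"
  obtains \<theta> where "\<mu> \<le> \<theta>" "\<theta> \<le> 3" "\<theta> ^ N = 2 * (\<Sum>i=1..<N. \<theta> ^ i) + s"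
proof -
  let ?f = "\<lambda>x::real. x ^ N - 2 * (\<Sum>i=1..<N. x ^ i) - s"
  have "2 * (\<Sum>i=1..<N. (3::real) ^ i) = 3 ^ N - 3"
    using times_geometric_sum[OF N, of 3] by simp
  then have "?f 3 \<ge> 0" using s by auto
  moreover have "?f \<mu> \<le> 0" using le by simp
  moreover have "continuous_on {\<mu>..3} ?f" by (intro continuous_intros)
  ultimately obtain \<theta> where "\<mu> \<le> \<theta>" "\<theta> \<le> 3" "?f \<theta> = 0"
    using IVT'[of ?f \<mu> 0 3] \<mu> by auto
  then show thesis by (intro that[of \<theta>]) auto
qed

lemma H_hat_root:
  assumes N: "1 \<le> N"
  obtains \<theta> :: real where "1 \<le> \<theta>" "\<theta> ^ N = 2 * (\<Sum>i=1..<N. \<theta> ^ i) + 1"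
    "\<theta> ^ N \<le> rho (H_hat_mat N)"
proof -
  obtain \<theta> :: real where l: "1 \<le> \<theta>" "\<theta> ^ N = 2 * (\<Sum>i=1..<N. \<theta> ^ i) + of_int 1"
    using cycle_root_exists[of 1 N 1] N by auto
  show thesis
    by (rule that[of \<theta>]) (use l rho_cycle_mat_ge_root[of 1 N \<theta>] N in \<open>auto simp: H_hat_mat_eq_cycle_mat\<close>)
qed

text \<open>The sequence on the right increases, by Bernoulli's inequality, and starts at \<open>1 / 4\<close>.\<close>

lemma quarter_le_power:
  assumes "N \<ge> 2"
  shows "1 / 4 \<le> (1 - 1 / real N) ^ N"
  using assms
proof (induction N rule: dec_induct)
  case base
  show ?case by (simp add: power2_eq_square)
next
  case (step N)
  define x where "x = real N"
  have x: "x \<ge> 2" using step by (simp add: x_def)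
  have "1 + x * (1 / (x\<^sup>2 - 1)) \<le> (1 + 1 / (x\<^sup>2 - 1)) ^ N"
  proof -
    have "x\<^sup>2 > 1" using x by (simp add: one_less_power)
    then have "0 \<le> 1 / (x\<^sup>2 - 1)" by simp
    then have "- 1 \<le> 1 / (x\<^sup>2 - 1)" by linarith
    from Bernoulli_inequality[OF this, of N] show ?thesis by (simp add: x_def)
  qed
  moreover have "1 / x \<le> x / (x\<^sup>2 - 1)"
  proof -
    have "x\<^sup>2 > 1" using x by (simp add: one_less_power)
    then have "x / x\<^sup>2 \<le> x / (x\<^sup>2 - 1)" using x by (intro divide_left_mono) auto
    then show ?thesis using x by (simp add: power2_eq_square)
  qed
  ultimately have "1 + 1 / x \<le> (1 + 1 / (x\<^sup>2 - 1)) ^ N" by simp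
  then have "1 \<le> (1 - 1 / (x + 1)) * (1 + 1 / (x\<^sup>2 - 1)) ^ N"
    using x by (simp add: field_simps)
  moreover have "(1 - 1 / x) * (1 + 1 / (x\<^sup>2 - 1)) = 1 - 1 / (x + 1)"
  proof -
    have "2 * 2 \<le> x * x" using x by (intro mult_mono) auto
    then have "x * x \<noteq> 1" by auto
    then show ?thesis using x by (simp add: field_simps power2_eq_square)
  qed
  ultimately have "(1 - 1 / x) ^ N \<le> (1 - 1 / (x + 1)) ^ Suc N"
    using x mult_left_mono[of 1 "(1 - 1 / (x + 1)) * (1 + 1 / (x\<^sup>2 - 1)) ^ N" "(1 - 1 / x) ^ N"]
    by (simp add: mult.left_commute flip: power_mult_distrib)
  moreover have "1 / 4 \<le> (1 - 1 / x) ^ N"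
    using step.IH by (simp only: x_def)
  moreover have e: "real (Suc N) = x + 1" by (simp add: x_def)
  ultimately show ?case unfolding e by linarith
qed

text \<open>The root is at least \<open>3 - 3 / N\<close>, whose \<open>N\<close>th power is at least \<open>3\<^sup>N / 4\<close>; for \<open>N \<ge> 3\<close> this is more than
  claimed. For \<open>N = 2\<close> the root 1 gives the claim.\<close>

lemma rho_H_mat_ge:
  assumes N: "N \<ge> 2"
  shows "(3 ^ N - 3 * real N - 1) / real N \<le> rho (H_mat N)"
proof (cases "N = 2")
  case True
  have "(1::real) ^ N \<le> rho (H_mat N)"
    unfolding H_mat_eq_cycle_mat using True by (intro rho_cycle_mat_ge_root) auto
  then show ?thesis using True by simp
next
  case False
  then have N3: "N \<ge> 3" using N by simp
  define \<mu> where "\<mu> = 3 * (1 - 1 / real N)"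
  have \<mu>: "2 \<le> \<mu>" "\<mu> \<le> 3" using N3 by (auto simp: \<mu>_def field_simps)
  have p: "3 ^ N / 4 \<le> \<mu> ^ N"
    using quarter_le_power[OF N] unfolding \<mu>_def power_mult_distrib by simp
  \<comment> \<open>Multiplied by \<open>\<mu> - 1\<close>, the inequality at \<open>\<mu>\<close> for the intermediate value theorem becomes
    \<open>(3 - \<mu>) * \<mu>\<^sup>N \<ge> 3 * \<mu> - 1\<close>, and by the bound on \<open>\<mu>\<^sup>N\<close> it follows from this one.\<close>
  have big: "32 * real N - 36 \<le> 3 * 3 ^ N"
    using N3 by (induction N rule: dec_induct) auto
  have "(\<mu> - 1) * (\<mu> ^ N - 2 * (\<Sum>i=1..<N. \<mu> ^ i) + 1) = 3 * \<mu> - 1 - (3 - \<mu>) * \<mu> ^ N"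
    using times_geometric_sum[of N \<mu>] N by (simp add: algebra_simps)
  also have "3 - \<mu> = 3 / real N" by (simp add: \<mu>_def algebra_simps)
  also have "3 * \<mu> - 1 - 3 / real N * \<mu> ^ N \<le> 3 * \<mu> - 1 - 3 / real N * (3 ^ N / 4)"
    using p N by (intro diff_left_mono mult_left_mono) auto
  also have "\<dots> = (32 * real N - 36 - 3 * 3 ^ N) / (4 * real N)"
    using N by (simp add: \<mu>_def field_simps)
  also have "\<dots> \<le> 0"
    using big N by (intro divide_nonpos_pos) auto
  finally have "\<mu> ^ N - 2 * (\<Sum>i=1..<N. \<mu> ^ i) + 1 \<le> 0"
    using \<mu> by (simp add: mult_le_0_iff)
  then obtain \<theta> where l: "\<mu> \<le> \<theta>" "\<theta> \<le> 3" "\<theta> ^ N = 2 * (\<Sum>i=1..<N. \<theta> ^ i) + of_int (- 1)"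
    using cycle_root_exists[of "- 1" N \<mu>] N \<mu> by auto
  have "(3 ^ N - 3 * real N - 1) / real N \<le> 3 ^ N / 4"
  proof (cases "N = 3")
    case False
    have "(3 ^ N - 3 * real N - 1) / real N \<le> 3 ^ N / real N"
      by (intro divide_right_mono) auto
    also have "\<dots> \<le> 3 ^ N / 4"
      using False N3 by (intro divide_left_mono) auto
    finally show ?thesis .
  qed simp
  also note p
  also have "\<mu> ^ N \<le> \<theta> ^ N" using l \<mu> by (intro power_mono) auto
  also have "\<dots> \<le> rho (H_mat N)"
    unfolding H_mat_eq_cycle_mat using l \<mu> N by (intro rho_cycle_mat_ge_root) auto
  finally show ?thesis .
qed

text \<open>The sum of the moduli of the entries of an eigenvector grows at most by the largest column sum.\<close>

lemma rho_H_hat_mat_le: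
  assumes N: "N \<ge> 1"
  shows "rho (H_hat_mat N) \<le> 3 ^ N - 2"
proof -
  obtain \<kappa> v i where v: "cmod \<kappa> = rho (cycle_mat 1 N)" "1 \<le> i" "i \<le> N" "v i \<noteq> 0"
    "\<And>j. 1 \<le> j \<Longrightarrow> j \<le> N \<Longrightarrow> cycle 1 N v j = \<kappa> * v j"
    using rho_cycle_mat_attained[OF N] by metis
  \<comment> \<open>The column sums of the product of the first \<open>m\<close> factors.\<close>
  define p where "p m j = (if m < j then 3 ^ m else 3 ^ m - 2 * 3 ^ (j - 1) :: real)" for m j :: nat
  define u where "u m = foldr (row_update 1 N) [Suc m..<Suc N] v" for m
  have upd: "u m = row_update 1 N (Suc m) (u (Suc m))" if "m < N" for m
    using that by (simp add: u_def upt_conv_Cons del: upt_Suc)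
  have "(\<Sum>j=1..N. cmod (u 0 j)) \<le> (\<Sum>j=1..N. p m j * cmod (u m j))" if "m \<le> N" for m
    using that
  proof (induction m)
    case 0
    show ?case by (intro sum_mono) (auto simp: p_def)
  next
    case (Suc m)
    let ?k = "Suc m" and ?w = "u (Suc m)"
    have k: "?k \<in> {1..N}" using Suc by auto
    have pk: "p m ?k = 3 ^ m" by (simp add: p_def)
    have "(\<Sum>j=1..N. p m j * cmod (u m j))
        = p m ?k * cmod (u m ?k) + (\<Sum>j\<in>{1..N} - {?k}. p m j * cmod (u m j))"
      using k by (subst sum.remove) auto
    also have "(\<Sum>j\<in>{1..N} - {?k}. p m j * cmod (u m j)) = (\<Sum>j\<in>{1..N} - {?k}. p m j * cmod (?w j))"
      using Suc by (intro sum.cong refl) (auto simp: upd[of m] row_update_def)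
    also have "cmod (u m ?k) \<le> cmod (?w ?k) + (\<Sum>j\<in>{1..N} - {?k}. 2 * cmod (?w j))"
    proof -
      have "u m ?k = ?w ?k + (\<Sum>j=1..N. of_int (row_coeff 1 ?k j) * ?w j)"
        using Suc by (simp add: upd[of m] row_update_def)
      also have "(\<Sum>j=1..N. of_int (row_coeff 1 ?k j) * ?w j) = (\<Sum>j\<in>{1..N} - {?k}. 2 * ?w j)"
        using k by (subst sum.remove[of _ ?k]) (auto simp: row_coeff_1 intro!: sum.cong)
      finally have "cmod (u m ?k) \<le> cmod (?w ?k) + cmod (\<Sum>j\<in>{1..N} - {?k}. 2 * ?w j)"
        by (simp add: norm_triangle_ineq)
      also have "cmod (\<Sum>j\<in>{1..N} - {?k}. 2 * ?w j) \<le> (\<Sum>j\<in>{1..N} - {?k}. 2 * cmod (?w j))"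
        by (rule order.trans[OF norm_sum]) (simp add: norm_mult)
      finally show ?thesis by simp
    qed
    also have "p m ?k * (cmod (?w ?k) + (\<Sum>j\<in>{1..N} - {?k}. 2 * cmod (?w j)))
          + (\<Sum>j\<in>{1..N} - {?k}. p m j * cmod (?w j))
        = p m ?k * cmod (?w ?k) + (\<Sum>j\<in>{1..N} - {?k}. (p m j + 2 * p m ?k) * cmod (?w j))"
      by (simp add: algebra_simps sum.distrib sum_distrib_left)
    also have "\<dots> = p ?k ?k * cmod (?w ?k) + (\<Sum>j\<in>{1..N} - {?k}. p ?k j * cmod (?w j))"
      by (intro arg_cong2[where f = "(+)"] sum.cong refl) (auto simp: p_def)
    also have "\<dots> = (\<Sum>j=1..N. p ?k j * cmod (?w j))"
      using k by (subst sum.remove[of _ ?k]) auto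
    finally show ?case using Suc by (simp add: pk)
  qed
  from this[of N] have "(\<Sum>j=1..N. cmod (u 0 j)) \<le> (\<Sum>j=1..N. p N j * cmod (u N j))" by simp
  moreover have "(\<Sum>j=1..N. cmod (u 0 j)) = cmod \<kappa> * (\<Sum>j=1..N. cmod (v j))"
  proof -
    have "u 0 = cycle 1 N v" by (simp only: u_def cycle_def One_nat_def)
    then have "(\<Sum>j=1..N. cmod (u 0 j)) = (\<Sum>j=1..N. cmod \<kappa> * cmod (v j))"
      using v(5) by (intro sum.cong) (auto simp: norm_mult)
    then show ?thesis by (simp add: sum_distrib_left)
  qed
  moreover have "(\<Sum>j=1..N. p N j * cmod (u N j)) \<le> (\<Sum>j=1..N. (3 ^ N - 2) * cmod (v j))"
    by (intro sum_mono) (auto simp: u_def p_def intro!: mult_right_mono)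
  ultimately have "cmod \<kappa> * (\<Sum>j=1..N. cmod (v j)) \<le> (3 ^ N - 2) * (\<Sum>j=1..N. cmod (v j))"
    by (simp add: sum_distrib_left)
  moreover have "(\<Sum>j=1..N. cmod (v j)) > 0"
    using v by (intro sum_pos2[of _ i]) auto
  ultimately show ?thesis using v(1) by (simp add: H_hat_mat_eq_cycle_mat)
qed

section \<open>Word length in free groups\<close>

lemma length_reduce: "length (reduce w) \<le> length w"
proof (induction w)
  case (Cons a w)
  have "length (cons_reduce a v) \<le> Suc (length v)" for v by (cases v) auto
  then have "length (reduce (a # w)) \<le> Suc (length (reduce w))" by (simp add: reduce_def)
  with Cons show ?case by simp
qed (simp add: reduce_def)

lemma word_length_attained:
  assumes "set u \<subseteq> X \<times> UNIV" "eval_word G (\<lambda>x. x) u = g"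
  obtains v where "set v \<subseteq> X \<times> UNIV" "length v = word_length G X g" "eval_word G (\<lambda>x. x) v = g"
proof -
  have "\<exists>v. set v \<subseteq> X \<times> UNIV \<and> length v = word_length G X g \<and> eval_word G (\<lambda>x. x) v = g"
    unfolding word_length_def by (rule LeastI_ex) (use assms in blast)
  then show thesis using that by blast
qed

lemma word_length_le:
  assumes "set u \<subseteq> X \<times> UNIV" "eval_word G (\<lambda>x. x) u = g"
  shows "word_length G X g \<le> length u"
  unfolding word_length_def by (rule Least_le) (use assms in blast)

lemma word_length_image_le:
  assumes "set u \<subseteq> X \<times> UNIV"
  shows "word_length G (f ` X) (eval_word G f u) \<le> length u"
proof -
  have "eval_word G (\<lambda>x. x) (map (apfst f) u) = eval_word G f u"
    by (induction u) auto
  then have "word_length G (f ` X) (eval_word G f u) \<le> length (map (apfst f) u)"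
    using assms by (intro word_length_le) fastforce+
  then show ?thesis by simp
qed

lemma word_length_image_attained:
  assumes "set u \<subseteq> X \<times> UNIV"
  obtains v where "set v \<subseteq> X \<times> UNIV" "length v = word_length G (f ` X) (eval_word G f u)"
    "eval_word G f v = eval_word G f u"
proof -
  have "eval_word G (\<lambda>x. x) (map (apfst f) u) = eval_word G f u"
    by (induction u) auto
  moreover have "set (map (apfst f) u) \<subseteq> f ` X \<times> UNIV" using assms by fastforce
  ultimately obtain v where v: "set v \<subseteq> f ` X \<times> UNIV" "length v = word_length G (f ` X) (eval_word G f u)"
    "eval_word G (\<lambda>x. x) v = eval_word G f u"
    using word_length_attained[of "map (apfst f) u" "f ` X" G] by metis
  obtain v' where "set v' \<subseteq> X \<times> UNIV" "length v' = length v" "eval_word G f v' = eval_word G (\<lambda>x. x) v"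
    using eval_word_image[OF v(1)] by blast
  then show thesis using v that by simp
qed

text \<open>A word that evaluates to \<open>w\<close> reduces to \<open>w\<close>, and reduction does not lengthen words.\<close>

lemma word_length_free_group:
  assumes w: "w \<in> carrier (free_group X)"
  shows "word_length (free_group X) ((\<lambda>x. [(x, True)]) ` X) w = length w"
proof -
  have set: "set w \<subseteq> X \<times> UNIV" and e: "eval_word (free_group X) (\<lambda>x. [(x, True)]) w = w"
    using w eval_word_letters[of w X] by (auto simp: free_group_def reduce_reduced_word)
  obtain v where v: "set v \<subseteq> X \<times> UNIV"
    "length v = word_length (free_group X) ((\<lambda>x. [(x, True)]) ` X) w"
    "eval_word (free_group X) (\<lambda>x. [(x, True)]) v = w"
    using word_length_image_attained[OF set, of "free_group X" "\<lambda>x. [(x, True)]"] unfolding e by blast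
  have "length w \<le> length v"
    using v(3) eval_word_letters[OF v(1)] length_reduce[of v] by simp
  moreover have "word_length (free_group X) ((\<lambda>x. [(x, True)]) ` X) w \<le> length w"
    using word_length_image_le[OF set, of "free_group X" "\<lambda>x. [(x, True)]"] by (simp add: e)
  ultimately show ?thesis using v(2) by simp
qed

lemma word_length_pi1:
  "w \<in> carrier (pi1 N) \<Longrightarrow> word_length (pi1 N) (delta ` {1..Suc N}) w = length w"
  using word_length_free_group[of w "{1..Suc N}"] by (simp only: delta_def[abs_def])

section \<open>The upper bound\<close>

definition weight :: "('x \<Rightarrow> real) \<Rightarrow> 'x gword \<Rightarrow> real" where
  "weight v w = (\<Sum>a\<leftarrow>w. v (fst a))"

lemma weight_simps [simp]: "weight v [] = 0" "weight v (a # w) = v (fst a) + weight v w"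
  "weight v (u @ w) = weight v u + weight v w"
  by (simp_all add: weight_def)

lemma weight_inverse_word [simp]: "weight v (rev (map (apsnd Not) w)) = weight v w"
  by (induction w) auto

lemma weight_reduce_le:
  assumes "\<And>x. 0 \<le> v x"
  shows "weight v (reduce w) \<le> weight v w"
proof (induction w)
  case (Cons a w)
  have "weight v (cons_reduce a u) \<le> v (fst a) + weight v u" for u
    using assms by (cases u) auto
  then have "weight v (reduce (a # w)) \<le> v (fst a) + weight v (reduce w)" by (simp add: reduce_def)
  with Cons show ?case by simp
qed (simp add: reduce_def)

lemma weight_mult_le:
  assumes "\<And>x. 0 \<le> v x"
  shows "weight v (u \<otimes>\<^bsub>free_group X\<^esub> w) \<le> weight v u + weight v w"
  using weight_reduce_le[of v "u @ w", OF assms] by (simp add: free_group_def)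

lemma weight_inv_le:
  assumes "\<And>x. 0 \<le> v x" "w \<in> carrier (free_group X)"
  shows "weight v (inv\<^bsub>free_group X\<^esub> w) \<le> weight v w"
  using weight_reduce_le[of v "rev (map (apsnd Not) w)", OF assms(1)] by (simp add: inv_free_group[OF assms(2)])

lemma weight_eval_word_le:
  assumes v: "\<And>x. 0 \<le> v x" and f: "f \<in> X \<rightarrow> carrier (free_group X)" and "set w \<subseteq> X \<times> UNIV"
  shows "weight v (eval_word (free_group X) f w) \<le> weight (\<lambda>x. weight v (f x)) w"
  using assms(3)
proof (induction w)
  case Nil
  show ?case by (simp add: free_group_def)
next
  case (Cons a w)
  obtain x b where a: "a = (x, b)" by fastforce
  have fx: "f x \<in> carrier (free_group X)" using Cons.prems a f by auto
  have "weight v (eval_word (free_group X) f (a # w)) \<le>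
      weight v (if b then f x else inv\<^bsub>free_group X\<^esub> (f x)) + weight v (eval_word (free_group X) f w)"
    unfolding a eval_word_Cons by (rule weight_mult_le[OF v])
  also have "\<dots> \<le> weight v (f x) + weight (\<lambda>x. weight v (f x)) w"
    using weight_inv_le[OF v fx] Cons by (intro add_mono) auto
  finally show ?case by (simp add: a)
qed

lemma weight_mono:
  assumes "\<And>x. x \<in> X \<Longrightarrow> u x \<le> v x" "set w \<subseteq> X \<times> UNIV"
  shows "weight u w \<le> weight v w"
  using assms(2) by (induction w) (auto intro!: add_mono assms(1))

lemma weight_one: "weight (\<lambda>_. 1) w = length w"
  by (induction w) auto

definition push_weight :: "nat \<Rightarrow> nat \<Rightarrow> (nat \<Rightarrow> real) \<Rightarrow> nat \<Rightarrow> real" where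
  "push_weight N j v = v(j := v j + 2 * (\<Sum>k\<in>{1..Suc N} - {j}. v k))"

lemma weight_push_word:
  assumes "1 \<le> j" "j \<le> N"
  shows "weight v (push_word N j) = (\<Sum>k\<in>{1..Suc N} - {j}. v k)"
proof -
  have "weight v (map (\<lambda>k. (k, True)) xs) = sum_list (map v xs)" for xs
    by (induction xs) auto
  moreover have "sum_list (map v ([Suc j..<Suc (Suc N)] @ [1..<j])) = sum v (set ([Suc j..<Suc (Suc N)] @ [1..<j]))"
    by (rule sum_list_distinct_conv_sum_set) auto
  moreover have "set ([Suc j..<Suc (Suc N)] @ [1..<j]) = {1..Suc N} - {j}"
    using assms by auto
  ultimately show ?thesis unfolding push_word_def by metis
qed

lemma weight_push_image_le:
  assumes v: "\<And>x. 0 \<le> v x" and j: "1 \<le> j" "j \<le> N"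
  shows "weight v (push_image N j i) \<le> push_weight N j v i"
    "weight v (inv_push_image N j i) \<le> push_weight N j v i"
proof -
  have w: "weight v (inv\<^bsub>pi1 N\<^esub> (push_word N j)) \<le> weight v (push_word N j)"
    by (rule weight_inv_le[OF v push_word_closed[OF j]])
  have d: "weight v (delta i) = v i" for i by (simp add: delta_def)
  have le: "weight v (a \<otimes>\<^bsub>pi1 N\<^esub> b \<otimes>\<^bsub>pi1 N\<^esub> c) \<le> weight v a + weight v b + weight v c" for a b c
    using weight_mult_le[of v "{1..Suc N}" "a \<otimes>\<^bsub>pi1 N\<^esub> b" c, OF v]
      weight_mult_le[of v "{1..Suc N}" a b, OF v]
    by linarith
  show "weight v (push_image N j i) \<le> push_weight N j v i"
    "weight v (inv_push_image N j i) \<le> push_weight N j v i"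
    using w d le[of "inv\<^bsub>pi1 N\<^esub> (push_word N j)" "delta j" "push_word N j"]
      le[of "push_word N j" "delta j" "inv\<^bsub>pi1 N\<^esub> (push_word N j)"] weight_push_word[OF j, of v]
    by (auto simp: push_image_def inv_push_image_def push_weight_def)
qed

text \<open>The weights of the images of the generators are new weights for the generators themselves. So
  automorphisms pull weights back, in a composition the outermost one first.\<close>

lemma weight_alpha_sharp_le:
  assumes v: "\<And>x. 0 \<le> v x" and j: "1 \<le> j" "j \<le> N" and w: "w \<in> carrier (pi1 N)"
  shows "weight v ((if b then alpha_sharp N j else inv\<^bsub>AutoGroup (pi1 N)\<^esub> (alpha_sharp N j)) w)
    \<le> weight (push_weight N j v) w"
proof -
  let ?f = "if b then push_image N j else inv_push_image N j"
  have set: "set w \<subseteq> {1..Suc N} \<times> UNIV" using w by (simp add: free_group_def)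
  have f: "?f \<in> {1..Suc N} \<rightarrow> carrier (pi1 N)" using push_image_closed[OF j] by auto
  have "(if b then alpha_sharp N j else inv\<^bsub>AutoGroup (pi1 N)\<^esub> (alpha_sharp N j)) w = eval_word (pi1 N) ?f w"
    using w inv_alpha_sharp[OF j w] by (simp add: alpha_sharp_free_endo free_endo_def)
  also have "weight v \<dots> \<le> weight (\<lambda>x. weight v (?f x)) w"
    by (rule weight_eval_word_le[OF v f set])
  also have "\<dots> \<le> weight (push_weight N j v) w"
    by (rule weight_mono[OF _ set]) (auto intro: weight_push_image_le v j)
  finally show ?thesis .
qed

text \<open>The summand 1 on the left absorbs the contribution of \<open>\<delta>\<^sub>N\<^sub>+\<^sub>1\<close>, whose weight 1 never changes: an update
  adds \<open>2\<close> to one entry on account of \<open>\<delta>\<^sub>N\<^sub>+\<^sub>1\<close>, but the bounds for the other \<open>N - 1\<close> entries, each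
  counted twice, give back at least as much.\<close>

definition dominated :: "nat \<Rightarrow> real \<Rightarrow> real \<Rightarrow> (nat \<Rightarrow> real) \<Rightarrow> bool" where
  "dominated N \<theta> a v \<longleftrightarrow> (\<forall>k. 0 \<le> v k) \<and> v (Suc N) = 1 \<and>
    (\<exists>\<pi>. bij_betw \<pi> {1..N} {0..<N} \<and> (\<forall>k\<in>{1..N}. v k + 1 \<le> a * \<theta> ^ \<pi> k))"

lemma dominated_one:
  assumes "1 \<le> \<theta>"
  shows "dominated N \<theta> 2 (\<lambda>_. 1)"
proof -
  have "bij_betw (\<lambda>k. k - 1) {1..N} {0..<N}"
    by (rule bij_betwI[where g = Suc]) auto
  then show ?thesis using assms unfolding dominated_def
    by (intro conjI exI[of _ "\<lambda>k. k - 1"]) auto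
qed

text \<open>The bound \<open>a * \<theta>\<^sup>N\<close> for the new entry is the equation for \<open>\<theta>\<close> when the entry with the smallest bound
  has been updated, and has room to spare otherwise. The remaining entries inherit the bounds
  \<open>a * \<theta>, \<dots>, a * \<theta>\<^sup>N\<^sup>-\<^sup>1\<close>: an entry that had the bound \<open>a\<close> takes over the one that the updated
  entry has given up.\<close>

lemma dominated_push_weight:
  assumes \<theta>: "1 \<le> \<theta>" and root: "\<theta> ^ N = 2 * (\<Sum>i=1..<N. \<theta> ^ i) + 1" and N: "2 \<le> N"
    and a: "0 \<le> a" and dom: "dominated N \<theta> a v" and j: "1 \<le> j" "j \<le> N"
  shows "dominated N \<theta> (a * \<theta>) (push_weight N j v)"
proof -
  obtain \<pi> where \<pi>: "bij_betw \<pi> {1..N} {0..<N}" "\<And>k. k \<in> {1..N} \<Longrightarrow> v k + 1 \<le> a * \<theta> ^ \<pi> k"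
    and v: "\<And>k. 0 \<le> v k" "v (Suc N) = 1"
    using dom by (auto simp: dominated_def)
  have j': "j \<in> {1..N}" using j by simp
  \<comment> \<open>Let the entry \<open>m\<close> with the smallest bound and the entry \<open>j\<close> exchange their bounds; then shift
    all exponents down by one and give the top exponent to \<open>j\<close>.\<close>
  obtain m where m: "m \<in> {1..N}" "\<pi> m = 0"
  proof -
    have "0 \<in> \<pi> ` {1..N}"
      unfolding bij_betw_imp_surj_on[OF \<pi>(1)] using N by simp
    then show thesis using that by (metis imageE)
  qed
  define \<rho> where "\<rho> k = (if k = j then N - 1 else \<pi> (Transposition.transpose j m k) - 1)" for k
  define c where "c i = (if i = 0 then N - 1 else i - 1)" for i
  have "bij_betw (Transposition.transpose j m) {1..N} {1..N}"
    using m(1) j by (intro bij_betwI[where g = "Transposition.transpose j m"])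
      (auto simp: Transposition.transpose_def)
  then have \<sigma>: "bij_betw (\<pi> \<circ> Transposition.transpose j m) {1..N} {0..<N}"
    using \<pi>(1) by (rule bij_betw_trans)
  have c: "bij_betw c {0..<N} {0..<N}"
    using N by (intro bij_betwI[where g = "\<lambda>i. if i = N - 1 then 0 else Suc i"]) (auto simp: c_def)
  have pos: "\<pi> (Transposition.transpose j m k) \<noteq> 0" if "k \<in> {1..N}" "k \<noteq> j" for k
  proof -
    have "(\<pi> \<circ> Transposition.transpose j m) k \<noteq> (\<pi> \<circ> Transposition.transpose j m) j"
      using inj_on_eq_iff[OF bij_betw_imp_inj_on[OF \<sigma>] that(1) j'] that(2) by simp
    then show ?thesis using m(2) by simp
  qed
  have "bij_betw (c \<circ> (\<pi> \<circ> Transposition.transpose j m)) {1..N} {0..<N}"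
    by (rule bij_betw_trans[OF \<sigma> c])
  moreover have "(c \<circ> (\<pi> \<circ> Transposition.transpose j m)) k = \<rho> k" if "k \<in> {1..N}" for k
    using pos[OF that] m(2) by (auto simp: c_def \<rho>_def)
  ultimately have \<rho>: "bij_betw \<rho> {1..N} {0..<N}"
    using bij_betw_cong[of "{1..N}" "c \<circ> (\<pi> \<circ> Transposition.transpose j m)" \<rho> "{0..<N}"] by blast
  have bound: "push_weight N j v k + 1 \<le> a * \<theta> * \<theta> ^ \<rho> k" if k: "k \<in> {1..N}" for k
  proof (cases "k = j")
    case False
    have "Suc (\<rho> k) = \<pi> (Transposition.transpose j m k)"
      using pos[OF k False] False by (simp add: \<rho>_def)
    moreover have "\<pi> k \<le> \<pi> (Transposition.transpose j m k)"
      using False m(2) by (cases "k = m") (auto simp: Transposition.transpose_def)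
    ultimately have "\<theta> ^ \<pi> k \<le> \<theta> ^ Suc (\<rho> k)"
      by (intro power_increasing \<theta>) simp
    from mult_left_mono[OF this a] have "a * \<theta> ^ \<pi> k \<le> a * \<theta> * \<theta> ^ \<rho> k"
      by (simp add: mult.assoc)
    then show ?thesis using \<pi>(2)[OF k] False by (simp add: push_weight_def)
  next
    case True
    have S: "(\<Sum>k\<in>{1..N}. \<theta> ^ \<pi> k) = (\<Sum>i\<in>{0..<N}. \<theta> ^ i)"
      by (rule sum.reindex_bij_betw[OF \<pi>(1)])
    have S0: "(\<Sum>i\<in>{0..<N}. \<theta> ^ i) = 1 + (\<Sum>i=1..<N. \<theta> ^ i)"
      using N sum.atLeast_Suc_lessThan[of 0 N "\<lambda>i. \<theta> ^ i"] by (simp add: One_nat_def)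
    have rem: "(\<Sum>k\<in>{1..N}. f k) = f j + (\<Sum>k\<in>{1..N} - {j}. f k)" for f :: "nat \<Rightarrow> real"
      using j' by (simp add: sum.remove)
    have "{1..Suc N} - {j} = insert (Suc N) ({1..N} - {j})" using j by auto
    then have "push_weight N j v j + 1 = v j + 1 + 2 * (\<Sum>k\<in>{1..N} - {j}. v k) + 2"
      by (simp add: push_weight_def v)
    also have "(\<Sum>k\<in>{1..N} - {j}. v k) \<le> (\<Sum>k\<in>{1..N} - {j}. a * \<theta> ^ \<pi> k - 1)"
      using \<pi>(2) by (intro sum_mono) (auto simp: algebra_simps)
    also have "(\<Sum>k\<in>{1..N} - {j}. a * \<theta> ^ \<pi> k - 1) = a * (\<Sum>k\<in>{1..N} - {j}. \<theta> ^ \<pi> k) - real (N - 1)"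
      using j' by (simp add: sum_subtractf sum_distrib_left)
    also have "v j + 1 \<le> a * \<theta> ^ \<pi> j" by (rule \<pi>(2)[OF j'])
    also have "a * \<theta> ^ \<pi> j + 2 * (a * (\<Sum>k\<in>{1..N} - {j}. \<theta> ^ \<pi> k) - real (N - 1)) + 2
        = a * (2 * (\<Sum>k\<in>{1..N}. \<theta> ^ \<pi> k) - \<theta> ^ \<pi> j) + (2 - 2 * real (N - 1))"
      by (simp add: rem algebra_simps)
    \<comment> \<open>The second summand is nonpositive because \<open>N \<ge> 2\<close>.\<close>
    also have "\<dots> \<le> a * (2 * (\<Sum>k\<in>{1..N}. \<theta> ^ \<pi> k) - 1) + 0"
      using a \<theta> N by (intro add_mono mult_left_mono) auto
    also have "\<dots> = a * \<theta> ^ N" by (simp add: S S0 root)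
    also have "\<dots> = a * \<theta> * \<theta> ^ \<rho> j"
      using N by (cases N) (auto simp: \<rho>_def)
    finally show ?thesis using True by simp
  qed
  have "0 \<le> push_weight N j v k" for k
    using v by (auto simp: push_weight_def intro!: add_nonneg_nonneg sum_nonneg)
  moreover have "push_weight N j v (Suc N) = 1"
    using v j by (simp add: push_weight_def)
  ultimately show ?thesis
    unfolding dominated_def using \<rho> bound by blast
qed

lemma alpha_sharp_word_auto:
  assumes "set u \<subseteq> {1..N} \<times> UNIV"
  shows "eval_word (AutoGroup (pi1 N)) (alpha_sharp N) u \<in> auto (pi1 N)"
proof -
  interpret F: group "pi1 N" by (rule group_free_group)
  interpret A: group "AutoGroup (pi1 N)" by (rule F.AutoGroup)
  have "alpha_sharp N \<in> {1..N} \<rightarrow> carrier (AutoGroup (pi1 N))"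
    using alpha_sharp_auto by (auto simp: carrier_AutoGroup)
  from A.eval_word_closed[OF this assms] show ?thesis by (simp add: carrier_AutoGroup)
qed

lemma auto_closed: "\<phi> \<in> auto G \<Longrightarrow> w \<in> carrier G \<Longrightarrow> \<phi> w \<in> carrier G"
  using Bij_imp_funcset[of \<phi> "carrier G"] by (auto simp only: auto_def Int_iff dest: funcset_mem)

lemma auto_funpow_closed:
  assumes "\<phi> \<in> auto G" "w \<in> carrier G"
  shows "(\<phi> ^^ n) w \<in> carrier G"
  by (induction n) (simp_all add: assms(2) auto_closed[OF assms(1)])

context
  fixes N :: nat and \<theta> :: real
  assumes \<theta>: "1 \<le> \<theta>" and root: "\<theta> ^ N = 2 * (\<Sum>i=1..<N. \<theta> ^ i) + 1" and N: "2 \<le> N"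
begin

lemma weight_alpha_sharp_word_le:
  assumes u: "set u \<subseteq> {1..N} \<times> UNIV" and "0 \<le> a" "dominated N \<theta> a v"
  shows "\<exists>v'. dominated N \<theta> (a * \<theta> ^ length u) v' \<and>
    (\<forall>w\<in>carrier (pi1 N). weight v (eval_word (AutoGroup (pi1 N)) (alpha_sharp N) u w) \<le> weight v' w)"
  using assms
proof (induction u arbitrary: a v)
  case Nil
  then show ?case by (intro exI[of _ v]) (auto simp: one_AutoGroup)
next
  case (Cons l u)
  interpret F: group "pi1 N" by (rule group_free_group)
  interpret A: group "AutoGroup (pi1 N)" by (rule F.AutoGroup)
  obtain j b where l: "l = (j, b)" by fastforce
  let ?\<psi> = "eval_word (AutoGroup (pi1 N)) (alpha_sharp N) u"
  let ?\<alpha> = "if b then alpha_sharp N j else inv\<^bsub>AutoGroup (pi1 N)\<^esub> (alpha_sharp N j)"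
  have j: "1 \<le> j" "j \<le> N" and u: "set u \<subseteq> {1..N} \<times> UNIV" using Cons.prems l by auto
  have v: "\<And>x. 0 \<le> v x" using Cons.prems(3) by (simp add: dominated_def)
  have a: "0 \<le> a * \<theta>" using Cons.prems(2) \<theta> by simp
  obtain v' where v': "dominated N \<theta> (a * \<theta> * \<theta> ^ length u) v'"
    "\<And>w. w \<in> carrier (pi1 N) \<Longrightarrow> weight (push_weight N j v) (?\<psi> w) \<le> weight v' w"
    using Cons.IH[OF u a dominated_push_weight[OF \<theta> root N Cons.prems(2,3) j]] by blast
  have auto: "?\<psi> \<in> auto (pi1 N)" "?\<alpha> \<in> auto (pi1 N)"
    using alpha_sharp_word_auto[OF u] alpha_sharp_auto[OF j] A.inv_closed[of "alpha_sharp N j"]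
    by (auto simp: carrier_AutoGroup)
  have "weight v (eval_word (AutoGroup (pi1 N)) (alpha_sharp N) (l # u) w) \<le> weight v' w"
    if w: "w \<in> carrier (pi1 N)" for w
  proof -
    have c: "?\<psi> w \<in> carrier (pi1 N)" by (rule auto_closed[OF auto(1) w])
    have "eval_word (AutoGroup (pi1 N)) (alpha_sharp N) (l # u) w = ?\<alpha> (?\<psi> w)"
      unfolding l eval_word_Cons by (rule F.AutoGroup_mult_apply[OF auto(2,1) w])
    also have "weight v \<dots> \<le> weight (push_weight N j v) (?\<psi> w)"
      by (rule weight_alpha_sharp_le[OF v j c])
    also have "\<dots> \<le> weight v' w" by (rule v'(2)[OF w])
    finally show ?thesis .
  qed
  then show ?case using v'(1) by (intro exI[of _ v']) (simp add: mult.assoc)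
qed

lemma weight_alpha_sharp_power_le:
  assumes u: "set u \<subseteq> {1..N} \<times> UNIV" and "0 \<le> a" "dominated N \<theta> a v"
  defines "\<phi> \<equiv> eval_word (AutoGroup (pi1 N)) (alpha_sharp N) u"
  shows "\<exists>v'. dominated N \<theta> (a * \<theta> ^ (length u * n)) v' \<and>
    (\<forall>w\<in>carrier (pi1 N). weight v ((\<phi> ^^ n) w) \<le> weight v' w)"
  using assms(2,3)
proof (induction n arbitrary: a v)
  case 0
  then show ?case by (intro exI[of _ v]) auto
next
  case (Suc n)
  obtain v1 where v1: "dominated N \<theta> (a * \<theta> ^ length u) v1"
    "\<And>w. w \<in> carrier (pi1 N) \<Longrightarrow> weight v (\<phi> w) \<le> weight v1 w"
    using weight_alpha_sharp_word_le[OF u Suc.prems] unfolding \<phi>_def by blast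
  have "0 \<le> a * \<theta> ^ length u" using Suc.prems(1) \<theta> by simp
  from Suc.IH[OF this v1(1)] obtain v2 where v2: "dominated N \<theta> (a * \<theta> ^ length u * \<theta> ^ (length u * n)) v2"
    "\<And>w. w \<in> carrier (pi1 N) \<Longrightarrow> weight v1 ((\<phi> ^^ n) w) \<le> weight v2 w" by blast
  have "weight v ((\<phi> ^^ Suc n) w) \<le> weight v2 w" if w: "w \<in> carrier (pi1 N)" for w
  proof -
    have "(\<phi> ^^ n) w \<in> carrier (pi1 N)"
      unfolding \<phi>_def by (rule auto_funpow_closed[OF alpha_sharp_word_auto[OF u] w])
    from v1(2)[OF this] v2(2)[OF w] show ?thesis by simp
  qed
  then show ?case using v2(1) by (intro exI[of _ v2]) (simp add: power_add mult.assoc)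
qed

lemma length_alpha_sharp_power_le:
  assumes u: "set u \<subseteq> {1..N} \<times> UNIV" and i: "1 \<le> i" "i \<le> Suc N"
  defines "\<phi> \<equiv> eval_word (AutoGroup (pi1 N)) (alpha_sharp N) u"
  shows "real (length ((\<phi> ^^ n) (delta i))) \<le> 2 * \<theta> ^ N * \<theta> ^ (length u * n)"
proof -
  obtain v where v: "dominated N \<theta> (2 * \<theta> ^ (length u * n)) v"
    "\<And>w. w \<in> carrier (pi1 N) \<Longrightarrow> weight (\<lambda>_. 1) ((\<phi> ^^ n) w) \<le> weight v w"
    using weight_alpha_sharp_power_le[OF u zero_le_numeral dominated_one[OF \<theta>], of n]
    unfolding \<phi>_def by blast
  have "real (length ((\<phi> ^^ n) (delta i))) \<le> v i"
    using v(2)[OF delta_closed[OF i]] by (simp add: weight_one delta_def)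
  also have "v i \<le> 2 * \<theta> ^ (length u * n) * \<theta> ^ N"
  proof (cases "i = Suc N")
    case True
    have "1 * 1 \<le> \<theta> ^ (length u * n) * \<theta> ^ N"
      using \<theta> by (intro mult_mono) auto
    then show ?thesis using v(1) True by (simp add: dominated_def)
  next
    case False
    then obtain m where m: "m < N" "v i + 1 \<le> 2 * \<theta> ^ (length u * n) * \<theta> ^ m"
    proof -
      obtain \<pi> where \<pi>: "bij_betw \<pi> {1..N} {0..<N}"
        "\<forall>k\<in>{1..N}. v k + 1 \<le> 2 * \<theta> ^ (length u * n) * \<theta> ^ \<pi> k"
        using v(1) unfolding dominated_def by blast
      have "i \<in> {1..N}" using i False by simp
      then show thesis using that[of "\<pi> i"] \<pi>(2) bij_betwE[OF \<pi>(1)] by simp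
    qed
    have "2 * \<theta> ^ (length u * n) * \<theta> ^ m \<le> 2 * \<theta> ^ (length u * n) * \<theta> ^ N"
      using m \<theta> by (intro mult_left_mono power_increasing) auto
    with m show ?thesis by linarith
  qed
  finally show ?thesis by (simp add: mult_ac)
qed

lemma entropy_alpha_sharp_word_le:
  assumes u: "set u \<subseteq> {1..N} \<times> UNIV"
  shows "entropy (pi1 N) (delta ` {1..Suc N}) (eval_word (AutoGroup (pi1 N)) (alpha_sharp N) u)
    \<le> ereal (real (length u) * ln \<theta>)"
proof -
  let ?\<phi> = "eval_word (AutoGroup (pi1 N)) (alpha_sharp N) u"
  let ?len = "\<lambda>n x. real (word_length (pi1 N) (delta ` {1..Suc N}) ((?\<phi> ^^ n) x))"
  have "limsup (\<lambda>n. ereal (ln (?len n (delta i)) / real n)) \<le> ereal (real (length u) * ln \<theta>)"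
    if i: "1 \<le> i" "i \<le> Suc N" for i
  proof -
    let ?C = "ln (2 * \<theta> ^ N)"
    have len: "?len n (delta i) \<le> 2 * \<theta> ^ N * \<theta> ^ (length u * n)" for n
      using length_alpha_sharp_power_le[OF u i, of n] word_length_pi1
        auto_funpow_closed[OF alpha_sharp_word_auto[OF u] delta_closed[OF i], of n] by simp
    have "ln (?len n (delta i)) / real n \<le> ?C / real n + real (length u) * ln \<theta>" if "n \<ge> 1" for n
    proof -
      have pos: "1 \<le> 2 * \<theta> ^ N" "1 \<le> \<theta> ^ (length u * n)"
        using one_le_power[OF \<theta>, of N] one_le_power[OF \<theta>, of "length u * n"] by linarith+
      have "ln (?len n (delta i)) \<le> ln (2 * \<theta> ^ N * \<theta> ^ (length u * n))"
      proof (cases "?len n (delta i) = 0")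
        case True
        have "1 * 1 \<le> 2 * \<theta> ^ N * \<theta> ^ (length u * n)" using pos by (intro mult_mono) auto
        then show ?thesis using True by simp
      next
        case False
        then show ?thesis using len[of n] by (intro ln_mono) auto
      qed
      also have "\<dots> = ?C + real n * (real (length u) * ln \<theta>)"
        using pos \<theta> by (simp add: ln_mult ln_realpow)
      finally show ?thesis using that by (simp add: field_simps)
    qed
    then have "eventually (\<lambda>n. ereal (ln (?len n (delta i)) / real n)
        \<le> ereal (?C / real n + real (length u) * ln \<theta>)) sequentially"
      by (auto simp: eventually_sequentially)
    then have "limsup (\<lambda>n. ereal (ln (?len n (delta i)) / real n))
        \<le> limsup (\<lambda>n. ereal (?C / real n + real (length u) * ln \<theta>))"
      by (rule Limsup_mono)
    also have "(\<lambda>n. ?C / real n + real (length u) * ln \<theta>) \<longlonglongrightarrow> 0 + real (length u) * ln \<theta>"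
      by (intro tendsto_add lim_const_over_n tendsto_const)
    then have "limsup (\<lambda>n. ereal (?C / real n + real (length u) * ln \<theta>)) = ereal (real (length u) * ln \<theta>)"
      by (intro lim_imp_Limsup) auto
    finally show ?thesis .
  qed
  then show ?thesis
    unfolding entropy_def by (intro Max.boundedI) auto
qed

lemma eff_le:
  assumes \<beta>: "\<beta> \<in> point_push N" "\<beta> \<noteq> \<one>\<^bsub>braid_group (Suc N)\<^esub>"
  shows "eff N \<beta> \<le> ereal (ln \<theta>)"
proof -
  let ?L = "word_length (braid_group (Suc N)) (alpha N ` {1..N}) \<beta>"
  obtain u0 where u0: "set u0 \<subseteq> {1..N} \<times> UNIV" "eval_word (braid_group (Suc N)) (alpha N) u0 = \<beta>"
    using point_push_alpha_word[OF \<beta>(1)] .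
  obtain u where u: "set u \<subseteq> {1..N} \<times> UNIV" "length u = ?L"
    "eval_word (braid_group (Suc N)) (alpha N) u = \<beta>"
    using word_length_image_attained[OF u0(1), of "braid_group (Suc N)" "alpha N"] unfolding u0(2) by blast
  have "u \<noteq> []" using u(3) \<beta>(2) by auto
  then have L: "real ?L > 0" unfolding u(2)[symmetric] by simp
  have "entropy (pi1 N) (delta ` {1..Suc N}) (induced_aut N \<beta>) \<le> ereal (real ?L * ln \<theta>)"
    using entropy_alpha_sharp_word_le[of "rev u"] induced_aut_alpha_word[OF u(1)] u by simp
  then have "eff N \<beta> \<le> ereal (real ?L * ln \<theta>) / ereal (real ?L)"
    unfolding eff_def using L by (intro ereal_divide_right_mono) auto
  also have "\<dots> = ereal (ln \<theta>)" using L by simp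
  finally show ?thesis .
qed

end

lemma Eff_le:
  assumes N: "2 \<le> N"
  shows "Eff N \<le> ereal (ln (rho (H_hat_mat N)) / real N)" "1 \<le> rho (H_hat_mat N)"
proof -
  obtain \<theta> :: real where \<theta>: "1 \<le> \<theta>" "\<theta> ^ N = 2 * (\<Sum>i=1..<N. \<theta> ^ i) + 1" "\<theta> ^ N \<le> rho (H_hat_mat N)"
    using H_hat_root[of N] N by auto
  show "1 \<le> rho (H_hat_mat N)" using one_le_power[OF \<theta>(1), of N] \<theta>(3) by linarith
  have "Eff N \<le> ereal (ln \<theta>)"
    unfolding Eff_def using eff_le[OF \<theta>(1,2) N] by (intro SUP_least) auto
  also have "ln \<theta> = ln (\<theta> ^ N) / real N"
    using \<theta>(1) N by (simp add: ln_realpow)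
  also have "\<dots> \<le> ln (rho (H_hat_mat N)) / real N"
    using \<theta> one_le_power[OF \<theta>(1), of N] by (intro divide_right_mono ln_mono) auto
  finally show "Eff N \<le> ereal (ln (rho (H_hat_mat N)) / real N)" by simp
qed

section \<open>An action on the plane by point reflections\<close>

text \<open>The action of \<open>\<delta>\<^sub>x\<close> on the complex plane, by an involution, so that a letter and its inverse act
  alike. The sign for \<open>x = N + 1\<close> makes the loop of the stirrer, which is the inverse of the product of
  all \<open>\<delta>\<^sub>x\<close>, act by a point reflection as well.\<close>

definition reflection :: "nat \<Rightarrow> (nat \<Rightarrow> complex) \<Rightarrow> nat \<Rightarrow> complex \<Rightarrow> complex" where
  "reflection N v x z = (if x \<le> N then v x - z else (- 1) ^ Suc N * z)"

definition refl_word :: "nat \<Rightarrow> (nat \<Rightarrow> complex) \<Rightarrow> nat gword \<Rightarrow> complex \<Rightarrow> complex" where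
  "refl_word N v w = foldr (\<lambda>a. reflection N v (fst a)) w"

lemma reflection_reflection [simp]: "reflection N v x (reflection N v x z) = z"
  by (simp add: reflection_def)

lemma refl_word_simps [simp]:
  "refl_word N v [] z = z"
  "refl_word N v (a # w) z = reflection N v (fst a) (refl_word N v w z)"
  "refl_word N v (u @ w) z = refl_word N v u (refl_word N v w z)"
  by (simp_all add: refl_word_def)

lemma refl_word_reduce: "refl_word N v (reduce w) z = refl_word N v w z"
proof (induction w)
  case (Cons a w)
  have "refl_word N v (cons_reduce a u) z = reflection N v (fst a) (refl_word N v u z)" for u
    by (cases u) (auto simp: cancelling_def)
  then have "refl_word N v (reduce (a # w)) z = reflection N v (fst a) (refl_word N v (reduce w) z)"
    by (simp add: reduce_def)
  with Cons show ?case by simp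
qed (simp add: reduce_def)

lemma refl_word_inverse_word: "refl_word N v (rev (map (apsnd Not) w)) (refl_word N v w z) = z"
  by (induction w arbitrary: z) auto

lemma refl_word_mult:
  "refl_word N v (u \<otimes>\<^bsub>free_group X\<^esub> w) z = refl_word N v u (refl_word N v w z)"
  by (simp add: free_group_def refl_word_reduce)

lemma refl_word_inv:
  "w \<in> carrier (free_group X) \<Longrightarrow> refl_word N v (inv\<^bsub>free_group X\<^esub> w) (refl_word N v w z) = z"
  by (simp add: inv_free_group refl_word_reduce refl_word_inverse_word)

lemma refl_word_upt:
  assumes "a \<le> b" "b \<le> Suc N"
  shows "refl_word N v (map (\<lambda>k. (k, True)) [a..<b]) z
    = (\<Sum>k=a..<b. (- 1) ^ (k - a) * v k) + (- 1) ^ (b - a) * z"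
  using assms
proof (induction b arbitrary: z rule: dec_induct)
  case (step b)
  then have "refl_word N v (map (\<lambda>k. (k, True)) [a..<Suc b]) z
      = (\<Sum>k=a..<b. (- 1) ^ (k - a) * v k) + (- 1) ^ (b - a) * (v b - z)"
    by (simp add: reflection_def)
  then show ?case using step by (simp add: Suc_diff_le algebra_simps)
qed simp

text \<open>The word \<open>w\<^sub>j\<close> acts by a translation. It contains every generator but \<open>\<delta>\<^sub>j\<close>, and the signs that its
  letters accumulate cancel.\<close>

lemma refl_word_push_word:
  assumes j: "1 \<le> j" "j \<le> N"
  shows "2 * refl_word N v (push_word N j) z
    = 2 * z - (\<Sum>k=1..N. of_int (row_coeff (- 1) j k) * v k)"
proof -
  have sgn: "(- 1) ^ (N - j) * ((- 1) ^ Suc N * (- 1) ^ (j - 1)) = (1 :: complex)"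
    using j by (auto simp: minus_one_power_iff)
  have sgn': "2 * ((- 1) ^ (N - j) * ((- 1) ^ Suc N * (- 1) ^ (k - 1))) = - complex_of_int (row_coeff (- 1) j k)"
    if "1 \<le> k" "k < j" for k
    using that j by (auto simp: row_coeff_def minus_one_power_iff)
  have sgn'': "2 * (- 1) ^ (k - Suc j) = - complex_of_int (row_coeff (- 1) j k)"
    if "j < k" for k
    using that by (auto simp: row_coeff_def minus_one_power_iff)
  let ?low = "\<Sum>k=1..<j. (- 1) ^ (k - 1) * v k" and ?high = "\<Sum>k=Suc j..<Suc N. (- 1) ^ (k - Suc j) * v k"
  have "refl_word N v (push_word N j) z
      = ?high + (- 1) ^ (N - j) * ((- 1) ^ Suc N * (?low + (- 1) ^ (j - 1) * z))"
    using j refl_word_upt[of "Suc j" "Suc N" N v] refl_word_upt[of 1 j N v]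
    by (simp add: push_word_def reflection_def del: upt_Suc add: upt_Suc_append[of "Suc j" "Suc N"])
  also have "\<dots> = ?high + (- 1) ^ (N - j) * ((- 1) ^ Suc N * ?low)
      + (- 1) ^ (N - j) * ((- 1) ^ Suc N * (- 1) ^ (j - 1)) * z"
    by (simp only: distrib_left mult.assoc add.assoc)
  also have "\<dots> = ?high + (- 1) ^ (N - j) * ((- 1) ^ Suc N * ?low) + z"
    by (simp only: sgn mult_1_left)
  finally have "2 * refl_word N v (push_word N j) z
      = 2 * ?high + 2 * ((- 1) ^ (N - j) * ((- 1) ^ Suc N * ?low)) + 2 * z"
    by (simp only: distrib_left)
  also have "2 * ?high = - (\<Sum>k=Suc j..<Suc N. of_int (row_coeff (- 1) j k) * v k)"
    unfolding sum_distrib_left sum_negf[symmetric] mult.assoc[symmetric]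
    by (intro sum.cong refl) (simp add: sgn'')
  also have "2 * ((- 1) ^ (N - j) * ((- 1) ^ Suc N * ?low)) = - (\<Sum>k=1..<j. of_int (row_coeff (- 1) j k) * v k)"
  proof -
    have "2 * ((- 1) ^ (N - j) * ((- 1) ^ Suc N * ?low))
        = (\<Sum>k=1..<j. 2 * ((- 1) ^ (N - j) * ((- 1) ^ Suc N * (- 1) ^ (k - 1))) * v k)"
      by (simp only: sum_distrib_left mult.assoc)
    also have "\<dots> = (\<Sum>k=1..<j. - (of_int (row_coeff (- 1) j k) * v k))"
      by (intro sum.cong refl) (simp only: sgn' atLeastLessThan_iff mult_minus_left)
    finally show ?thesis by (simp only: sum_negf)
  qed
  also have "- (\<Sum>k=Suc j..<Suc N. of_int (row_coeff (- 1) j k) * v k)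
      + - (\<Sum>k=1..<j. of_int (row_coeff (- 1) j k) * v k) + 2 * z
      = 2 * z - (\<Sum>k=1..N. of_int (row_coeff (- 1) j k) * v k)"
  proof -
    have "{1..N} = insert j ({1..<j} \<union> {Suc j..<Suc N})" "{1..<j} \<inter> {Suc j..<Suc N} = {}"
      using j by auto
    then show ?thesis by (simp add: sum.union_disjoint row_coeff_def[of _ j j])
  qed
  finally show ?thesis .
qed

text \<open>Conjugating a point reflection by a translation moves its centre by the opposite vector, hence its
  constant term by twice that vector.\<close>

lemma refl_word_push_image:
  assumes j: "1 \<le> j" "j \<le> N"
  shows "refl_word N v (push_image N j x) z = reflection N (row_update (- 1) N j v) x z"
proof (cases "x = j")
  case True
  let ?w = "push_word N j" and ?c = "\<Sum>k=1..N. of_int (row_coeff (- 1) j k) * v k"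
  have w: "refl_word N v ?w y = y - ?c / 2" for y
    using refl_word_push_word[OF j, of v y] by (simp add: field_simps)
  have "refl_word N v (inv\<^bsub>pi1 N\<^esub> ?w) y = y + ?c / 2" for y
    using refl_word_inv[OF push_word_closed[OF j], of N v "y + ?c / 2"] by (simp add: w)
  then show ?thesis
    using True j by (simp add: push_image_def refl_word_mult w delta_def reflection_def row_update_def)
next
  case False
  then show ?thesis by (simp add: push_image_def delta_def reflection_def row_update_def)
qed

lemma refl_word_alpha_sharp:
  assumes j: "1 \<le> j" "j \<le> N" and w: "w \<in> carrier (pi1 N)"
  shows "refl_word N v (alpha_sharp N j w) z = refl_word N (row_update (- 1) N j v) w z"
proof -
  have "refl_word N v (eval_word (pi1 N) (push_image N j) w) z = refl_word N (row_update (- 1) N j v) w z"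
    if "set w \<subseteq> {1..Suc N} \<times> UNIV" for w
    using that
  proof (induction w)
    case Nil
    show ?case by (simp add: free_group_def)
  next
    case (Cons a w)
    obtain x b where a: "a = (x, b)" by fastforce
    have x: "push_image N j x \<in> carrier (pi1 N)"
      using push_image_closed(1)[OF j] Cons.prems a by auto
    have "refl_word N v (inv\<^bsub>pi1 N\<^esub> (push_image N j x)) y = reflection N (row_update (- 1) N j v) x y" for y
      using refl_word_inv[OF x, of N v "reflection N (row_update (- 1) N j v) x y"]
      by (simp add: refl_word_push_image[OF j])
    then show ?case using Cons by (simp add: a refl_word_mult refl_word_push_image[OF j])
  qed
  then show ?thesis using w by (simp add: alpha_sharp_free_endo free_endo_def free_group_def)
qed

lemma refl_word_cong:
  assumes "\<And>x. 1 \<le> x \<Longrightarrow> x \<le> N \<Longrightarrow> u x = v x" "set w \<subseteq> {1..Suc N} \<times> UNIV"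
  shows "refl_word N u w z = refl_word N v w z"
  using assms(2) by (induction w) (auto simp: reflection_def assms(1))

lemma refl_word_scale: "refl_word N (\<lambda>x. c * v x) w (c * z) = c * refl_word N v w z"
  by (induction w) (auto simp: reflection_def algebra_simps)

lemma norm_refl_word_le:
  assumes "\<And>x. x \<le> N \<Longrightarrow> norm (v x) \<le> M" "0 \<le> M"
  shows "norm (refl_word N v w z) \<le> M * length w + norm z"
proof (induction w)
  case (Cons a w)
  have "norm (reflection N v (fst a) y) \<le> M + norm y" for y
  proof (cases "fst a \<le> N")
    case True
    then show ?thesis
      using norm_triangle_ineq4[of "v (fst a)" y] assms(1)[OF True] by (simp add: reflection_def)
  next
    case False
    then show ?thesis using assms(2) by (simp add: reflection_def norm_mult norm_power)
  qed
  from order.trans[OF this add_left_mono[OF Cons.IH]] show ?case by (simp add: algebra_simps)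
qed simp

section \<open>The lower bound\<close>

definition cyclic_word :: "nat \<Rightarrow> nat gword" where
  "cyclic_word N = map (\<lambda>i. (i, True)) [1..<Suc N]"

lemma set_cyclic_word: "set (cyclic_word N) \<subseteq> {1..N} \<times> UNIV"
  by (auto simp: cyclic_word_def)

definition cyclic_aut :: "nat \<Rightarrow> nat gword \<Rightarrow> nat gword" where
  "cyclic_aut N = eval_word (AutoGroup (pi1 N)) (alpha_sharp N) (rev (cyclic_word N))"

lemma cyclic_aut_auto: "cyclic_aut N \<in> auto (pi1 N)"
  unfolding cyclic_aut_def using set_cyclic_word by (intro alpha_sharp_word_auto) simp

text \<open>The automorphism applied last contributes the matrix that acts first on \<open>v\<close>; so \<open>\<alpha>\<^sub>1\<close>, which acts first
  on words, contributes the leftmost factor of \<open>H\<^sup>(\<^sup>N\<^sup>)\<close>.\<close>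

lemma refl_word_cyclic_aut:
  assumes w: "w \<in> carrier (pi1 N)"
  shows "refl_word N v (cyclic_aut N w) z = refl_word N (cycle (- 1) N v) w z"
proof -
  interpret F: group "pi1 N" by (rule group_free_group)
  interpret A: group "AutoGroup (pi1 N)" by (rule F.AutoGroup)
  have sharp: "alpha_sharp N \<in> {1..N} \<rightarrow> carrier (AutoGroup (pi1 N))"
    using alpha_sharp_auto by (auto simp: carrier_AutoGroup)
  have "refl_word N v (eval_word (AutoGroup (pi1 N)) (alpha_sharp N) (rev (map (\<lambda>i. (i, True)) ks)) w) z
      = refl_word N (foldr (row_update (- 1) N) ks v) w z" if "set ks \<subseteq> {1..N}" for ks
    using that w
  proof (induction ks arbitrary: w)
    case Nil
    then show ?case by (simp add: one_AutoGroup)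
  next
    case (Cons k ks)
    let ?\<phi> = "eval_word (AutoGroup (pi1 N)) (alpha_sharp N) (rev (map (\<lambda>i. (i, True)) ks))"
    have k: "1 \<le> k" "k \<le> N" and ks: "set (rev (map (\<lambda>i. (i, True)) ks)) \<subseteq> {1..N} \<times> UNIV"
      using Cons.prems(1) by auto
    note a = alpha_sharp_auto[OF k]
    have c: "alpha_sharp N k w \<in> carrier (pi1 N)" by (rule auto_closed[OF a Cons.prems(2)])
    have "eval_word (AutoGroup (pi1 N)) (alpha_sharp N) (rev (map (\<lambda>i. (i, True)) (k # ks)))
        = ?\<phi> \<otimes>\<^bsub>AutoGroup (pi1 N)\<^esub> alpha_sharp N k"
      using A.eval_word_append[OF sharp ks, of "[(k, True)]"] k a by (simp add: carrier_AutoGroup)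
    then have "eval_word (AutoGroup (pi1 N)) (alpha_sharp N) (rev (map (\<lambda>i. (i, True)) (k # ks))) w
        = ?\<phi> (alpha_sharp N k w)"
      using F.AutoGroup_mult_apply[OF alpha_sharp_word_auto[OF ks] a Cons.prems(2)] by simp
    then show ?case
      using Cons.IH[OF _ c] Cons.prems refl_word_alpha_sharp[OF k Cons.prems(2)] by simp
  qed
  moreover have "set [1..<Suc N] \<subseteq> {1..N}" by auto
  ultimately show ?thesis unfolding cyclic_aut_def cyclic_word_def cycle_def by blast
qed

lemma refl_word_cyclic_aut_power:
  assumes ev: "\<And>j. 1 \<le> j \<Longrightarrow> j \<le> N \<Longrightarrow> cycle (- 1) N v j = \<kappa> * v j" and w: "w \<in> carrier (pi1 N)"
  shows "refl_word N v ((cyclic_aut N ^^ n) w) 0 = \<kappa> ^ n * refl_word N v w 0"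
proof (induction n)
  case (Suc n)
  let ?w = "(cyclic_aut N ^^ n) w"
  have c: "?w \<in> carrier (pi1 N)" by (rule auto_funpow_closed[OF cyclic_aut_auto w])
  then have set: "set ?w \<subseteq> {1..Suc N} \<times> UNIV" by (simp add: free_group_def)
  have "refl_word N v ((cyclic_aut N ^^ Suc n) w) 0 = refl_word N (cycle (- 1) N v) ?w 0"
    using refl_word_cyclic_aut[OF c] by simp
  also have "\<dots> = refl_word N (\<lambda>j. \<kappa> * v j) ?w (\<kappa> * 0)"
    using refl_word_cong[OF ev set] by simp
  also have "\<dots> = \<kappa> * refl_word N v ?w 0" by (rule refl_word_scale)
  finally show ?case using Suc by simp
qed simp

text \<open>The index \<open>i\<close> of a nonzero entry of the eigenvector names a generator whose images grow fast enough.\<close>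

lemma entropy_cyclic_aut_ge:
  assumes N: "1 \<le> N" and pos: "0 < rho (H_mat N)"
  shows "ereal (ln (rho (H_mat N))) \<le> entropy (pi1 N) (delta ` {1..Suc N}) (cyclic_aut N)"
proof -
  obtain \<kappa> v i where v: "cmod \<kappa> = rho (H_mat N)" "1 \<le> i" "i \<le> N" "v i \<noteq> 0"
    "\<And>j. 1 \<le> j \<Longrightarrow> j \<le> N \<Longrightarrow> cycle (- 1) N v j = \<kappa> * v j"
    using rho_cycle_mat_attained[OF N, of "- 1", folded H_mat_eq_cycle_mat] by metis
  let ?r = "rho (H_mat N)"
  let ?len = "\<lambda>n. real (word_length (pi1 N) (delta ` {1..Suc N}) ((cyclic_aut N ^^ n) (delta i)))"
  define M where "M = Max ((\<lambda>x. cmod (v x)) ` {..N})"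
  have M: "cmod (v x) \<le> M" if "x \<le> N" for x
    unfolding M_def using that by (intro Max_ge) auto
  have "0 < cmod (v i)" using v(4) by simp
  then have M0: "0 < M" using M[OF v(3)] by (rule order.strict_trans2)
  define c where "c = cmod (v i) / M"
  have c: "0 < c" using v(4) M0 by (simp add: c_def)
  have d: "delta i \<in> carrier (pi1 N)" using v(2,3) by (intro delta_closed) auto
  have len: "?r ^ n * c \<le> ?len n" for n
  proof -
    have "refl_word N v (delta i) 0 = v i" using v(3) by (simp add: delta_def reflection_def)
    then have "?r ^ n * cmod (v i) = cmod (refl_word N v ((cyclic_aut N ^^ n) (delta i)) 0)"
      using refl_word_cyclic_aut_power[OF v(5) d, of n] by (simp add: norm_mult norm_power v(1))
    also have "\<dots> \<le> M * length ((cyclic_aut N ^^ n) (delta i))"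
      using norm_refl_word_le[of N v M "(cyclic_aut N ^^ n) (delta i)" 0] M M0 by simp
    also have "\<dots> = M * ?len n"
      by (simp add: word_length_pi1 auto_funpow_closed[OF cyclic_aut_auto d])
    finally show ?thesis using M0 by (simp add: c_def field_simps)
  qed
  have "ln ?r + ln c / real n \<le> ln (?len n) / real n" if n: "n \<ge> 1" for n
  proof -
    have "real n * ln ?r + ln c = ln (?r ^ n * c)"
      using pos c by (simp add: ln_mult ln_realpow)
    also have "\<dots> \<le> ln (?len n)"
      using len[of n] pos c by (intro ln_mono) auto
    finally have "(real n * ln ?r + ln c) / real n \<le> ln (?len n) / real n"
      by (rule divide_right_mono) simp
    then show ?thesis using n by (simp add: add_divide_distrib)
  qed
  then have "eventually (\<lambda>n. ereal (ln ?r + ln c / real n) \<le> ereal (ln (?len n) / real n)) sequentially"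
    by (auto simp: eventually_sequentially)
  then have "limsup (\<lambda>n. ereal (ln ?r + ln c / real n)) \<le> limsup (\<lambda>n. ereal (ln (?len n) / real n))"
    by (rule Limsup_mono)
  moreover have "(\<lambda>n. ln ?r + ln c / real n) \<longlonglongrightarrow> ln ?r + 0"
    by (intro tendsto_add lim_const_over_n tendsto_const)
  then have "limsup (\<lambda>n. ereal (ln ?r + ln c / real n)) = ereal (ln ?r)"
    by (intro lim_imp_Limsup) auto
  moreover have "limsup (\<lambda>n. ereal (ln (?len n) / real n))
      \<le> entropy (pi1 N) (delta ` {1..Suc N}) (cyclic_aut N)"
    unfolding entropy_def using v(2,3) by (intro Max_ge) auto
  ultimately show ?thesis by simp
qed

text \<open>Among the letters of the cyclic protocol only the last one changes \<open>\<delta>\<^sub>N\<close>, and the action on the plane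
  attached to the first unit vector detects this.\<close>

lemma cyclic_aut_not_id:
  assumes N: "2 \<le> N"
  shows "cyclic_aut N (delta N) \<noteq> delta N"
proof
  assume fixed: "cyclic_aut N (delta N) = delta N"
  define v :: "nat \<Rightarrow> complex" where "v x = (if x = 1 then 1 else 0)" for x
  have "foldr (row_update (- 1) N) ks u N = u N" if "N \<notin> set ks" for ks u
    using that by (induction ks) (auto simp: row_update_def)
  then have "cycle (- 1) N v N = row_update (- 1) N N v N"
    using N by (simp add: cycle_def)
  also have "\<dots> = (\<Sum>j=1..N. of_int (row_coeff (- 1) N j) * v j)"
    using N by (simp add: row_update_def v_def)
  also have "\<dots> = (\<Sum>j=1..N. if j = 1 then of_int (row_coeff (- 1) N j) else 0)"
    by (intro sum.cong refl) (simp add: v_def)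
  also have "\<dots> = of_int (row_coeff (- 1) N 1)" using N by simp
  also have "\<dots> \<noteq> 0" using N by (simp add: row_coeff_def)
  finally have "cycle (- 1) N v N \<noteq> 0" .
  moreover have "cycle (- 1) N v N = refl_word N (cycle (- 1) N v) (delta N) 0"
    by (simp add: delta_def reflection_def)
  moreover have "\<dots> = refl_word N v (delta N) 0"
    using refl_word_cyclic_aut[of "delta N" N v 0] fixed delta_closed[of N N] N by simp
  moreover have "\<dots> = 0" using N by (simp add: delta_def reflection_def v_def)
  ultimately show False by simp
qed

text \<open>The length of the protocol is only bounded by \<open>N\<close> from above. Since the logarithm of the spectral
  radius is nonnegative, a shorter length could but increase the efficiency.\<close>

lemma Eff_ge:
  assumes N: "2 \<le> N" and rho: "1 \<le> rho (H_mat N)"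
  shows "ereal (ln (rho (H_mat N)) / real N) \<le> Eff N"
proof -
  let ?B = "braid_group (Suc N)"
  let ?\<chi> = "eval_word ?B (alpha N) (cyclic_word N)"
  let ?L = "word_length ?B (alpha N ` {1..N}) ?\<chi>"
  note set = set_cyclic_word[of N]
  have aut: "induced_aut N ?\<chi> = cyclic_aut N"
    unfolding cyclic_aut_def by (rule induced_aut_alpha_word[OF set])
  have pp: "?\<chi> \<in> point_push N"
    unfolding cyclic_word_def by (rule positive_alpha_word_point_push) auto
  have ne: "?\<chi> \<noteq> \<one>\<^bsub>?B\<^esub>"
  proof
    assume "?\<chi> = \<one>\<^bsub>?B\<^esub>"
    then have "cyclic_aut N = (\<lambda>x\<in>carrier (pi1 N). x)"
      using aut induced_aut_alpha_word[of "[]" N] by (simp add: one_AutoGroup)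
    then show False using cyclic_aut_not_id[OF N] delta_closed[of N N] N by simp
  qed
  have "?L \<le> length (cyclic_word N)" by (rule word_length_image_le[OF set])
  moreover have "length (cyclic_word N) = N" by (simp add: cyclic_word_def del: upt_Suc)
  ultimately have LN: "?L \<le> N" by simp
  obtain u where "length u = ?L" "eval_word ?B (alpha N) u = ?\<chi>"
    by (rule word_length_image_attained[OF set, of ?B "alpha N"])
  then have L: "0 < ?L" using ne by (cases u) auto
  have "ereal (ln (rho (H_mat N)) / real N) \<le> ereal (ln (rho (H_mat N)) / real ?L)"
    using LN L rho by (simp add: divide_left_mono)
  also have "\<dots> = ereal (ln (rho (H_mat N))) / ereal (real ?L)" using L by simp
  also have "\<dots> \<le> eff N ?\<chi>"
    unfolding eff_def aut using L N rho by (intro ereal_divide_right_mono entropy_cyclic_aut_ge) auto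
  also have "\<dots> \<le> Eff N"
    unfolding Eff_def using pp ne by (intro SUP_upper) auto
  finally show ?thesis .
qed

section \<open>The bounds and the limit\<close>

theorem theorem1p1:
  shows "(\<forall>N::nat. N \<ge> 2 \<longrightarrow>
            (ln (3 ^ N - 3 * real N - 1) - ln (real N)) / real N \<le> ln (rho (H_mat N)) / real N \<and>
            ereal (ln (rho (H_mat N)) / real N) \<le> Eff N \<and>
            Eff N \<le> ereal (ln (rho (H_hat_mat N)) / real N) \<and>
            ln (rho (H_hat_mat N)) / real N \<le> ln (3 ^ N - 2) / real N) \<and>
         Eff \<longlonglongrightarrow> ereal (ln 3)"
proof -
  have bounds: "(ln (3 ^ N - 3 * real N - 1) - ln (real N)) / real N \<le> ln (rho (H_mat N)) / real N \<and>
      ereal (ln (rho (H_mat N)) / real N) \<le> Eff N \<and>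
      Eff N \<le> ereal (ln (rho (H_hat_mat N)) / real N) \<and>
      ln (rho (H_hat_mat N)) / real N \<le> ln (3 ^ N - 2) / real N" if N: "N \<ge> 2" for N :: nat
  proof (intro conjI)
    have big: "4 * real N + 1 \<le> 3 ^ N"
      using N by (induction N rule: dec_induct) auto
    have "1 \<le> (3 ^ N - 3 * real N - 1) / real N"
      using big N by (simp add: field_simps)
    then have rho: "1 \<le> rho (H_mat N)" using rho_H_mat_ge[OF N] by linarith
    have "ln (3 ^ N - 3 * real N - 1) - ln (real N) = ln ((3 ^ N - 3 * real N - 1) / real N)"
      using big N by (simp add: ln_div)
    also have "\<dots> \<le> ln (rho (H_mat N))"
      using rho_H_mat_ge[OF N] big N by (intro ln_mono divide_pos_pos) auto
    finally show "(ln (3 ^ N - 3 * real N - 1) - ln (real N)) / real N \<le> ln (rho (H_mat N)) / real N"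
      by (rule divide_right_mono) simp
    show "ereal (ln (rho (H_mat N)) / real N) \<le> Eff N" by (rule Eff_ge[OF N rho])
    show "Eff N \<le> ereal (ln (rho (H_hat_mat N)) / real N)" by (rule Eff_le(1)[OF N])
    have "ln (rho (H_hat_mat N)) \<le> ln (3 ^ N - 2)"
      using rho_H_hat_mat_le[of N] Eff_le(2)[OF N] N by (intro ln_mono) auto
    then show "ln (rho (H_hat_mat N)) / real N \<le> ln (3 ^ N - 2) / real N"
      by (rule divide_right_mono) simp
  qed
  have "Eff \<longlonglongrightarrow> ereal (ln 3)"
  proof (rule tendsto_sandwich)
    have "(\<lambda>N::nat. (ln (3 ^ N - 3 * real N - 1) - ln (real N)) / real N) \<longlonglongrightarrow> ln 3"
      by real_asymp
    then show "(\<lambda>N::nat. ereal ((ln (3 ^ N - 3 * real N - 1) - ln (real N)) / real N)) \<longlonglongrightarrow> ereal (ln 3)"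
      by (rule tendsto_ereal)
    have "(\<lambda>N::nat. ln (3 ^ N - 2) / real N) \<longlonglongrightarrow> ln 3"
      by real_asymp
    then show "(\<lambda>N::nat. ereal (ln (3 ^ N - 2) / real N)) \<longlonglongrightarrow> ereal (ln 3)"
      by (rule tendsto_ereal)
    have "ereal ((ln (3 ^ N - 3 * real N - 1) - ln (real N)) / real N) \<le> Eff N" if "N \<ge> 2" for N :: nat
      using bounds[OF that] by (meson ereal_less_eq(3) order.trans)
    then show "eventually (\<lambda>N. ereal ((ln (3 ^ N - 3 * real N - 1) - ln (real N)) / real N) \<le> Eff N) sequentially"
      by (auto simp: eventually_sequentially)
    have "Eff N \<le> ereal (ln (3 ^ N - 2) / real N)" if "N \<ge> 2" for N :: nat
      using bounds[OF that] by (meson ereal_less_eq(3) order.trans)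
    then show "eventually (\<lambda>N. Eff N \<le> ereal (ln (3 ^ N - 2) / real N)) sequentially"
      by (auto simp: eventually_sequentially)
  qed
  with bounds show ?thesis by blast
qed

end
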